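(* Let $k$ be a field, let $d\ge 3$ be an integer, and let $G$ be a connected $C_3$-free unicyclic graph on $[n]$ with $\Delta(G)>d$. Then $L_G(d)$ is an almost complete intersection if and only if $G$ has one of the following forms: (1) $G$ is obtained by adding an edge between two vertices of a tree $H$ with $V(H)=V(G)$ and $\Delta(H)\le d$; (2) $G$ is obtained by adding an edge between (a vertex of) a tree $H$ and (a vertex of) a unicyclic graph $U$, where $H$ and $U$ are vertex-disjoint, $V(H)\cup V(U)=V(G)$, $\Delta(H)\le d$ and $\Delta(U)\le d$.
   Context: Graphs are finite, simple and undirected, with vertex set $V(G)=[n]=\{1,\dots,n\}$ and edge set $E(G)$. $\Delta(G)$ is the maximal degree of a vertex of $G$. $G$ is unicyclic if it contains precisely one cycle as a subgraph; $C_3$-free means that it contains no triangle $C_3$. For a field $k$ and $d\ge1$, the LSS-ideal of $G$ is $$L_G(d)=\Big(f_e^{(d)}=\sum_{\ell=1}^d x_{i\ell}x_{j\ell}\ :\ e=\{i,j\}\in E(G)\Big)\subset S=k[x_{ij}: i\in[n],\ j\in[d]].$$ An ideal is a complete intersection if its minimal number of generators equals its height. An ideal $I$ is an almost complete intersection if its minimal number of generators is one more than its height and $I_{\mathfrak p}$ is a complete intersection for every minimal prime $\mathfrak p$ of $I$. *)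

theory Defs
  imports "HOL-Algebra.Ideal" "HOL-Library.Poly_Mapping" "HOL-Library.Extended_Nat"
begin

section \<open>Finite simple graphs\<close>

definition simple_graph :: "'v set \<Rightarrow> 'v set set \<Rightarrow> bool" where
  "simple_graph V E \<longleftrightarrow> finite V \<and> (\<forall>e\<in>E. e \<subseteq> V \<and> card e = 2)"

definition vdegree :: "'v set set \<Rightarrow> 'v \<Rightarrow> nat" where
  "vdegree E v = card {e \<in> E. v \<in> e}"

text \<open>Only meaningful for a nonempty vertex set.\<close>

definition max_degree :: "'v set \<Rightarrow> 'v set set \<Rightarrow> nat" where
  "max_degree V E = Max (vdegree E ` V)"

definition connected_graph :: "'v set \<Rightarrow> 'v set set \<Rightarrow> bool" where
  "connected_graph V E \<longleftrightarrow> simple_graph V E \<and> V \<noteq> {} \<and>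
     (\<forall>u\<in>V. \<forall>v\<in>V. (u, v) \<in> {(x, y). {x, y} \<in> E}\<^sup>*)"

text \<open>A cycle subgraph has no isolated vertices, so it is identified with its set of edges.
  Cyclic shifts and reversals of the list of vertices yield the same cycle.\<close>

definition cycle_edges :: "'v list \<Rightarrow> 'v set set" where
  "cycle_edges vs = {{vs ! i, vs ! (Suc i mod length vs)} | i. i < length vs}"

definition cycles :: "'v set set \<Rightarrow> 'v set set set" where
  "cycles E = {cycle_edges vs | vs. distinct vs \<and> 3 \<le> length vs \<and> cycle_edges vs \<subseteq> E}"

definition tree :: "'v set \<Rightarrow> 'v set set \<Rightarrow> bool" where
  "tree V E \<longleftrightarrow> connected_graph V E \<and> cycles E = {}"

text \<open>A unicyclic graph need not be connected.\<close>

definition unicyclic :: "'v set \<Rightarrow> 'v set set \<Rightarrow> bool" where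
  "unicyclic V E \<longleftrightarrow> simple_graph V E \<and> (\<exists>!C. C \<in> cycles E)"

definition triangle_free :: "'v set set \<Rightarrow> bool" where
  "triangle_free E \<longleftrightarrow> \<not> (\<exists>x y z. distinct [x, y, z] \<and> {x, y} \<in> E \<and> {y, z} \<in> E \<and> {z, x} \<in> E)"


section \<open>Height, number of generators and localization\<close>

definition prime_height :: "('a, 'b) ring_scheme \<Rightarrow> 'a set \<Rightarrow> enat" where
  "prime_height R P = Sup {enat m | m. \<exists>c :: nat \<Rightarrow> 'a set.
     (\<forall>i\<le>m. primeideal (c i) R) \<and> (\<forall>i<m. c i \<subset> c (Suc i)) \<and> c m = P}"

text \<open>The unit ideal has height \<open>\<infinity>\<close>.\<close>

definition ideal_height :: "('a, 'b) ring_scheme \<Rightarrow> 'a set \<Rightarrow> enat" where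
  "ideal_height R I = Inf {prime_height R P | P. primeideal P R \<and> I \<subseteq> P}"

text \<open>The value is \<open>\<infinity>\<close> if the ideal is not finitely generated.\<close>

definition min_gens :: "('a, 'b) ring_scheme \<Rightarrow> 'a set \<Rightarrow> enat" where
  "min_gens R I = Inf {enat (card A) | A. finite A \<and> A \<subseteq> carrier R \<and> genideal R A = I}"

definition minimal_primes :: "('a, 'b) ring_scheme \<Rightarrow> 'a set \<Rightarrow> 'a set set" where
  "minimal_primes R I = {P. primeideal P R \<and> I \<subseteq> P \<and>
     (\<forall>Q. primeideal Q R \<and> I \<subseteq> Q \<and> Q \<subseteq> P \<longrightarrow> Q = P)}"

text \<open>\<open>loc_frac R P a s\<close> is the fraction \<open>a / s\<close> of the localization at the prime ideal \<open>P\<close>, as an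
  equivalence class of pairs. The unions in the ring operations below run over
  representatives; all members of such a union are the same class.\<close>

definition loc_frac :: "('a, 'b) ring_scheme \<Rightarrow> 'a set \<Rightarrow> 'a \<Rightarrow> 'a \<Rightarrow> ('a \<times> 'a) set" where
  "loc_frac R P a s = {(b, t). b \<in> carrier R \<and> t \<in> carrier R - P \<and>
     (\<exists>u\<in>carrier R - P. u \<otimes>\<^bsub>R\<^esub> (a \<otimes>\<^bsub>R\<^esub> t) = u \<otimes>\<^bsub>R\<^esub> (b \<otimes>\<^bsub>R\<^esub> s))}"

definition localization :: "('a, 'b) ring_scheme \<Rightarrow> 'a set \<Rightarrow> ('a \<times> 'a) set ring" where
  "localization R P = \<lparr>
     carrier = {loc_frac R P a s | a s. a \<in> carrier R \<and> s \<in> carrier R - P},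
     mult = (\<lambda>A B. \<Union>{loc_frac R P (a \<otimes>\<^bsub>R\<^esub> b) (s \<otimes>\<^bsub>R\<^esub> t) | a s b t.
       (a, s) \<in> A \<and> (b, t) \<in> B}),
     one = loc_frac R P \<one>\<^bsub>R\<^esub> \<one>\<^bsub>R\<^esub>,
     zero = loc_frac R P \<zero>\<^bsub>R\<^esub> \<one>\<^bsub>R\<^esub>,
     add = (\<lambda>A B. \<Union>{loc_frac R P (a \<otimes>\<^bsub>R\<^esub> t \<oplus>\<^bsub>R\<^esub> b \<otimes>\<^bsub>R\<^esub> s) (s \<otimes>\<^bsub>R\<^esub> t) | a s b t.
       (a, s) \<in> A \<and> (b, t) \<in> B})\<rparr>"

definition localized_ideal :: "('a, 'b) ring_scheme \<Rightarrow> 'a set \<Rightarrow> 'a set \<Rightarrow> ('a \<times> 'a) set set" where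
  "localized_ideal R P I = {loc_frac R P a s | a s. a \<in> I \<and> s \<in> carrier R - P}"

definition complete_intersection :: "('a, 'b) ring_scheme \<Rightarrow> 'a set \<Rightarrow> bool" where
  "complete_intersection R I \<longleftrightarrow> ideal I R \<and> min_gens R I = ideal_height R I"

definition almost_complete_intersection :: "('a, 'b) ring_scheme \<Rightarrow> 'a set \<Rightarrow> bool" where
  "almost_complete_intersection R I \<longleftrightarrow> ideal I R \<and> min_gens R I = ideal_height R I + 1 \<and>
     (\<forall>P\<in>minimal_primes R I. complete_intersection (localization R P) (localized_ideal R P I))"


section \<open>Polynomial rings and LSS-ideals\<close>

type_synonym ('x, 'k) mpoly = "('x \<Rightarrow>\<^sub>0 nat) \<Rightarrow>\<^sub>0 'k"

definition poly_ring :: "'x set \<Rightarrow> ('x, 'k::field) mpoly ring" where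
  "poly_ring I = \<lparr>
     carrier = {p. \<forall>m\<in>Poly_Mapping.keys p. Poly_Mapping.keys m \<subseteq> I},
     mult = (*), one = 1, zero = 0, add = (+)\<rparr>"

definition indet :: "'x \<Rightarrow> ('x, 'k::field) mpoly" where
  "indet x = Poly_Mapping.single (Poly_Mapping.single x 1) 1"

definition lss_ring :: "nat \<Rightarrow> nat \<Rightarrow> (nat \<times> nat, 'k::field) mpoly ring" where
  "lss_ring n d = poly_ring ({1..n} \<times> {1..d})"

text \<open>For an edge \<open>e = {i, j}\<close> the generator \<open>lss_poly d i j\<close> does not depend on the order of
  \<open>i\<close> and \<open>j\<close>.\<close>

definition lss_poly :: "nat \<Rightarrow> nat \<Rightarrow> nat \<Rightarrow> (nat \<times> nat, 'k::field) mpoly" where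
  "lss_poly d i j = (\<Sum>l = 1..d. indet (i, l) * indet (j, l))"

definition lss_ideal :: "nat \<Rightarrow> nat \<Rightarrow> nat set set \<Rightarrow> (nat \<times> nat, 'k::field) mpoly set" where
  "lss_ideal n d E = genideal (lss_ring n d) {lss_poly d i j | i j. {i, j} \<in> E}"

end

theory Submission
  imports Defs "HOL-Computational_Algebra.Polynomial" "HOL-Computational_Algebra.Fraction_Field"
    "HOL-Library.Product_Lexorder"
begin

text \<open>The quadrics of the edges are linearly independent and homogeneous of the same degree, so the
  ideal \<open>L\<close> of the graph needs exactly one generator per edge (\<open>lss_min_gens\<close>), and the theorem is a
  statement about the height of \<open>L\<close> and about its localizations.

  \<^bold>\<open>Upper bounds.\<close> If all variables of the vertices in a set \<open>B\<close> vanish, so do the quadrics of all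
  edges that meet \<open>B\<close>. By Krull's height theorem the height of \<open>L\<close> is at most \<open>d |B|\<close> plus the number
  of edges that miss \<open>B\<close> (\<open>lss_height_le\<close>). A vertex of degree greater than \<open>d\<close> thus pushes the height
  down to \<open>|E| - 1\<close>, and a vertex of degree at least \<open>d + 2\<close>, or two nonadjacent vertices of degree
  greater than \<open>d\<close>, pushes it down to \<open>|E| - 2\<close>.

  \<^bold>\<open>Combinatorics.\<close> A cycle edge can be removed without disconnecting the graph, and any other edge
  is a bridge. Hence one of the two forms is present exactly if all degrees drop to at most \<open>d\<close>
  after the removal of a suitable edge (\<open>forms_iff_edge_removal\<close>). If no edge is suitable, there
  are either too many vertices of degree greater than \<open>d\<close> or one of degree at least \<open>d + 2\<close>; as three
  mutually adjacent vertices are excluded, one finds a set \<open>B\<close> for which the height is at most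
  \<open>|E| - 2\<close> (\<open>obstruction\<close>), too small for an almost complete intersection.

  \<^bold>\<open>Lower bounds.\<close> Now suppose that all degrees of \<open>E - {e}\<close> are at most \<open>d\<close>. This graph has at most
  one cycle. Removing leaves until only a cycle remains, one finds a proper edge colouring with \<open>d\<close>
  colours and weights of the variables such that, in the quadric of an edge \<open>{i, j}\<close> of colour \<open>c\<close>, the
  monomial of the coordinates \<open>c\<close> has strictly the largest weight (\<open>weighted_colouring_exists\<close>; the
  cycle is responsible for \<open>d \<ge> 3\<close>). These leading monomials are squarefree and pairwise coprime.
  Division with remainder shows that the quadrics form a regular sequence and that the ideal \<open>J\<close>
  that they generate is radical (locale \<open>coprime_leads\<close>). So the height of \<open>L\<close> is \<open>|E| - 1\<close>. Let \<open>P\<close> be a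
  minimal prime of \<open>L\<close>. If \<open>P\<close> is minimal over \<open>J\<close>, the last quadric lies in \<open>J\<close> locally at \<open>P\<close> because
  \<open>J\<close> is radical; so \<open>L\<close> is locally generated by \<open>|E| - 1\<close> elements, and \<open>P\<close> has at least this height.
  Otherwise \<open>P\<close> strictly contains a prime over \<open>J\<close> and has height at least \<open>|E|\<close>. In both cases
  Krull's theorem in the local ring turns the inequality into equality
  (\<open>almost_complete_intersection_extend\<close>).

  The commutative algebra is done for a subring \<open>T\<close> of a type that is itself a commutative ring, so
  that all calculations take place in a type class. Rings with an explicit carrier are reached by
  an injective parametrization (locale \<open>represented_ring\<close>): polynomial rings by the identity, the
  localization at a prime by the fractions in the field of fractions.\<close>

section \<open>Ideals of a subring\<close>

locale subring_set =
  fixes T :: "'a::comm_ring_1 set"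
  assumes one_in: "1 \<in> T"
    and diff_in: "x \<in> T \<Longrightarrow> y \<in> T \<Longrightarrow> x - y \<in> T"
    and mult_in: "x \<in> T \<Longrightarrow> y \<in> T \<Longrightarrow> x * y \<in> T"
begin

lemma zero_in: "0 \<in> T"
  using diff_in[OF one_in one_in] by simp

lemma uminus_in: "x \<in> T \<Longrightarrow> - x \<in> T"
  using diff_in[OF zero_in] by force

lemma add_in: "x \<in> T \<Longrightarrow> y \<in> T \<Longrightarrow> x + y \<in> T"
  using diff_in[OF _ uminus_in] by force

lemma power_in: "x \<in> T \<Longrightarrow> x ^ k \<in> T"
  by (induction k) (auto simp: one_in mult_in)

lemma sum_in: "(\<And>i. i \<in> A \<Longrightarrow> f i \<in> T) \<Longrightarrow> sum f A \<in> T"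
  by (induction A rule: infinite_finite_induct) (auto simp: zero_in add_in)

lemmas ring_in = one_in zero_in diff_in mult_in uminus_in add_in power_in

end

definition ideal_in :: "'a::comm_ring_1 set \<Rightarrow> 'a set \<Rightarrow> bool" where
  "ideal_in T I \<longleftrightarrow> I \<subseteq> T \<and> 0 \<in> I \<and> (\<forall>x\<in>I. \<forall>y\<in>I. x + y \<in> I) \<and> (\<forall>r\<in>T. \<forall>x\<in>I. r * x \<in> I)"

definition prime_in :: "'a::comm_ring_1 set \<Rightarrow> 'a set \<Rightarrow> bool" where
  "prime_in T P \<longleftrightarrow> ideal_in T P \<and> 1 \<notin> P \<and> (\<forall>x\<in>T. \<forall>y\<in>T. x * y \<in> P \<longrightarrow> x \<in> P \<or> y \<in> P)"

inductive_set gen :: "'a::comm_ring_1 set \<Rightarrow> 'a set \<Rightarrow> 'a set" for T A where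
  gen_zero: "0 \<in> gen T A"
| gen_step: "x \<in> gen T A \<Longrightarrow> r \<in> T \<Longrightarrow> a \<in> A \<Longrightarrow> r * a + x \<in> gen T A"

definition adjoin :: "'a::comm_ring_1 set \<Rightarrow> 'a set \<Rightarrow> 'a \<Rightarrow> 'a set" where
  "adjoin T I a = {x + r * a | x r. x \<in> I \<and> r \<in> T}"

definition noetherian :: "'a::comm_ring_1 set \<Rightarrow> bool" where
  "noetherian T \<longleftrightarrow> (\<forall>I. ideal_in T I \<longrightarrow> (\<exists>A. finite A \<and> A \<subseteq> I \<and> gen T A = I))"

definition minimal_over :: "'a::comm_ring_1 set \<Rightarrow> 'a set \<Rightarrow> 'a set \<Rightarrow> bool" where
  "minimal_over T A P \<longleftrightarrow> prime_in T P \<and> A \<subseteq> P \<and>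
     (\<forall>Q. prime_in T Q \<longrightarrow> A \<subseteq> Q \<longrightarrow> Q \<subseteq> P \<longrightarrow> Q = P)"

definition prime_chain :: "'a::comm_ring_1 set \<Rightarrow> 'a set \<Rightarrow> nat \<Rightarrow> (nat \<Rightarrow> 'a set) \<Rightarrow> bool" where
  "prime_chain T P m c \<longleftrightarrow>
     (\<forall>i\<le>m. prime_in T (c i)) \<and> (\<forall>i<m. c i \<subset> c (Suc i)) \<and> c m = P"

lemma ideal_inD:
  assumes "ideal_in T I"
  shows "x \<in> I \<Longrightarrow> x \<in> T" "0 \<in> I" "x \<in> I \<Longrightarrow> y \<in> I \<Longrightarrow> x + y \<in> I"
    "r \<in> T \<Longrightarrow> x \<in> I \<Longrightarrow> r * x \<in> I" "r \<in> T \<Longrightarrow> x \<in> I \<Longrightarrow> x * r \<in> I"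
  using assms unfolding ideal_in_def by (auto simp: mult.commute)

lemma prime_inD:
  assumes "prime_in T P"
  shows "ideal_in T P" "1 \<notin> P" "x \<in> T \<Longrightarrow> y \<in> T \<Longrightarrow> x * y \<in> P \<Longrightarrow> x \<in> P \<or> y \<in> P"
  using assms unfolding prime_in_def by auto

lemma ideal_lin: "ideal_in T I \<Longrightarrow> r \<in> T \<Longrightarrow> s \<in> T \<Longrightarrow> x \<in> I \<Longrightarrow> y \<in> I \<Longrightarrow> r * x + s * y \<in> I"
  by (simp add: ideal_inD)

lemma noetherianE:
  assumes "noetherian T" "ideal_in T I"
  obtains A where "finite A" "A \<subseteq> I" "gen T A = I"
  using assms unfolding noetherian_def by blast

lemma gen_least:
  assumes "ideal_in T I" "A \<subseteq> I" shows "gen T A \<subseteq> I"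
proof
  fix x assume "x \<in> gen T A"
  then show "x \<in> I"
    by induction (use assms in \<open>auto simp: ideal_in_def\<close>)
qed

context subring_set
begin

lemma ideal_uminus: "ideal_in T I \<Longrightarrow> x \<in> I \<Longrightarrow> - x \<in> I"
  using ideal_inD(4)[of T I "-1" x] uminus_in[OF one_in] by simp

lemma ideal_diff: "ideal_in T I \<Longrightarrow> x \<in> I \<Longrightarrow> y \<in> I \<Longrightarrow> x - y \<in> I"
  using ideal_inD(3)[of T I x "- y"] ideal_uminus by simp

lemma ideal_sum: "ideal_in T I \<Longrightarrow> (\<And>i. i \<in> A \<Longrightarrow> f i \<in> I) \<Longrightarrow> sum f A \<in> I"
  by (induction A rule: infinite_finite_induct) (auto simp: ideal_inD)

lemma ideal_add_cancel: "ideal_in T I \<Longrightarrow> x \<in> I \<Longrightarrow> x + y \<in> I \<longleftrightarrow> y \<in> I"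
  using ideal_diff[of I "x + y" x] ideal_inD(3) by auto

lemma ideal_eq_ring: "ideal_in T I \<Longrightarrow> 1 \<in> I \<Longrightarrow> I = T"
  using ideal_inD(4)[of T I _ 1] ideal_inD(1) by auto

lemma gen_ideal:
  assumes "A \<subseteq> T" shows "ideal_in T (gen T A)"
proof -
  have "x \<in> T" if "x \<in> gen T A" for x
    using that by induction (use assms in \<open>auto simp: ring_in\<close>)
  moreover have "x + y \<in> gen T A" if "x \<in> gen T A" "y \<in> gen T A" for x y
    using that by induction (auto simp: add.assoc intro: gen_step)
  moreover have "s * x \<in> gen T A" if "x \<in> gen T A" "s \<in> T" for s x
    using that
  proof induction
    case (gen_step x r a)
    then have "(s * r) * a + s * x \<in> gen T A"
      by (intro gen.gen_step) (auto simp: ring_in)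
    then show ?case by (simp add: algebra_simps)
  qed (auto intro: gen_zero)
  ultimately show ?thesis
    unfolding ideal_in_def by (auto intro: gen_zero)
qed

lemma gen_incl: "a \<in> A \<Longrightarrow> a \<in> gen T A"
  using gen_step[OF gen_zero one_in, of a A] by simp

lemma gen_mono: "A \<subseteq> B \<Longrightarrow> B \<subseteq> T \<Longrightarrow> gen T A \<subseteq> gen T B"
  by (intro gen_least gen_ideal) (auto intro: gen_incl)

lemma gen_of_ideal: "ideal_in T I \<Longrightarrow> gen T I = I"
  using gen_least[of T I I] gen_incl by auto

lemma adjoin_ideal:
  assumes "ideal_in T I" "a \<in> T" shows "ideal_in T (adjoin T I a)"
  unfolding ideal_in_def
proof (intro conjI ballI)
  show "adjoin T I a \<subseteq> T"
    using assms by (auto simp: adjoin_def ring_in ideal_inD)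
  show "0 \<in> adjoin T I a"
    unfolding adjoin_def using ideal_inD(2)[OF assms(1)] zero_in by force
  fix x assume "x \<in> adjoin T I a"
  then obtain u r where x: "x = u + r * a" "u \<in> I" "r \<in> T"
    unfolding adjoin_def by auto
  { fix y assume "y \<in> adjoin T I a"
    then obtain v s where y: "y = v + s * a" "v \<in> I" "s \<in> T"
      unfolding adjoin_def by auto
    have "x + y = (u + v) + (r + s) * a" using x y by (simp add: algebra_simps)
    then show "x + y \<in> adjoin T I a"
      unfolding adjoin_def using x y add_in ideal_inD(3)[OF assms(1)] by blast }
  { fix t assume t: "t \<in> T"
    have "t * x = t * u + (t * r) * a" using x by (simp add: algebra_simps)
    then show "t * x \<in> adjoin T I a"
      unfolding adjoin_def using x t assms ring_in(4) ideal_inD(4)[OF assms(1)] by blast }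
qed

lemma adjoin_incl: "x \<in> I \<Longrightarrow> x \<in> adjoin T I a"
  unfolding adjoin_def using zero_in by force

lemma adjoin_elem: "ideal_in T I \<Longrightarrow> a \<in> adjoin T I a"
  unfolding adjoin_def using one_in ideal_inD(2) by force

lemma adjoin_least: "ideal_in T J \<Longrightarrow> I \<subseteq> J \<Longrightarrow> a \<in> J \<Longrightarrow> adjoin T I a \<subseteq> J"
  unfolding adjoin_def by (auto simp: ideal_inD subset_iff)

lemma gen_insert:
  assumes "A \<subseteq> T" "a \<in> T"
  shows "gen T (insert a A) = adjoin T (gen T A) a"
proof
  have "adjoin T (gen T A) a \<subseteq> gen T (insert a A)"
    by (rule adjoin_least)
       (use assms gen_ideal[of "insert a A"] gen_mono[of A "insert a A"] gen_incl in auto)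
  then show "adjoin T (gen T A) a \<subseteq> gen T (insert a A)" .
  show "gen T (insert a A) \<subseteq> adjoin T (gen T A) a"
    by (rule gen_least[OF adjoin_ideal])
       (use assms gen_ideal gen_incl adjoin_incl adjoin_elem in auto)
qed

lemma prime_power: "prime_in T P \<Longrightarrow> x \<in> T \<Longrightarrow> x ^ k \<in> P \<Longrightarrow> x \<in> P"
proof (induction k)
  case (Suc k)
  then show ?case using prime_inD(3)[of T P x "x ^ k"] power_in by auto
qed (auto dest: prime_inD)

lemma prime_compl_mult: "prime_in T P \<Longrightarrow> s \<in> T - P \<Longrightarrow> t \<in> T - P \<Longrightarrow> s * t \<in> T - P"
  using prime_inD(3)[of T P s t] mult_in by auto

end

section \<open>Noetherian rings and Krull's height theorem\<close>

lemma (in subring_set) noetherian_maximal: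
  assumes "noetherian T" "F \<noteq> {}" "\<And>I. I \<in> F \<Longrightarrow> ideal_in T I"
  shows "\<exists>M\<in>F. \<forall>J\<in>F. \<not> M \<subset> J"
proof (rule ccontr)
  assume "\<not> ?thesis"
  then have ex: "\<And>M. M \<in> F \<Longrightarrow> \<exists>J\<in>F. M \<subset> J" by blast
  obtain I0 where I0: "I0 \<in> F" using assms by auto
  obtain c where c: "\<And>n. c n \<in> F" "\<And>n. c n \<subset> c (Suc n)"
    using dependent_nat_choice[of "\<lambda>_ I. I \<in> F" "\<lambda>_ I J. I \<subset> J"] I0 ex by metis
  have mono: "c i \<subseteq> c j" if "i \<le> j" for i j
    by (rule lift_Suc_mono_le[OF _ that]) (use c in auto)
  define U where "U = (\<Union>n. c n)"
  have "ideal_in T U"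
    unfolding ideal_in_def
  proof (intro conjI ballI)
    show "U \<subseteq> T" "0 \<in> U"
      using ideal_inD(1,2)[OF assms(3)[OF c(1)]] by (auto simp: U_def)
    fix x assume "x \<in> U"
    then obtain i where i: "x \<in> c i" by (auto simp: U_def)
    { fix y assume "y \<in> U"
      then obtain j where j: "y \<in> c j" by (auto simp: U_def)
      have "x + y \<in> c (max i j)"
        using i j mono[of i "max i j"] mono[of j "max i j"] assms(3)[OF c(1)]
        by (auto intro!: ideal_inD(3))
      then show "x + y \<in> U" by (auto simp: U_def) }
    { fix r assume "r \<in> T"
      then show "r * x \<in> U"
        using i assms(3)[OF c(1)] by (auto simp: U_def intro!: ideal_inD(4)) }
  qed
  then obtain A where A: "finite A" "A \<subseteq> U" "gen T A = U"
    using noetherianE[OF assms(1)] by blast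
  have "\<exists>n. A \<subseteq> c n"
    using A(1,2)
  proof induction
    case (insert x A)
    then obtain n i where "A \<subseteq> c n" "x \<in> c i" by (auto simp: U_def)
    then have "insert x A \<subseteq> c (max n i)"
      using mono[of n "max n i"] mono[of i "max n i"] by auto
    then show ?case by blast
  qed auto
  then obtain n where "A \<subseteq> c n" by blast
  then have "U \<subseteq> c n" using gen_least[OF assms(3)[OF c(1)]] A by blast
  then show False using c(2)[of n] by (auto simp: U_def)
qed

lemma (in subring_set) noetherian_induct [consumes 2, case_names step]:
  assumes "noetherian T" "ideal_in T I"
    and step: "\<And>I. ideal_in T I \<Longrightarrow> (\<And>J. ideal_in T J \<Longrightarrow> I \<subset> J \<Longrightarrow> P J) \<Longrightarrow> P I"
  shows "P I"
proof (rule ccontr)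
  assume "\<not> P I"
  then have "{I. ideal_in T I \<and> \<not> P I} \<noteq> {}" using assms by blast
  from noetherian_maximal[OF assms(1) this] obtain M
    where "ideal_in T M" "\<not> P M" "\<And>J. ideal_in T J \<Longrightarrow> \<not> P J \<Longrightarrow> \<not> M \<subset> J" by auto
  then show False using step by blast
qed

text \<open>An ideal that is maximal among those avoiding \<open>M\<close> is prime: two elements outside it produce
  two elements of \<open>M\<close>, and the product of these would lie in the ideal if the product of the former did.\<close>

lemma (in subring_set) prime_avoiding:
  assumes "noetherian T" "ideal_in T I" "M \<subseteq> T" "1 \<in> M"
    and M: "\<And>x y. x \<in> M \<Longrightarrow> y \<in> M \<Longrightarrow> x * y \<in> M" and "I \<inter> M = {}"
  obtains Q where "prime_in T Q" "I \<subseteq> Q" "Q \<inter> M = {}"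
proof -
  define F where "F = {J. ideal_in T J \<and> I \<subseteq> J \<and> J \<inter> M = {}}"
  have "F \<noteq> {}" using assms by (auto simp: F_def)
  from noetherian_maximal[OF assms(1) this] obtain Q
    where Q: "Q \<in> F" and max: "\<And>J. J \<in> F \<Longrightarrow> \<not> Q \<subset> J" unfolding F_def by auto
  have Qi: "ideal_in T Q" and IQ: "I \<subseteq> Q" and QM: "Q \<inter> M = {}" using Q by (auto simp: F_def)
  have meet: "\<exists>u\<in>Q. \<exists>r\<in>T. u + r * x \<in> M" if "x \<in> T" "x \<notin> Q" for x
  proof -
    have "Q \<subset> adjoin T Q x" using that adjoin_incl adjoin_elem[OF Qi] by blast
    then have "adjoin T Q x \<notin> F" using max by blast
    then have "adjoin T Q x \<inter> M \<noteq> {}"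
      using adjoin_ideal[OF Qi that(1)] IQ adjoin_incl unfolding F_def by blast
    then show ?thesis unfolding adjoin_def by blast
  qed
  have "prime_in T Q"
    unfolding prime_in_def
  proof (intro conjI ballI impI)
    show "1 \<notin> Q" using QM assms by auto
    fix x y assume xy: "x \<in> T" "y \<in> T" "x * y \<in> Q"
    show "x \<in> Q \<or> y \<in> Q"
    proof (rule ccontr)
      assume n: "\<not> ?thesis"
      then obtain u r v s where *: "u \<in> Q" "r \<in> T" "u + r * x \<in> M" "v \<in> Q" "s \<in> T" "v + s * y \<in> M"
        using meet xy by metis
      have "(u + r * x) * (v + s * y) = (v + s * y) * u + ((r * x) * v + (r * s) * (x * y))"
        by (simp add: algebra_simps)
      also have "\<dots> \<in> Q"
      proof -
        have "v \<in> T" "u \<in> T" using * Qi ideal_inD(1) by blast+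
        then have "v + s * y \<in> T" "r * x \<in> T" "r * s \<in> T" using * xy by (auto simp: ring_in)
        then have "(v + s * y) * u \<in> Q" "(r * x) * v \<in> Q" "(r * s) * (x * y) \<in> Q"
          using * xy ideal_inD(4)[OF Qi] by blast+
        then show ?thesis using ideal_inD(3)[OF Qi] by blast
      qed
      finally show False using M[OF *(3,6)] QM by blast
    qed
  qed (fact Qi)
  then show ?thesis using that IQ QM by blast
qed

text \<open>This replaces nilpotency of \<open>P\<close> in the localization modulo \<open>A\<close>. If no such \<open>s\<close> and \<open>k\<close>
  existed, some prime over \<open>A\<close> would avoid all the products \<open>s x\<^sup>k\<close>; it would be contained in \<open>P\<close> and
  miss \<open>x\<close>.\<close>

lemma (in subring_set) minimal_over_power:
  assumes "noetherian T" "A \<subseteq> T" "minimal_over T A P" "x \<in> P"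
  obtains s k where "s \<in> T" "s \<notin> P" "s * x ^ k \<in> gen T A"
proof (rule ccontr)
  assume neg: "\<not> thesis"
  have P: "prime_in T P" "ideal_in T P" "A \<subseteq> P" using assms(3) unfolding minimal_over_def by (auto dest: prime_inD)
  have xT: "x \<in> T" using P assms(4) ideal_inD by blast
  define M where "M = {s * x ^ k | s k. s \<in> T \<and> s \<notin> P}"
  have "gen T A \<inter> M = {}" using neg that by (auto simp: M_def)
  have one: "1 \<notin> P" using P prime_inD by blast
  obtain Q where Q: "prime_in T Q" "gen T A \<subseteq> Q" "Q \<inter> M = {}"
  proof (rule prime_avoiding[OF assms(1) gen_ideal[OF assms(2)], of M])
    show "M \<subseteq> T" using xT by (auto simp: M_def ring_in)
    show "1 \<in> M" unfolding M_def using one one_in by (intro CollectI exI[of _ 1] exI[of _ 0]) auto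
    show "a * b \<in> M" if ab: "a \<in> M" "b \<in> M" for a b
    proof -
      from ab obtain s k t l where *: "a = s * x ^ k" "b = t * x ^ l" "s \<in> T - P" "t \<in> T - P"
        unfolding M_def by blast
      then have "a * b = (s * t) * x ^ (k + l)" by (simp add: power_add algebra_simps)
      then show ?thesis unfolding M_def using prime_compl_mult[OF P(1) *(3,4)] by blast
    qed
  qed (use \<open>gen T A \<inter> M = {}\<close> in auto)
  have "Q \<subseteq> P"
  proof
    fix y assume y: "y \<in> Q"
    then have "y \<in> T" using Q(1) by (auto dest: prime_inD ideal_inD)
    then show "y \<in> P"
      using y Q(3) unfolding M_def by (metis (mono_tags, lifting) IntI empty_iff mem_Collect_eq mult.right_neutral power_0)
  qed
  moreover have "A \<subseteq> Q" using Q(2) gen_incl by blast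
  ultimately have "Q = P" using Q(1) assms(3) unfolding minimal_over_def by blast
  moreover have "x \<in> M"
    unfolding M_def using one one_in by (intro CollectI exI[of _ 1] exI[of _ "Suc 0"]) auto
  ultimately show False using Q(3) assms(4) by blast
qed

text \<open>Ideals of the localization at \<open>P\<close> correspond to the ideals that are closed in this sense;
  the saturation is the contraction of the extended ideal. Working with them avoids passing to
  the local ring in the proof of Krull's theorem.\<close>

definition closed_at :: "'a::comm_ring_1 set \<Rightarrow> 'a set \<Rightarrow> 'a set \<Rightarrow> bool" where
  "closed_at T P I \<longleftrightarrow> (\<forall>s\<in>T - P. \<forall>x\<in>T. s * x \<in> I \<longrightarrow> x \<in> I)"

definition saturation :: "'a::comm_ring_1 set \<Rightarrow> 'a set \<Rightarrow> 'a set \<Rightarrow> 'a set" where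
  "saturation T P I = {x \<in> T. \<exists>s\<in>T - P. s * x \<in> I}"

context subring_set
begin

lemma saturation_ideal:
  assumes P: "prime_in T P" and I: "ideal_in T I"
  shows "ideal_in T (saturation T P I)" "closed_at T P (saturation T P I)" "I \<subseteq> saturation T P I"
proof -
  have one: "1 \<in> T - P" using P one_in by (auto dest: prime_inD)
  show "I \<subseteq> saturation T P I"
    unfolding saturation_def using one ideal_inD(1)[OF I] by (auto intro!: bexI[of _ 1])
  show "closed_at T P (saturation T P I)"
    unfolding closed_at_def saturation_def
  proof safe
    fix s x t assume "s \<in> T" "s \<notin> P" "x \<in> T" "t \<in> T" "t \<notin> P" "t * (s * x) \<in> I"
    then show "\<exists>s\<in>T - P. s * x \<in> I"
      using prime_compl_mult[OF P, of t s] by (intro bexI[of _ "t * s"]) (auto simp: mult.assoc)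
  qed
  show "ideal_in T (saturation T P I)"
    unfolding ideal_in_def
  proof (intro conjI ballI)
    show "saturation T P I \<subseteq> T" by (auto simp: saturation_def)
    show "0 \<in> saturation T P I" using \<open>I \<subseteq> saturation T P I\<close> ideal_inD(2)[OF I] by blast
    fix x assume "x \<in> saturation T P I"
    then obtain s where x: "x \<in> T" "s \<in> T - P" "s * x \<in> I" by (auto simp: saturation_def)
    { fix y assume "y \<in> saturation T P I"
      then obtain t where y: "y \<in> T" "t \<in> T - P" "t * y \<in> I" by (auto simp: saturation_def)
      have "(s * t) * (x + y) = t * (s * x) + s * (t * y)" by (simp add: algebra_simps)
      also have "\<dots> \<in> I"
        using x y ideal_inD(3)[OF I] ideal_inD(4)[OF I, of t "s * x"] ideal_inD(4)[OF I, of s "t * y"] by blast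
      finally show "x + y \<in> saturation T P I"
        unfolding saturation_def using prime_compl_mult[OF P x(2) y(2)] x y by (auto simp: ring_in) }
    { fix r assume r: "r \<in> T"
      have "s * (r * x) = r * (s * x)" by (simp add: algebra_simps)
      also have "\<dots> \<in> I" using r x ideal_inD(4)[OF I] by auto
      finally show "r * x \<in> saturation T P I"
        unfolding saturation_def using x r by (auto simp: ring_in) }
  qed
qed

text \<open>Locally at a minimal prime \<open>P\<close> of \<open>A\<close> the residue ring modulo \<open>A\<close> is Artinian. The proof is a
  Noetherian induction on a lower bound \<open>B\<close> of the chain: adjoining a socle element \<open>x\<close>, an element
  with annihilator \<open>P\<close> modulo \<open>B\<close>, gives a larger ideal, and two nested
  closed ideals over \<open>B\<close> that miss \<open>x\<close> are equal if their sums with \<open>x\<close> are locally equal.\<close>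

lemma descending_chain_stops:
  assumes N: "noetherian T" and A: "A \<subseteq> T" and P: "minimal_over T A P"
    and "ideal_in T B" "closed_at T P B" "A \<subseteq> B"
    and "\<And>n. ideal_in T (c n)" "\<And>n. closed_at T P (c n)" "\<And>n. B \<subseteq> c n"
      "\<And>n. c (Suc n) \<subseteq> c n"
  shows "\<exists>n. c (Suc n) = c n"
proof -
  have "closed_at T P B \<longrightarrow> A \<subseteq> B \<longrightarrow> (\<forall>c. (\<forall>n. ideal_in T (c n)) \<longrightarrow> (\<forall>n. closed_at T P (c n)) \<longrightarrow>
     (\<forall>n. B \<subseteq> c n) \<longrightarrow> (\<forall>n. c (Suc n) \<subseteq> c n) \<longrightarrow> (\<exists>n. c (Suc n) = c n))"
    using N assms(4)
  proof (induction rule: noetherian_induct)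
    case (step B)
    note Bi = step(1) and IH = step(2)
    have Pp: "prime_in T P" "ideal_in T P" using P by (auto simp: minimal_over_def prime_in_def)
    show ?case
    proof (intro impI allI)
      fix c :: "nat \<Rightarrow> 'a set"
      assume Bc: "closed_at T P B" and AB: "A \<subseteq> B"
        and c: "\<forall>n. ideal_in T (c n)" "\<forall>n. closed_at T P (c n)" "\<forall>n. B \<subseteq> c n" "\<forall>n. c (Suc n) \<subseteq> c n"
      show "\<exists>n. c (Suc n) = c n"
      proof (cases "1 \<in> B")
        case True
        then have "c n = T" for n using c ideal_eq_ring by blast
        then show ?thesis by auto
      next
        case False
        have colon: "ideal_in T {r \<in> T. r * x \<in> B}" if "x \<in> T" for x
          unfolding ideal_in_def
          using Bi that by (auto simp: ring_in ideal_inD distrib_right mult.assoc)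
        \<comment> \<open>A maximal annihilator of an element of the residue ring is prime; it contains \<open>A\<close> and is contained in \<open>P\<close>.\<close>
        define F where "F = {{r \<in> T. r * x \<in> B} | x. x \<in> T \<and> x \<notin> B}"
        have "F \<noteq> {}" using False one_in by (auto simp: F_def)
        from noetherian_maximal[OF N this] obtain x
          where x: "x \<in> T" "x \<notin> B"
            and max: "\<And>y. y \<in> T \<Longrightarrow> y \<notin> B \<Longrightarrow> \<not> {r \<in> T. r * x \<in> B} \<subset> {r \<in> T. r * y \<in> B}"
          using colon unfolding F_def by (smt (verit) mem_Collect_eq)
        define Q where "Q = {r \<in> T. r * x \<in> B}"
        have "prime_in T Q"
          unfolding prime_in_def
        proof (intro conjI ballI impI)
          show "ideal_in T Q" unfolding Q_def by (rule colon[OF x(1)])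
          show "1 \<notin> Q" using x by (simp add: Q_def)
          fix r s assume rs: "r \<in> T" "s \<in> T" "r * s \<in> Q"
          show "r \<in> Q \<or> s \<in> Q"
          proof (rule disjCI)
            assume "s \<notin> Q"
            then have "s * x \<in> T" "s * x \<notin> B" using rs x by (auto simp: Q_def ring_in)
            from max[OF this] have "\<not> Q \<subset> {t \<in> T. t * (s * x) \<in> B}" by (simp add: Q_def)
            moreover have "Q \<subseteq> {t \<in> T. t * (s * x) \<in> B}"
              using rs Bi by (auto simp: Q_def mult.left_commute[of _ s] ideal_inD)
            ultimately have "{t \<in> T. t * (s * x) \<in> B} = Q" by blast
            moreover have "r * (s * x) \<in> B" using rs by (auto simp: Q_def mult.assoc)
            ultimately show "r \<in> Q" using rs by blast
          qed
        qed
        moreover have "A \<subseteq> Q"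
          using A AB Bi x by (auto simp: Q_def ideal_inD)
        moreover have "Q \<subseteq> P"
          using Bc x unfolding closed_at_def Q_def by blast
        ultimately have QP: "Q = P" using P unfolding minimal_over_def by blast
        define B' where "B' = saturation T P (adjoin T B x)"
        have B': "ideal_in T B'" "closed_at T P B'" "adjoin T B x \<subseteq> B'"
          unfolding B'_def by (rule saturation_ideal[OF Pp(1) adjoin_ideal[OF Bi x(1)]])+
        have sub: "B \<subseteq> B'" "x \<in> B'" using B' adjoin_incl adjoin_elem[OF Bi] by blast+
        show ?thesis
        proof (cases "\<forall>n. x \<in> c n")
          case True
          have "B' \<subseteq> c n" for n
          proof
            fix y assume "y \<in> B'"
            then obtain s where "y \<in> T" "s \<in> T - P" "s * y \<in> adjoin T B x"
              by (auto simp: B'_def saturation_def)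
            moreover have "adjoin T B x \<subseteq> c n" using True c by (intro adjoin_least) auto
            ultimately show "y \<in> c n" using c unfolding closed_at_def by blast
          qed
          then show ?thesis using IH[OF B'(1)] B'(2) sub x AB c by blast
        next
          case False
          then obtain n0 where n0: "x \<notin> c n0" by blast
          have mono: "c j \<subseteq> c i" if "i \<le> j" for i j
            using lift_Suc_antimono_le[of c, OF _ that] c by blast
          \<comment> \<open>From index \<open>n0\<close> on no member contains \<open>x\<close>, so equality of the sums with \<open>x\<close> forces equality of the members.\<close>
          define e where "e n = saturation T P (adjoin T (c (n0 + n)) x)" for n
          have e: "ideal_in T (e n)" "closed_at T P (e n)" "adjoin T (c (n0 + n)) x \<subseteq> e n" for n
            unfolding e_def using saturation_ideal[OF Pp(1) adjoin_ideal[OF _ x(1)]] c by blast+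
          have amono: "adjoin T (c (n0 + Suc n)) x \<subseteq> adjoin T (c (n0 + n)) x" for n
            unfolding adjoin_def using c by fastforce
          have "\<exists>n. e (Suc n) = e n"
          proof (rule IH[rule_format, OF B'(1) _ B'(2)])
            show "B \<subset> B'" using sub x by blast
            show "A \<subseteq> B'" using AB sub by blast
            have "adjoin T B x \<subseteq> adjoin T (c (n0 + n)) x" for n
              unfolding adjoin_def using c by fastforce
            then show "B' \<subseteq> e n" for n unfolding B'_def e_def saturation_def by blast
            show "e (Suc n) \<subseteq> e n" for n
              unfolding e_def saturation_def using amono[of n] by blast
          qed (use e in auto)
          then obtain n where n: "e (Suc n) = e n" by blast
          have "c (n0 + n) \<subseteq> c (n0 + Suc n)"
          proof
            fix y assume y: "y \<in> c (n0 + n)"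
            then have yT: "y \<in> T" using c ideal_inD(1) by blast
            have "y \<in> e (Suc n)" using y n e(3) adjoin_incl by blast
            then obtain s z r where s: "s \<in> T - P" and z: "z \<in> c (n0 + Suc n)" "r \<in> T" "s * y = z + r * x"
              unfolding e_def saturation_def adjoin_def by blast
            have "s * y \<in> c (n0 + n)" "z \<in> c (n0 + n)"
              using y s z(1) c ideal_inD(4)[OF c(1)[rule_format]] mono[of "n0 + n" "n0 + Suc n"] by auto
            then have rx: "r * x \<in> c (n0 + n)" using z(3) c ideal_add_cancel by auto
            have "r \<in> P"
            proof (rule ccontr)
              assume "r \<notin> P"
              then have "x \<in> c (n0 + n)" using rx c z x unfolding closed_at_def by blast
              then show False using n0 mono[of n0 "n0 + n"] by auto
            qed
            then have "r * x \<in> c (n0 + Suc n)" using QP c unfolding Q_def by blast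
            then have "s * y \<in> c (n0 + Suc n)"
              using z c ideal_inD(3)[OF c(1)[rule_format], of z "n0 + Suc n" "r * x"] by auto
            then show "y \<in> c (n0 + Suc n)" using c s yT unfolding closed_at_def by blast
          qed
          then show ?thesis using c by (intro exI[of _ "n0 + n"]) auto
        qed
      qed
    qed
  qed
  then show ?thesis using assms by blast
qed

text \<open>Nakayama's lemma for the localization at \<open>P\<close>, with the generators eliminated one by one: in the
  relation of \<open>g\<close> the coefficient \<open>s - a r\<close> of \<open>g\<close> is still outside \<open>P\<close>.\<close>

lemma nakayama_at:
  assumes P: "prime_in T P" and a: "a \<in> P" and N: "ideal_in T N" "closed_at T P N"
    and "finite G" "G \<subseteq> T"
    and "\<And>g. g \<in> G \<Longrightarrow> \<exists>s\<in>T - P. \<exists>u\<in>N. \<exists>v\<in>gen T G. s * g = u + a * v"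
  shows "G \<subseteq> N"
  using assms(5-)
proof (induction G rule: finite_induct)
  case (insert g G)
  have aT: "a \<in> T" using a P by (auto dest: prime_inD ideal_inD)
  have gT: "g \<in> T" "G \<subseteq> T" using insert by auto
  have ins: "\<exists>w\<in>gen T G. \<exists>r\<in>T. v = w + r * g" if "v \<in> gen T (insert g G)" for v
    using that gen_insert[OF gT(2,1)] unfolding adjoin_def by blast
  obtain s u w r where g: "s \<in> T - P" "u \<in> N" "w \<in> gen T G" "r \<in> T" "s * g = u + a * (w + r * g)"
    using insert.prems(2)[of g] ins by blast
  define t where "t = s - a * r"
  have t: "t \<in> T - P"
  proof -
    have ar: "a * r \<in> P" using a g(4) ideal_inD(5)[OF prime_inD(1)[OF P]] by blast
    have "t \<in> P \<Longrightarrow> s \<in> P"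
      using ideal_inD(3)[OF prime_inD(1)[OF P] _ ar, of t] by (simp add: t_def)
    then show ?thesis using g aT by (auto simp: t_def ring_in)
  qed
  have tg: "t * g = u + a * w" using g(5) by (simp add: t_def algebra_simps)
  have Gi: "ideal_in T (gen T G)" using gT gen_ideal by blast
  have "G \<subseteq> N"
  proof (rule insert.IH)
    fix h assume h: "h \<in> G"
    obtain s' u' w' r' where h': "s' \<in> T - P" "u' \<in> N" "w' \<in> gen T G" "r' \<in> T" "s' * h = u' + a * (w' + r' * g)"
      using insert.prems(2)[of h] ins h by blast
    have "(t * s') * h = t * (s' * h)" by (simp add: algebra_simps)
    also have "\<dots> = t * u' + a * (t * w') + a * (r' * (t * g))" 
      unfolding h'(5) by (simp add: algebra_simps)
    also have "\<dots> = (t * u' + (a * r') * u) + a * (t * w' + (r' * a) * w)"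
      unfolding tg by (simp add: algebra_simps)
    finally have eq: "(t * s') * h = (t * u' + (a * r') * u) + a * (t * w' + (r' * a) * w)" .
    show "\<exists>s\<in>T - P. \<exists>u\<in>N. \<exists>v\<in>gen T G. s * h = u + a * v"
    proof (intro bexI)
      show "t * s' \<in> T - P" using prime_compl_mult[OF P] t h' by blast
      show "t * u' + (a * r') * u \<in> N" using t h' g aT by (intro ideal_lin[OF N(1)]) (auto intro: mult_in)
      show "t * w' + (r' * a) * w \<in> gen T G" using t h' g aT by (intro ideal_lin[OF Gi]) (auto intro: mult_in)
    qed (fact eq)
  qed (use gT in auto)
  then have "gen T G \<subseteq> N" using N gen_least by blast
  then have "w \<in> N" using g by blast
  then have "t * g \<in> N" unfolding tg using g aT ideal_lin[OF N(1) one_in aT, of u w] by simp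
  then show ?case using t gT N(2) \<open>G \<subseteq> N\<close> unfolding closed_at_def by blast
qed simp

text \<open>Krull's principal ideal theorem in the form that no chain of three primes ends in a prime
  that is minimal over the first one and one more element. Instead of the symbolic powers of \<open>Q\<close> it
  is enough to use the saturations \<open>c n\<close> at \<open>Q\<close> of the ideals generated by \<open>Q'\<close> and \<open>q\<^sup>n\<close>, for a single
  element \<open>q\<close> of \<open>Q\<close> outside \<open>Q'\<close>: modulo \<open>a\<close> they become stationary, by Nakayama's lemma they are then equal at
  two consecutive places, and \<open>q\<^sup>n \<in> c (n + 1)\<close> makes an element outside \<open>Q\<close> a multiple of \<open>q\<close> modulo
  \<open>Q'\<close>.\<close>

lemma principal_ideal_theorem:
  assumes N: "noetherian T" and Q': "prime_in T Q'" and Q: "prime_in T Q" and lt: "Q' \<subset> Q" "Q \<subset> P"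
    and aT: "a \<in> T" and P: "minimal_over T (insert a Q') P"
  shows False
proof -
  have Pp: "prime_in T P" and aP: "a \<in> P" using P by (auto simp: minimal_over_def)
  note Pi = prime_inD(1)[OF Pp] and Qi = prime_inD(1)[OF Q] and Q'i = prime_inD(1)[OF Q']
  have aQ: "a \<notin> Q" using P Q lt unfolding minimal_over_def by auto
  obtain q where q: "q \<in> Q" "q \<notin> Q'" using lt by blast
  have qT: "q \<in> T" using q Qi ideal_inD by blast
  define c where "c n = saturation T Q (adjoin T Q' (q ^ n))" for n
  have adj: "ideal_in T (adjoin T Q' (q ^ n))" for n
    by (intro adjoin_ideal Q'i power_in qT)
  have c: "ideal_in T (c n)" "closed_at T Q (c n)" "adjoin T Q' (q ^ n) \<subseteq> c n" for n
    unfolding c_def by (rule saturation_ideal[OF Q adj])+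
  have cP: "closed_at T P (c n)" for n
    using c(2)[of n] lt unfolding closed_at_def by blast
  have "adjoin T Q' (q ^ Suc n) \<subseteq> adjoin T Q' (q ^ n)" for n
    unfolding adjoin_def
  proof safe
    fix x r assume "x \<in> Q'" "r \<in> T"
    then show "\<exists>x' r'. x + r * q ^ Suc n = x' + r' * q ^ n \<and> x' \<in> Q' \<and> r' \<in> T"
      using qT by (intro exI[of _ x] exI[of _ "r * q"]) (auto simp: ring_in algebra_simps)
  qed
  then have cdec: "c (Suc n) \<subseteq> c n" for n
    unfolding c_def saturation_def by blast
  have Q'c: "Q' \<subseteq> c n" for n using c(3) adjoin_incl by blast
  define e where "e n = saturation T P (adjoin T (c n) a)" for n
  have e: "ideal_in T (e n)" "closed_at T P (e n)" "adjoin T (c n) a \<subseteq> e n" for n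
    unfolding e_def by (rule saturation_ideal[OF Pp adjoin_ideal[OF c(1) aT]])+
  define B where "B = saturation T P (adjoin T Q' a)"
  have B: "ideal_in T B" "closed_at T P B" "adjoin T Q' a \<subseteq> B"
    unfolding B_def by (rule saturation_ideal[OF Pp adjoin_ideal[OF Q'i aT]])+
  have "\<exists>n. e (Suc n) = e n"
  proof (rule descending_chain_stops[OF N _ P B(1,2)])
    show "insert a Q' \<subseteq> T" using aT Q'i ideal_inD by blast
    show "insert a Q' \<subseteq> B" using B(3) adjoin_incl adjoin_elem[OF Q'i] by blast
    have "adjoin T Q' a \<subseteq> adjoin T (c n) a" for n unfolding adjoin_def using Q'c by blast
    then show "B \<subseteq> e n" for n unfolding B_def e_def saturation_def by blast
    have "adjoin T (c (Suc n)) a \<subseteq> adjoin T (c n) a" for n unfolding adjoin_def using cdec by blast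
    then show "e (Suc n) \<subseteq> e n" for n unfolding e_def saturation_def by blast
  qed (use e in auto)
  then obtain n where n: "e (Suc n) = e n" by blast
  obtain G where G: "finite G" "G \<subseteq> c n" "gen T G = c n"
    using noetherianE[OF N c(1)] by blast
  have "G \<subseteq> c (Suc n)"
  proof (rule nakayama_at[OF Pp aP c(1) cP G(1)])
    show "G \<subseteq> T" using G c(1) ideal_inD by blast
    fix g assume "g \<in> G"
    then have g: "g \<in> c n" using G by blast
    then have "g \<in> e (Suc n)" using n e(3) adjoin_incl by blast
    then obtain s u r where s: "s \<in> T - P" "u \<in> c (Suc n)" "r \<in> T" "s * g = u + r * a"
      unfolding e_def saturation_def adjoin_def by blast
    have "s * g \<in> c n" "u \<in> c n" using g s cdec ideal_inD(4)[OF c(1)] by blast+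
    then have "r * a \<in> c n" using s ideal_add_cancel[OF c(1)] by auto
    then have "r \<in> c n" using c(2)[of n] aT aQ s(3) unfolding closed_at_def by (auto simp: mult.commute)
    then show "\<exists>s\<in>T - P. \<exists>u\<in>c (Suc n). \<exists>v\<in>gen T G. s * g = u + a * v"
      using s G(3) by (metis mult.commute)
  qed
  then have "c n \<subseteq> c (Suc n)" using gen_least[OF c(1)] G(3) by blast
  moreover have "q ^ n \<in> c n" using c(3) adjoin_elem[OF Q'i] by blast
  ultimately have "q ^ n \<in> c (Suc n)" by blast
  then obtain s u r where s: "s \<in> T - Q" "u \<in> Q'" "r \<in> T" "s * q ^ n = u + r * q ^ Suc n"
    unfolding c_def saturation_def adjoin_def by blast
  have "(s - r * q) * q ^ n = u" using s(4) by (simp add: algebra_simps)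
  then have "(s - r * q) * q ^ n \<in> Q'" using s by simp
  then have "s - r * q \<in> Q' \<or> q ^ n \<in> Q'"
    using s qT by (intro prime_inD(3)[OF Q']) (auto simp: ring_in)
  then have "s - r * q \<in> Q" using prime_power[OF Q' qT] q lt by blast
  then have "s \<in> Q" using ideal_inD(3)[OF Qi, of "s - r * q" "r * q"] ideal_inD(4)[OF Qi s(3) q(1)] by simp
  then show False using s by blast
qed

text \<open>Let \<open>Q\<close> be a maximal prime strictly below \<open>P\<close> that contains the last but one member of the
  chain, and let \<open>a \<in> A\<close> lie outside \<open>Q\<close>. Then \<open>P\<close> is minimal over \<open>Q\<close> and \<open>a\<close>, so that each other generator \<open>b\<close>
  has locally a power of the form \<open>u b + r b * a\<close> with \<open>u b \<in> Q\<close>. By the principal ideal theorem \<open>Q\<close> is minimal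
  over the elements \<open>u b\<close>, of which there are fewer than elements of \<open>A\<close>.\<close>

theorem krull_height:
  assumes "noetherian T" "finite A" "A \<subseteq> T" "minimal_over T A P" "prime_chain T P m c"
  shows "m \<le> card A"
  using assms(2-)
proof (induction "card A" arbitrary: A P m c rule: less_induct)
  case less
  note N = assms(1)
  have Pp: "prime_in T P" and AP: "A \<subseteq> P" using less.prems by (auto simp: minimal_over_def)
  show ?case
  proof (cases m)
    case (Suc m')
    have ch: "\<And>i. i \<le> m \<Longrightarrow> prime_in T (c i)" "\<And>i. i < m \<Longrightarrow> c i \<subset> c (Suc i)" "c m = P"
      using less.prems(4) unfolding prime_chain_def by auto
    define F where "F = {Q. prime_in T Q \<and> c m' \<subseteq> Q \<and> Q \<subset> P}"
    have "F \<noteq> {}" using ch(1)[of m'] ch(2)[of m'] ch(3) Suc by (auto simp: F_def)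
    moreover have "\<And>I. I \<in> F \<Longrightarrow> ideal_in T I" by (auto simp: F_def dest: prime_inD)
    ultimately obtain Q where QF: "Q \<in> F" and Qmax: "\<And>J. J \<in> F \<Longrightarrow> \<not> Q \<subset> J"
      using noetherian_maximal[OF N, of F] by blast
    have Q: "prime_in T Q" "c m' \<subseteq> Q" "Q \<subset> P" using QF by (auto simp: F_def)
    have "\<not> A \<subseteq> Q" using less.prems(3) Q unfolding minimal_over_def by blast
    then obtain a where a: "a \<in> A" "a \<notin> Q" by blast
    have aT: "a \<in> T" using a less.prems by blast
    have QT: "Q \<subseteq> T" using Q(1) by (auto dest: prime_inD ideal_inD)
    have PQ: "minimal_over T (insert a Q) P"
      unfolding minimal_over_def
    proof (intro conjI allI impI)
      fix R assume R: "prime_in T R" "insert a Q \<subseteq> R" "R \<subseteq> P"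
      then have "Q \<subset> R" "c m' \<subseteq> R" using a Q by blast+
      then have "R \<notin> F" using Qmax by blast
      then show "R = P" using R \<open>c m' \<subseteq> R\<close> unfolding F_def by blast
    qed (use Pp AP a Q in auto)
    have "\<exists>s k u r. s \<in> T \<and> s \<notin> P \<and> u \<in> Q \<and> r \<in> T \<and> s * b ^ k = u + r * a" if b: "b \<in> A" for b
    proof -
      have "b \<in> P" using b AP by blast
      then obtain s k where "s \<in> T" "s \<notin> P" "s * b ^ k \<in> gen T (insert a Q)"
        using minimal_over_power[OF N _ PQ, of b] QT aT by blast
      moreover have "gen T (insert a Q) = adjoin T Q a"
        using gen_insert[OF QT aT] gen_of_ideal[OF prime_inD(1)[OF Q(1)]] by simp
      ultimately show ?thesis unfolding adjoin_def by blast
    qed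
    then obtain s k u r where b: "\<And>b. b \<in> A \<Longrightarrow> s b \<in> T \<and> s b \<notin> P \<and> u b \<in> Q \<and> r b \<in> T \<and> s b * b ^ k b = u b + r b * a"
      by metis
    define B where "B = u ` (A - {a})"
    have BQ: "B \<subseteq> Q" using b by (auto simp: B_def)
    have card: "card B < card A"
      using a less.prems(1) card_image_le[of "A - {a}" u] card_Diff1_less[of A a] unfolding B_def by simp
    have "minimal_over T B Q"
      unfolding minimal_over_def
    proof (intro conjI allI impI)
      fix Q' assume Q': "prime_in T Q'" "B \<subseteq> Q'" "Q' \<subseteq> Q"
      have "minimal_over T (insert a Q') P"
        unfolding minimal_over_def
      proof (intro conjI allI impI)
        fix R assume R: "prime_in T R" "insert a Q' \<subseteq> R" "R \<subseteq> P"
        have Ri: "ideal_in T R" using R(1) prime_inD by blast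
        have "x \<in> R" if x: "x \<in> A" for x
        proof (cases "x = a")
          case False
          then have "u x \<in> R" using x Q' R by (auto simp: B_def)
          then have "s x * x ^ k x \<in> R" 
            using b[OF x] R ideal_lin[OF Ri one_in, of "r x" "u x" a] by simp
          moreover have "s x \<in> T" "s x \<notin> R" "x \<in> T" using b[OF x] R less.prems x by auto
          ultimately show ?thesis
            using prime_inD(3)[OF R(1)] prime_power[OF R(1)] power_in by blast
        qed (use R in auto)
        then show "R = P" using less.prems(3) R unfolding minimal_over_def by blast
      qed (use Pp a AP Q' Q in auto)
      then show "Q' = Q"
        using principal_ideal_theorem[OF N Q'(1) Q(1) _ Q(3) aT] Q'(3) by blast
    qed (use Q BQ in auto)
    moreover have "prime_chain T Q m' (c(m' := Q))"
      unfolding prime_chain_def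
    proof (intro conjI allI impI)
      fix i assume i: "i < m'"
      then have "c i \<subset> c (Suc i)" using ch(2)[of i] Suc by simp
      then show "(c(m' := Q)) i \<subset> (c(m' := Q)) (Suc i)"
        using i Q(2) by (cases "Suc i = m'") auto
    qed (use ch(1) Q Suc in auto)
    ultimately have "m' \<le> card B"
      using less.hyps[OF card] less.prems(1) BQ QT by (auto simp: B_def)
    then show ?thesis using card Suc by simp
  qed simp
qed

lemma prime_chain_bounded:
  assumes "noetherian T" "prime_in T P"
  obtains r where "\<And>m c. prime_chain T P m c \<Longrightarrow> m \<le> r"
proof -
  obtain A where A: "finite A" "A \<subseteq> P" "gen T A = P"
    using assms unfolding noetherian_def by (meson prime_inD(1))
  have "minimal_over T A P"
    unfolding minimal_over_def using assms A gen_least prime_inD(1) by blast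
  then show ?thesis
    using that krull_height[OF assms(1) A(1)] A(2) assms(2) ideal_inD(1)[OF prime_inD(1)] by blast
qed

text \<open>Heights are finite, so among the chains of primes over \<open>A\<close> that end in \<open>P\<close> there is a longest one; it
  starts at a minimal prime.\<close>

lemma minimal_prime_below:
  assumes "noetherian T" "prime_in T P" "A \<subseteq> P"
  obtains Q where "minimal_over T A Q" "Q \<subseteq> P"
proof -
  define S where "S = {m. \<exists>c. prime_chain T P m c \<and> A \<subseteq> c 0}"
  obtain r where r: "\<And>m c. prime_chain T P m c \<Longrightarrow> m \<le> r"
    using prime_chain_bounded[OF assms(1,2)] by blast
  have "prime_chain T P 0 (\<lambda>_. P)" using assms by (auto simp: prime_chain_def)
  then have "0 \<in> S" using assms by (auto simp: S_def)
  have "\<forall>m\<in>S. m \<le> r" using r by (auto simp: S_def)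
  then have fin: "finite S" unfolding finite_nat_set_iff_bounded_le by blast
  have Smax: "Max S \<in> S" using Max_in[OF fin] \<open>0 \<in> S\<close> by blast
  then obtain c where c: "prime_chain T P (Max S) c" "A \<subseteq> c 0" by (auto simp: S_def)
  have "c 0 \<subseteq> c i" if "i \<le> Max S" for i
    using that
  proof (induction i)
    case (Suc i)
    then have "c i \<subset> c (Suc i)" using c(1) by (auto simp: prime_chain_def)
    then show ?case using Suc by auto
  qed auto
  then have c0: "c 0 \<subseteq> P" using c(1) unfolding prime_chain_def by auto
  have "minimal_over T A (c 0)"
    unfolding minimal_over_def
  proof (intro conjI allI impI)
    fix Q assume Q: "prime_in T Q" "A \<subseteq> Q" "Q \<subseteq> c 0"
    show "Q = c 0"
    proof (rule ccontr)
      assume "Q \<noteq> c 0"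
      then have "prime_chain T P (Suc (Max S)) (case_nat Q c)"
        using Q c unfolding prime_chain_def by (auto split: nat.split)
      then have "Suc (Max S) \<in> S" using Q unfolding S_def by (auto intro!: exI[of _ "case_nat Q c"])
      then show False using Max_ge[OF fin] by fastforce
    qed
  qed (use c in \<open>auto simp: prime_chain_def\<close>)
  then show ?thesis using that c0 by blast
qed

end

section \<open>Regular families\<close>

text \<open>A finite family of this kind is a regular sequence in every order, a unit ideal being
  permitted.\<close>

definition regular_family :: "'a::comm_ring_1 set \<Rightarrow> ('i \<Rightarrow> 'a) \<Rightarrow> 'i set \<Rightarrow> bool" where
  "regular_family T f F \<longleftrightarrow> (\<forall>G i h. G \<subseteq> F \<longrightarrow> i \<in> F - G \<longrightarrow> h \<in> T \<longrightarrow>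
     h * f i \<in> gen T (f ` G) \<longrightarrow> h \<in> gen T (f ` G))"

lemma prime_chain_extend:
  assumes "prime_chain T Q m c" "prime_in T P" "Q \<subset> P"
  shows "prime_chain T P (Suc m) (c(Suc m := P))"
  using assms unfolding prime_chain_def by (auto simp: le_Suc_eq less_Suc_eq)

context subring_set
begin

lemma non_zero_divisor_power:
  assumes "\<And>h. h \<in> T \<Longrightarrow> h * x \<in> I \<Longrightarrow> h \<in> I" "x \<in> T" "s \<in> T" "s * x ^ k \<in> I"
  shows "s \<in> I"
  using assms(4)
proof (induction k)
  case (Suc k)
  have "(s * x ^ k) * x \<in> I" using Suc.prems by (simp add: algebra_simps)
  moreover have "s * x ^ k \<in> T" using assms(2,3) by (intro mult_in power_in)
  ultimately show ?case using Suc.IH assms(1) by blast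
qed simp

text \<open>A minimal prime over the first members consists of zero divisors modulo them, so it does not
  contain the next member and lies strictly below \<open>P\<close>.\<close>

lemma regular_family_chain:
  assumes "noetherian T" "finite F" "f ` F \<subseteq> T" "regular_family T f F" "prime_in T P" "f ` F \<subseteq> P"
  shows "\<exists>c. prime_chain T P (card F) c"
  using assms(2-)
proof (induction F arbitrary: P rule: finite_induct)
  case empty
  then show ?case by (intro exI[of _ "\<lambda>_. P"]) (auto simp: prime_chain_def)
next
  case (insert i F)
  then obtain Q where Q: "minimal_over T (f ` F) Q" "Q \<subseteq> P"
    using minimal_prime_below[OF assms(1), of P "f ` F"] by auto
  have Qp: "prime_in T Q" "f ` F \<subseteq> Q" using Q by (auto simp: minimal_over_def)
  have FT: "f ` F \<subseteq> T" "f i \<in> T" using insert.prems by auto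
  have "f i \<notin> Q"
  proof
    assume "f i \<in> Q"
    then obtain s k where s: "s \<in> T" "s \<notin> Q" "s * f i ^ k \<in> gen T (f ` F)"
      using minimal_over_power[OF assms(1) FT(1) Q(1)] by blast
    have "\<And>h. h \<in> T \<Longrightarrow> h * f i \<in> gen T (f ` F) \<Longrightarrow> h \<in> gen T (f ` F)"
      using insert.prems(2) insert.hyps unfolding regular_family_def by blast
    then have "s \<in> gen T (f ` F)"
      using non_zero_divisor_power[OF _ FT(2) s(1,3)] by blast
    then show False using gen_least[OF prime_inD(1)[OF Qp(1)] Qp(2)] s by blast
  qed
  then have "Q \<subset> P" using insert.prems Q by auto
  have "regular_family T f F" using insert.prems(2) unfolding regular_family_def by blast
  then obtain c where "prime_chain T Q (card F) c"
    using insert.IH[of Q] FT Qp by blast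
  from prime_chain_extend[OF this insert.prems(3) \<open>Q \<subset> P\<close>]
  show ?case using insert.hyps by auto
qed

end

section \<open>Hilbert's basis theorem\<close>

definition polys_over :: "'a::comm_ring_1 set \<Rightarrow> 'a poly set" where
  "polys_over T = {p. \<forall>i. coeff p i \<in> T}"

text \<open>The subring generated by \<open>T\<close> and \<open>x\<close>. As \<open>x\<close> may satisfy algebraic relations over \<open>T\<close>, an element
  can be the value of many polynomials.\<close>

definition poly_ext :: "'a::comm_ring_1 set \<Rightarrow> 'a \<Rightarrow> 'a set" where
  "poly_ext T x = (\<lambda>p. poly p x) ` polys_over T"

context subring_set
begin

lemma polys_over_closed:
  "0 \<in> polys_over T" "1 \<in> polys_over T"
  "p \<in> polys_over T \<Longrightarrow> q \<in> polys_over T \<Longrightarrow> p - q \<in> polys_over T"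
  "p \<in> polys_over T \<Longrightarrow> q \<in> polys_over T \<Longrightarrow> p + q \<in> polys_over T"
  "p \<in> polys_over T \<Longrightarrow> q \<in> polys_over T \<Longrightarrow> p * q \<in> polys_over T"
  "a \<in> T \<Longrightarrow> p \<in> polys_over T \<Longrightarrow> smult a p \<in> polys_over T"
  "a \<in> T \<Longrightarrow> p \<in> polys_over T \<Longrightarrow> pCons a p \<in> polys_over T"
  "a \<in> T \<Longrightarrow> monom a n \<in> polys_over T"
  unfolding polys_over_def
  by (auto simp: ring_in coeff_mult coeff_pCons coeff_1 split: nat.split intro!: sum_in)

lemma poly_ext_subring: "subring_set (poly_ext T x)"
proof
  show "1 \<in> poly_ext T x"
    unfolding poly_ext_def using polys_over_closed(2) by (auto intro!: image_eqI[of _ _ 1])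
  fix u v assume "u \<in> poly_ext T x" "v \<in> poly_ext T x"
  then obtain p q where pq: "u = poly p x" "v = poly q x" "p \<in> polys_over T" "q \<in> polys_over T"
    unfolding poly_ext_def by blast
  show "u - v \<in> poly_ext T x" "u * v \<in> poly_ext T x"
    unfolding poly_ext_def pq using pq polys_over_closed
    by (auto intro: image_eqI[of _ _ "p - q"] image_eqI[of _ _ "p * q"])
qed

text \<open>The classical argument with ideals of leading coefficients, applied to all polynomials of
  degree at most \<open>n\<close> whose value at \<open>x\<close> lies in \<open>I\<close>, and not to the elements of \<open>I\<close> themselves.\<close>

lemma hilbert_basis:
  assumes N: "noetherian T"
  shows "noetherian (poly_ext T x)"
  unfolding noetherian_def
proof (intro allI impI)
  let ?S = "poly_ext T x"
  interpret S: subring_set ?S by (rule poly_ext_subring)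
  fix I assume I: "ideal_in ?S I"
  have inS: "p \<in> polys_over T \<Longrightarrow> poly p x \<in> ?S" for p by (auto simp: poly_ext_def)
  define D where "D n = {p \<in> polys_over T. degree p \<le> n \<and> poly p x \<in> I}" for n
  define L where "L n = (\<lambda>p. coeff p n) ` D n" for n
  have const: "[:r:] \<in> polys_over T" if "r \<in> T" for r
    using that polys_over_closed(1,7) by blast
  have L: "ideal_in T (L n)" for n
    unfolding ideal_in_def
  proof (intro conjI ballI)
    show "L n \<subseteq> T" by (auto simp: L_def D_def polys_over_def)
    show "0 \<in> L n"
      unfolding L_def using ideal_inD(2)[OF I] polys_over_closed(1)
      by (auto simp: D_def intro!: image_eqI[of _ _ 0])
    fix a assume "a \<in> L n"
    then obtain p where p: "a = coeff p n" "p \<in> D n" by (auto simp: L_def)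
    { fix b assume "b \<in> L n"
      then obtain q where q: "b = coeff q n" "q \<in> D n" by (auto simp: L_def)
      have "p + q \<in> D n"
        using p q ideal_inD(3)[OF I] polys_over_closed(4) by (auto simp: D_def degree_add_le)
      then show "a + b \<in> L n" unfolding L_def p q by (auto intro!: image_eqI[of _ _ "p + q"]) }
    { fix r assume r: "r \<in> T"
      have "r \<in> ?S" using inS[OF const[OF r]] by simp
      then have "r * poly p x \<in> I" using ideal_inD(4)[OF I] p by (auto simp: D_def)
      then have "smult r p \<in> D n"
        using p r polys_over_closed(6) degree_smult_le[of r p] by (auto simp: D_def)
      then show "r * a \<in> L n" unfolding L_def p by (auto intro!: image_eqI[of _ _ "smult r p"]) }
  qed
  have xS: "x \<in> ?S"
    using inS[of "[:0, 1:]"] polys_over_closed(1,7) one_in zero_in by simp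
  have Lsuc: "L n \<subseteq> L (Suc n)" for n
  proof
    fix a assume "a \<in> L n"
    then obtain p where p: "a = coeff p n" "p \<in> D n" by (auto simp: L_def)
    have "pCons 0 p \<in> D (Suc n)"
      using p polys_over_closed(7)[OF zero_in] ideal_inD(4)[OF I xS] by (auto simp: D_def degree_pCons_eq_if)
    then show "a \<in> L (Suc n)" unfolding L_def p by (auto intro!: image_eqI[of _ _ "pCons 0 p"])
  qed
  have "\<And>I. I \<in> range L \<Longrightarrow> ideal_in T I" using L by auto
  then obtain M where M: "\<And>n. \<not> L M \<subset> L n"
    using noetherian_maximal[OF N, of "range L"] by auto
  have LM: "L n = L (min n M)" for n
  proof (cases "n \<le> M")
    case False
    then have "L M \<subseteq> L n" using lift_Suc_mono_le[of L M n, OF Lsuc] by auto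
    then show ?thesis using M[of n] False by (auto simp: min_def)
  qed (auto simp: min_def)
  have "\<forall>n. \<exists>A. finite A \<and> A \<subseteq> L n \<and> gen T A = L n" using L N unfolding noetherian_def by blast
  then obtain A where "\<forall>n. finite (A n) \<and> A n \<subseteq> L n \<and> gen T (A n) = L n"
    by (rule choice[THEN exE])
  then have A: "\<And>n. finite (A n)" "\<And>n. A n \<subseteq> L n" "\<And>n. gen T (A n) = L n" by blast+
  define q where "q n a = (SOME q. q \<in> D n \<and> coeff q n = a)" for n a
  have q: "q n a \<in> D n \<and> coeff (q n a) n = a" if "a \<in> A n" for n a
    unfolding q_def by (rule someI_ex) (use that A(2)[of n] in \<open>auto simp: L_def\<close>)
  define G where "G = (\<Union>n\<le>M. (\<lambda>a. poly (q n a) x) ` A n)"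
  have G: "finite G" "G \<subseteq> I" using A(1) q by (auto simp: G_def D_def)
  have GS: "G \<subseteq> ?S" using G I ideal_inD(1) by blast
  note gi = S.gen_ideal[OF GS]
  have rep: "\<exists>p\<in>D n. coeff p n = b \<and> poly p x \<in> gen ?S G" if "b \<in> gen T (A n)" "n \<le> M" for b n
    using that
  proof induction
    case gen_zero
    then show ?case
      using ideal_inD(2)[OF I] ideal_inD(2)[OF gi] polys_over_closed(1)
      by (intro bexI[of _ 0]) (auto simp: D_def)
  next
    case (gen_step b r a)
    then obtain p where p: "p \<in> D n" "coeff p n = b" "poly p x \<in> gen ?S G" by auto
    have qa: "q n a \<in> D n" "coeff (q n a) n = a" "poly (q n a) x \<in> gen ?S G"
      using q[OF gen_step(3)] gen_step by (auto simp: G_def intro!: S.gen_incl)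
    have rS: "r \<in> ?S" using inS[OF const[OF gen_step(2)]] by simp
    have "degree (smult r (q n a) + p) \<le> n"
      using p(1) qa(1) degree_smult_le[of r "q n a"] by (auto simp: D_def intro!: degree_add_le)
    then have "smult r (q n a) + p \<in> D n"
      using p(1) qa(1) rS gen_step(2) ideal_inD(3,4)[OF I] polys_over_closed(4,6) by (auto simp: D_def)
    moreover have "r * poly (q n a) x + poly p x \<in> gen ?S G"
      using rS qa p ideal_inD(3,4)[OF gi] by auto
    ultimately show ?case
      using p qa by (intro bexI[of _ "smult r (q n a) + p"]) auto
  qed
  have main: "poly p x \<in> gen ?S G" if "p \<in> polys_over T" "poly p x \<in> I" "\<forall>i\<ge>k. coeff p i = 0" for p k
    using that
  proof (induction k arbitrary: p)
    case 0
    then have "p = 0" by (auto simp: poly_eq_iff)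
    then show ?case using ideal_inD(2)[OF gi] by simp
  next
    case (Suc k)
    have "degree p \<le> k" using Suc.prems by (intro degree_le) auto
    then have "coeff p k \<in> L k" using Suc.prems by (auto simp: L_def D_def)
    then have "coeff p k \<in> gen T (A (min k M))" using LM[of k] A(3) by auto
    from rep[OF this] obtain r where r: "r \<in> D (min k M)" "coeff r (min k M) = coeff p k"
      "poly r x \<in> gen ?S G" by auto
    define t where "t = monom 1 (k - min k M) * r"
    have tT: "t \<in> polys_over T"
      using r polys_over_closed(5,8) one_in by (auto simp: t_def D_def)
    have xk: "x ^ (k - min k M) \<in> ?S" using xS by (rule S.power_in)
    have pt: "poly t x = x ^ (k - min k M) * poly r x" by (simp add: t_def poly_monom)
    have tG: "poly t x \<in> gen ?S G" using pt ideal_inD(4)[OF gi xk r(3)] by simp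
    have tI: "poly t x \<in> I" using pt ideal_inD(4)[OF I xk] r by (auto simp: D_def)
    have ct: "coeff t i = (if i < k - min k M then 0 else coeff r (i - (k - min k M)))" for i
      unfolding t_def coeff_monom_mult by (cases "i < k - min k M") auto
    have rdeg: "degree r \<le> min k M" using r(1) by (auto simp: D_def)
    have "coeff (p - t) i = 0" if "i \<ge> k" for i
    proof (cases "i = k")
      case True
      have "\<not> k < k - min k M" "k - (k - min k M) = min k M" by linarith+
      then show ?thesis using r(2) unfolding True coeff_diff ct by simp
    next
      case False
      then have "i \<ge> Suc k" using that by auto
      moreover have "coeff r (i - (k - min k M)) = 0"
        by (rule coeff_eq_0) (use \<open>i \<ge> Suc k\<close> rdeg in linarith)
      ultimately show ?thesis using Suc.prems(3) by (simp add: ct)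
    qed
    then have "poly (p - t) x \<in> gen ?S G"
      using Suc.IH[of "p - t"] Suc.prems tT tI polys_over_closed(3) S.ideal_diff[OF I] by auto
    then show ?case using ideal_inD(3)[OF gi _ tG, of "poly (p - t) x"] by simp
  qed
  have "I \<subseteq> gen ?S G"
  proof
    fix y assume y: "y \<in> I"
    then obtain p where p: "y = poly p x" "p \<in> polys_over T"
      using ideal_inD(1)[OF I] by (auto simp: poly_ext_def)
    then show "y \<in> gen ?S G"
      using main[of p "Suc (degree p)"] y by (auto simp: coeff_eq_0)
  qed
  then show "\<exists>A. finite A \<and> A \<subseteq> I \<and> gen ?S A = I"
    using G gen_least[OF I G(2)] by blast
qed

end

section \<open>Transport to rings with an explicit carrier\<close>

text \<open>A parametrization of the carrier of \<open>L\<close> by \<open>T\<close> that is an isomorphism of rings. It allows results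
  on subrings of a type to be read in \<open>L\<close>.\<close>

definition represents :: "('a::comm_ring_1 \<Rightarrow> 'b) \<Rightarrow> 'a set \<Rightarrow> ('b, 'c) ring_scheme \<Rightarrow> bool" where
  "represents \<phi> T L \<longleftrightarrow> inj_on \<phi> T \<and> carrier L = \<phi> ` T \<and>
     (\<forall>x\<in>T. \<forall>y\<in>T. \<phi> x \<otimes>\<^bsub>L\<^esub> \<phi> y = \<phi> (x * y)) \<and>
     (\<forall>x\<in>T. \<forall>y\<in>T. \<phi> x \<oplus>\<^bsub>L\<^esub> \<phi> y = \<phi> (x + y)) \<and>
     \<one>\<^bsub>L\<^esub> = \<phi> 1 \<and> \<zero>\<^bsub>L\<^esub> = \<phi> 0"

locale represented_ring = subring_set T for T :: "'a::comm_ring_1 set" +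
  fixes \<phi> :: "'a \<Rightarrow> 'b" and L :: "('b, 'c) ring_scheme"
  assumes rep: "represents \<phi> T L"
begin

lemma rep_inj: "inj_on \<phi> T"
  and rep_carrier: "carrier L = \<phi> ` T"
  and rep_mult: "x \<in> T \<Longrightarrow> y \<in> T \<Longrightarrow> \<phi> x \<otimes>\<^bsub>L\<^esub> \<phi> y = \<phi> (x * y)"
  and rep_add: "x \<in> T \<Longrightarrow> y \<in> T \<Longrightarrow> \<phi> x \<oplus>\<^bsub>L\<^esub> \<phi> y = \<phi> (x + y)"
  and rep_one: "\<one>\<^bsub>L\<^esub> = \<phi> 1" and rep_zero: "\<zero>\<^bsub>L\<^esub> = \<phi> 0"
  using rep unfolding represents_def by auto

lemmas rep_simps = rep_carrier rep_mult rep_add rep_one rep_zero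

lemma rep_cring: "cring L"
proof (rule cringI)
  show "abelian_group L"
  proof (rule abelian_groupI)
    fix x assume "x \<in> carrier L"
    then obtain a where "x = \<phi> a" "a \<in> T" by (auto simp: rep_carrier)
    then show "\<exists>y\<in>carrier L. y \<oplus>\<^bsub>L\<^esub> x = \<zero>\<^bsub>L\<^esub>"
      by (intro bexI[of _ "\<phi> (- a)"]) (auto simp: rep_simps ring_in)
  qed (auto simp: rep_simps ring_in algebra_simps)
  show "comm_monoid L"
    by (rule comm_monoidI) (auto simp: rep_simps ring_in algebra_simps)
qed (auto simp: rep_simps ring_in algebra_simps)

lemma rep_mem: "I \<subseteq> T \<Longrightarrow> x \<in> T \<Longrightarrow> \<phi> x \<in> \<phi> ` I \<longleftrightarrow> x \<in> I"
  using rep_inj by (auto simp: inj_on_def)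

lemma rep_neg: "x \<in> T \<Longrightarrow> \<ominus>\<^bsub>L\<^esub> \<phi> x = \<phi> (- x)"
  using cring.axioms(1)[OF rep_cring]
  by (intro abelian_group.minus_equality ring.is_abelian_group) (auto simp: rep_simps ring_in)

lemma rep_ideal:
  assumes "I \<subseteq> T" shows "ideal (\<phi> ` I) L \<longleftrightarrow> ideal_in T I"
proof
  assume "ideal (\<phi> ` I) L"
  then interpret ideal "\<phi> ` I" L .
  show "ideal_in T I"
    unfolding ideal_in_def
  proof (intro conjI ballI)
    show "0 \<in> I" using additive_subgroup.zero_closed[OF is_additive_subgroup] rep_zero rep_mem[OF assms zero_in] by simp
    fix x y assume "x \<in> I" "y \<in> I"
    then have xy: "\<phi> x \<in> \<phi> ` I" "\<phi> y \<in> \<phi> ` I" "x \<in> T" "y \<in> T" using assms by auto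
    then have "\<phi> x \<oplus>\<^bsub>L\<^esub> \<phi> y \<in> \<phi> ` I"
      by (intro additive_subgroup.a_closed[OF is_additive_subgroup])
    then have "\<phi> (x + y) \<in> \<phi> ` I" "x + y \<in> T"
      using xy by (auto simp: rep_add add_in)
    then show "x + y \<in> I" using rep_mem[OF assms] by blast
  next
    fix r x assume "r \<in> T" "x \<in> I"
    then have "\<phi> (r * x) \<in> \<phi> ` I" "r * x \<in> T"
      using I_l_closed[of "\<phi> x" "\<phi> r"] assms rep_mult[of r x] mult_in[of r x]
      by (auto simp: rep_carrier subset_iff)
    then show "r * x \<in> I" using rep_mem[OF assms] by blast
  qed (fact assms)
next
  assume I: "ideal_in T I"
  show "ideal (\<phi> ` I) L"
  proof (rule idealI)
    show "ring L" using rep_cring by (rule cring.axioms)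
    then interpret ring L .
    show "subgroup (\<phi> ` I) (add_monoid L)"
    proof (rule add.subgroupI)
      show "\<phi> ` I \<subseteq> carrier L" using assms by (auto simp: rep_carrier)
      show "\<phi> ` I \<noteq> {}" using ideal_inD(2)[OF I] by auto
      fix a assume "a \<in> \<phi> ` I"
      then show "\<ominus>\<^bsub>L\<^esub> a \<in> \<phi> ` I" using assms ideal_uminus[OF I] rep_neg by auto
      fix b assume "b \<in> \<phi> ` I"
      with \<open>a \<in> \<phi> ` I\<close> show "a \<oplus>\<^bsub>L\<^esub> b \<in> \<phi> ` I"
        using assms ideal_inD(3)[OF I] rep_add by (auto simp: subset_iff)
    qed
    fix a x assume "a \<in> \<phi> ` I" "x \<in> carrier L"
    then show "x \<otimes>\<^bsub>L\<^esub> a \<in> \<phi> ` I" "a \<otimes>\<^bsub>L\<^esub> x \<in> \<phi> ` I"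
      using assms ideal_inD(4,5)[OF I] rep_mult by (auto simp: rep_carrier subset_iff)
  qed
qed

lemma rep_prime:
  assumes "P \<subseteq> T" shows "primeideal (\<phi> ` P) L \<longleftrightarrow> prime_in T P"
proof
  assume "primeideal (\<phi> ` P) L"
  then interpret primeideal "\<phi> ` P" L .
  have P: "ideal_in T P" using rep_ideal[OF assms] is_ideal by simp
  show "prime_in T P"
    unfolding prime_in_def
  proof (intro conjI ballI impI)
    show "1 \<notin> P" using I_notcarr ideal_eq_ring[OF P] rep_carrier by auto
    fix x y assume "x \<in> T" "y \<in> T" "x * y \<in> P"
    then show "x \<in> P \<or> y \<in> P"
      using I_prime[of "\<phi> x" "\<phi> y"] rep_mult[of x y] rep_mem[OF assms] by (auto simp: rep_carrier)
  qed (fact P)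
next
  assume P: "prime_in T P"
  show "primeideal (\<phi> ` P) L"
  proof (intro primeideal.intro primeideal_axioms.intro)
    show "ideal (\<phi> ` P) L" using rep_ideal[OF assms] P prime_inD by blast
    show "carrier L \<noteq> \<phi> ` P" 
      using prime_inD(2)[OF P] one_in rep_mem[OF assms one_in] by (auto simp: rep_carrier)
    show "a \<in> \<phi> ` P \<or> b \<in> \<phi> ` P"
      if "a \<in> carrier L" "b \<in> carrier L" "a \<otimes>\<^bsub>L\<^esub> b \<in> \<phi> ` P" for a b
    proof -
      note * = that
      then obtain x y where xy: "a = \<phi> x" "b = \<phi> y" "x \<in> T" "y \<in> T" by (auto simp: rep_carrier)
      then have "x * y \<in> P" using *(3) rep_mem[OF assms, of "x * y"] by (simp add: rep_mult mult_in)
      then show ?thesis using prime_inD(3)[OF P] xy by blast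
    qed
  qed (fact rep_cring)
qed

lemma rep_idealE:
  assumes "ideal J L"
  obtains I where "I \<subseteq> T" "J = \<phi> ` I"
proof
  show "J = \<phi> ` {x \<in> T. \<phi> x \<in> J}"
    using additive_subgroup.a_subset[OF ideal.axioms(1)[OF assms]] rep_carrier by auto
qed auto

lemma rep_genideal:
  assumes "A \<subseteq> T" shows "genideal L (\<phi> ` A) = \<phi> ` gen T A"
proof
  have sub: "gen T A \<subseteq> T" using gen_ideal[OF assms] by (auto dest: ideal_inD)
  show "genideal L (\<phi> ` A) \<subseteq> \<phi> ` gen T A"
    unfolding genideal_def using rep_ideal[OF sub] gen_ideal[OF assms] gen_incl by blast
  show "\<phi> ` gen T A \<subseteq> genideal L (\<phi> ` A)"
    unfolding genideal_def
  proof (rule Inter_greatest, safe)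
    fix J x assume J: "ideal J L" "\<phi> ` A \<subseteq> J" and x: "x \<in> gen T A"
    obtain I where I: "I \<subseteq> T" "J = \<phi> ` I" by (rule rep_idealE[OF J(1)])
    have "A \<subseteq> I" using J(2) I assms rep_mem[OF I(1)] by blast
    then have "gen T A \<subseteq> I" using gen_least rep_ideal[OF I(1)] J I by blast
    then show "\<phi> x \<in> J" using I x by blast
  qed
qed

lemma rep_prime_chain:
  assumes "P \<subseteq> T"
  shows "(\<exists>c. (\<forall>i\<le>m. primeideal (c i) L) \<and> (\<forall>i<m. c i \<subset> c (Suc i)) \<and> c m = \<phi> ` P)
    \<longleftrightarrow> (\<exists>c. prime_chain T P m c)"
proof safe
  fix c assume c: "\<forall>i\<le>m. primeideal (c i) L" "\<forall>i<m. c i \<subset> c (Suc i)" "c m = \<phi> ` P"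
  define e where "e i = {x \<in> T. \<phi> x \<in> c i}" for i
  have ce: "c i = \<phi> ` e i" if im: "i \<le> m" for i
  proof -
    obtain I where "I \<subseteq> T" "c i = \<phi> ` I"
      by (rule rep_idealE[OF primeideal.axioms(1)[OF c(1)[rule_format, OF im]]])
    then show ?thesis unfolding e_def by auto
  qed
  have "e m = P" using c(3) rep_mem[OF assms] assms by (auto simp: e_def)
  moreover have "prime_in T (e i)" if "i \<le> m" for i
    using c(1) that ce[OF that] rep_prime[of "e i"] by (auto simp: e_def)
  moreover have "e i \<subset> e (Suc i)" if "i < m" for i
  proof -
    have "\<phi> ` e i \<subset> \<phi> ` e (Suc i)"
      using c(2)[rule_format, OF that] ce[of i] ce[of "Suc i"] that by simp
    moreover have "e i \<subseteq> e (Suc i)" using c(2) that by (auto simp: e_def)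
    ultimately show ?thesis by blast
  qed
  ultimately show "\<exists>c. prime_chain T P m c" unfolding prime_chain_def by blast
next
  fix c assume c: "prime_chain T P m c"
  have sub: "c i \<subseteq> T" if "i \<le> m" for i
    using c that by (auto simp: prime_chain_def dest!: prime_inD(1) ideal_inD(1))
  show "\<exists>c. (\<forall>i\<le>m. primeideal (c i) L) \<and> (\<forall>i<m. c i \<subset> c (Suc i)) \<and> c m = \<phi> ` P"
  proof (intro exI[of _ "\<lambda>i. \<phi> ` c i"] conjI allI impI)
    fix i assume "i < m"
    then have "c i \<subset> c (Suc i)" "c (Suc i) \<subseteq> T" using c sub by (auto simp: prime_chain_def)
    then show "\<phi> ` c i \<subset> \<phi> ` c (Suc i)"
      by (intro image_strict_mono inj_on_subset[OF rep_inj])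
  qed (use c rep_prime[OF sub] in \<open>auto simp: prime_chain_def\<close>)
qed

lemma rep_prime_height:
  assumes "P \<subseteq> T"
  shows "prime_height L (\<phi> ` P) = Sup {enat m | m. \<exists>c. prime_chain T P m c}"
  unfolding prime_height_def rep_prime_chain[OF assms] ..

lemma rep_height_le:
  assumes "prime_in T P" "I \<subseteq> P" "\<And>m c. prime_chain T P m c \<Longrightarrow> m \<le> r"
  shows "ideal_height L (\<phi> ` I) \<le> enat r"
proof -
  have PT: "P \<subseteq> T" using assms(1) by (auto dest!: prime_inD(1) ideal_inD(1))
  have "ideal_height L (\<phi> ` I) \<le> prime_height L (\<phi> ` P)"
    unfolding ideal_height_def using assms rep_prime[OF PT] by (intro Inf_lower) auto
  also have "\<dots> \<le> enat r"
    unfolding rep_prime_height[OF PT] using assms(3) by (intro Sup_least) auto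
  finally show ?thesis .
qed

lemma rep_height_ge:
  assumes "I \<subseteq> T" "\<And>P. prime_in T P \<Longrightarrow> I \<subseteq> P \<Longrightarrow> \<exists>c. prime_chain T P r c"
  shows "enat r \<le> ideal_height L (\<phi> ` I)"
  unfolding ideal_height_def
proof (intro Inf_greatest, safe)
  fix J assume J: "primeideal J L" "\<phi> ` I \<subseteq> J"
  obtain P where P: "P \<subseteq> T" "J = \<phi> ` P" by (rule rep_idealE[OF primeideal.axioms(1)[OF J(1)]])
  have "prime_in T P" using rep_prime[OF P(1)] J P by simp
  moreover have "I \<subseteq> P" using J(2) P assms(1) rep_mem[OF P(1)] by blast
  ultimately obtain c where "prime_chain T P r c" using assms(2) by blast
  then show "enat r \<le> prime_height L J"
    unfolding P(2) rep_prime_height[OF P(1)] by (intro Sup_upper) auto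
qed

lemma rep_min_gens_le:
  assumes "finite A" "A \<subseteq> T" "card A \<le> r"
  shows "min_gens L (\<phi> ` gen T A) \<le> enat r"
proof -
  have "card (\<phi> ` A) = card A" by (intro card_image inj_on_subset[OF rep_inj assms(2)])
  then have "min_gens L (\<phi> ` gen T A) \<le> enat (card A)"
    unfolding min_gens_def using assms rep_genideal[OF assms(2)]
    by (intro Inf_lower) (auto simp: rep_carrier intro!: exI[of _ "\<phi> ` A"])
  also have "\<dots> \<le> enat r" using assms(3) by simp
  finally show ?thesis .
qed

lemma rep_min_gens_ge:
  assumes "I \<subseteq> T" "\<And>A. finite A \<Longrightarrow> A \<subseteq> T \<Longrightarrow> gen T A = I \<Longrightarrow> r \<le> enat (card A)"
  shows "r \<le> min_gens L (\<phi> ` I)"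
  unfolding min_gens_def
proof (intro Inf_greatest, safe)
  fix B assume B: "finite B" "B \<subseteq> carrier L" "genideal L B = \<phi> ` I"
  define A where "A = {x \<in> T. \<phi> x \<in> B}"
  have BA: "B = \<phi> ` A" using B(2) by (auto simp: A_def rep_carrier)
  have AT: "A \<subseteq> T" by (auto simp: A_def)
  have inj: "inj_on \<phi> A" by (rule inj_on_subset[OF rep_inj AT])
  have "finite A" using B(1) finite_imageD[OF _ inj] BA by simp
  moreover have "gen T A = I"
  proof -
    have "\<phi> ` gen T A = \<phi> ` I" using rep_genideal[OF AT] B(3) BA by simp
    moreover have "gen T A \<subseteq> T" using gen_ideal[OF AT] by (auto dest: ideal_inD)
    ultimately show ?thesis using inj_on_image_eq_iff[OF rep_inj _ assms(1)] by blast
  qed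
  ultimately show "r \<le> enat (card B)"
    using assms(2)[of A] AT card_image[OF inj] BA by simp
qed

lemma rep_minimal_primes:
  assumes "I \<subseteq> T"
  shows "minimal_primes L (\<phi> ` I) = {\<phi> ` P | P. minimal_over T I P}"
proof -
  have sub: "P \<subseteq> T" if "prime_in T P" for P using that by (auto dest!: prime_inD(1) ideal_inD(1))
  have img: "\<phi> ` A \<subseteq> \<phi> ` B \<longleftrightarrow> A \<subseteq> B" if "A \<subseteq> T" "B \<subseteq> T" for A B
    using that rep_mem[of B] by blast
  have ex: "\<exists>P. P \<subseteq> T \<and> Q = \<phi> ` P \<and> prime_in T P" if Q: "primeideal Q L" for Q
  proof -
    obtain P where "P \<subseteq> T" "Q = \<phi> ` P"
      by (rule rep_idealE[OF primeideal.axioms(1)[OF Q]])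
    then show ?thesis using Q rep_prime by auto
  qed
  show ?thesis
  proof safe
    fix Q assume Q: "Q \<in> minimal_primes L (\<phi> ` I)"
    then have "primeideal Q L" by (simp add: minimal_primes_def)
    from ex[OF this] obtain P where P: "P \<subseteq> T" "Q = \<phi> ` P" "prime_in T P" by blast
    have "minimal_over T I P"
      unfolding minimal_over_def
    proof (intro conjI allI impI)
      have "\<phi> ` I \<subseteq> \<phi> ` P" using Q P by (simp add: minimal_primes_def)
      then show "I \<subseteq> P" using img[OF assms P(1)] by simp
      fix R assume R: "prime_in T R" "I \<subseteq> R" "R \<subseteq> P"
      then have "primeideal (\<phi> ` R) L" "\<phi> ` I \<subseteq> \<phi> ` R" "\<phi> ` R \<subseteq> Q"
        using rep_prime[OF sub[OF R(1)]] P by auto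
      then have "\<phi> ` R = \<phi> ` P" using Q P by (simp add: minimal_primes_def)
      then show "R = P" using inj_on_image_eq_iff[OF rep_inj sub[OF R(1)] P(1)] by simp
    qed (fact P)
    then show "\<exists>P. Q = \<phi> ` P \<and> minimal_over T I P" using P by blast
  next
    fix P assume P: "minimal_over T I P"
    then have Pp: "prime_in T P" "I \<subseteq> P" by (auto simp: minimal_over_def)
    show "\<phi> ` P \<in> minimal_primes L (\<phi> ` I)"
      unfolding minimal_primes_def
    proof (intro CollectI conjI allI impI)
      show "primeideal (\<phi> ` P) L" using rep_prime[OF sub] Pp by blast
      show "\<phi> ` I \<subseteq> \<phi> ` P" using Pp by blast
      fix Q assume Q: "primeideal Q L \<and> \<phi> ` I \<subseteq> Q \<and> Q \<subseteq> \<phi> ` P"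
      obtain R where R: "R \<subseteq> T" "Q = \<phi> ` R" "prime_in T R" using ex[of Q] Q by blast
      then have "I \<subseteq> R" "R \<subseteq> P" using Q img[OF assms R(1)] img[OF R(1) sub[OF Pp(1)]] by auto
      then have "R = P" using P R unfolding minimal_over_def by blast
      then show "Q = \<phi> ` P" using R by blast
    qed
  qed
qed

end

section \<open>Polynomial rings\<close>

text \<open>Monomials are themselves finitely supported functions, so \<open>lookup\<close> is used for the
  coefficients of polynomials and for the exponents of monomials.\<close>

abbreviation lookup :: "('a \<Rightarrow>\<^sub>0 'b::zero) \<Rightarrow> 'a \<Rightarrow> 'b" where "lookup \<equiv> Poly_Mapping.lookup"
abbreviation keys :: "('a \<Rightarrow>\<^sub>0 'b::zero) \<Rightarrow> 'a set" where "keys \<equiv> Poly_Mapping.keys"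
abbreviation single :: "'a \<Rightarrow> 'b \<Rightarrow> 'a \<Rightarrow>\<^sub>0 'b::zero" where "single \<equiv> Poly_Mapping.single"

definition polys_in :: "'x set \<Rightarrow> ('x, 'k::field) mpoly set" where
  "polys_in X = {p. \<forall>m\<in>keys p. keys m \<subseteq> X}"

lemma keys_diff_subset:
  "keys (p - q :: 'a \<Rightarrow>\<^sub>0 'b::ab_group_add) \<subseteq> keys p \<union> keys q"
  by (auto simp: in_keys_iff lookup_minus)

lemma lookup_sum_single:
  assumes "finite A"
  shows "lookup (\<Sum>t\<in>A. single t (g t)) u = (if u \<in> A then g u else 0)"
  using assms by (simp add: lookup_sum lookup_single when_def)

lemma sum_of_monomials:
  "(\<Sum>t\<in>keys p. single t (lookup p t)) = p"
  by (rule poly_mapping_eqI) (auto simp: lookup_sum_single in_keys_iff)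

text \<open>If \<open>s + t\<close> arises in only one way as a product of monomials, the corresponding coefficient of
  the product involves no sum. This is how coefficients of products are computed throughout.\<close>

lemma lookup_mult_unique:
  fixes p q :: "('x, 'k::comm_ring_1) mpoly"
  assumes u: "\<And>a b. a \<in> keys p \<Longrightarrow> b \<in> keys q \<Longrightarrow> a + b = s + t \<Longrightarrow> a = s \<and> b = t"
  shows "lookup (p * q) (s + t) = lookup p s * lookup q t"
proof -
  define p' where "p' = p - single s (lookup p s)"
  define q' where "q' = q - single t (lookup q t)"
  have p': "a \<in> keys p \<and> a \<noteq> s" if "a \<in> keys p'" for a
    using that by (auto simp: p'_def in_keys_iff lookup_minus lookup_single when_def split: if_splits)
  have q': "a \<in> keys q \<and> a \<noteq> t" if "a \<in> keys q'" for a
    using that by (auto simp: q'_def in_keys_iff lookup_minus lookup_single when_def split: if_splits)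
  have eq: "p * q = single (s + t) (lookup p s * lookup q t)
      + single s (lookup p s) * q' + p' * q"
    unfolding p'_def q'_def mult_single[symmetric] by (simp add: algebra_simps)
  have "s + t \<notin> keys (single s (lookup p s) * q')"
  proof
    assume "s + t \<in> keys (single s (lookup p s) * q')"
    then obtain b where "s + t = s + b" "b \<in> keys q'"
      using keys_mult[of "single s (lookup p s)" q'] by (auto split: if_splits)
    then show False using q' by auto
  qed
  moreover have "s + t \<notin> keys (p' * q)"
  proof
    assume "s + t \<in> keys (p' * q)"
    then obtain a b where "s + t = a + b" "a \<in> keys p'" "b \<in> keys q"
      using keys_mult[of p' q] by auto
    then show False using p' u[of a b] by auto
  qed
  ultimately show ?thesis
    unfolding eq by (simp add: lookup_add in_keys_iff)
qed

lemma polys_in_subring: "subring_set (polys_in X :: ('x, 'k::field) mpoly set)"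
proof
  show "1 \<in> (polys_in X :: ('x, 'k) mpoly set)" by (auto simp: polys_in_def)
  fix p q :: "('x, 'k) mpoly" assume pq: "p \<in> polys_in X" "q \<in> polys_in X"
  show "p - q \<in> polys_in X"
    using pq keys_diff_subset[of p q] unfolding polys_in_def by blast
  show "p * q \<in> polys_in X"
    unfolding polys_in_def
  proof safe
    fix m x assume "m \<in> keys (p * q)" and x: "x \<in> keys m"
    then obtain a b where "m = a + b" "a \<in> keys p" "b \<in> keys q"
      using keys_mult[of p q] by blast
    then show "x \<in> X" using x pq keys_add[of a b] unfolding polys_in_def by blast
  qed
qed

lemma single_in_polys_in: "keys m \<subseteq> X \<Longrightarrow> single m c \<in> polys_in X"
  by (auto simp: polys_in_def)

lemma polys_in_mono: "X \<subseteq> Y \<Longrightarrow> polys_in X \<subseteq> polys_in Y"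
  by (auto simp: polys_in_def)

lemma indet_in_polys_in: "x \<in> X \<Longrightarrow> indet x \<in> polys_in X"
  unfolding indet_def by (rule single_in_polys_in) simp

lemma indet_power: "indet x ^ k = single (single x k) (1::'k::field)"
  by (induction k) (auto simp: indet_def mult_single simp flip: single_add)

text \<open>The induction step that brings Hilbert's basis theorem to polynomial rings in finitely many
  variables.\<close>

lemma polys_in_insert:
  "polys_in (insert x X) = poly_ext (polys_in X) (indet x :: ('x, 'k::field) mpoly)"
proof
  interpret subring_set "polys_in X :: ('x, 'k) mpoly set" by (rule polys_in_subring)
  interpret E: subring_set "poly_ext (polys_in X) (indet x :: ('x, 'k) mpoly)" by (rule poly_ext_subring)
  interpret I: subring_set "polys_in (insert x X) :: ('x, 'k) mpoly set" by (rule polys_in_subring)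
  show "polys_in (insert x X) \<subseteq> poly_ext (polys_in X) (indet x :: ('x, 'k) mpoly)"
  proof
    fix p :: "('x, 'k) mpoly" assume p: "p \<in> polys_in (insert x X)"
    have "single m c \<in> poly_ext (polys_in X) (indet x)"
      if "m \<in> keys p" for m and c :: 'k
    proof -
      define k where "k = lookup m x"
      define m' where "m' = m - single x k"
      have m: "m = m' + single x k"
        by (rule poly_mapping_eqI) (auto simp: m'_def k_def lookup_add lookup_minus lookup_single when_def)
      have "keys m' \<subseteq> X"
      proof
        fix y assume "y \<in> keys m'"
        then have "y \<noteq> x" "y \<in> keys m"
          by (auto simp: in_keys_iff m'_def k_def lookup_minus lookup_single when_def split: if_splits)
        then show "y \<in> X" using that p by (auto simp: polys_in_def)
      qed
      then have "monom (single m' c) k \<in> polys_over (polys_in X)"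
        by (intro polys_over_closed single_in_polys_in)
      moreover have "poly (monom (single m' c) k) (indet x) = single m c"
        by (subst m) (simp add: poly_monom indet_power mult_single)
      ultimately show ?thesis unfolding poly_ext_def by (metis image_eqI)
    qed
    then have "(\<Sum>t\<in>keys p. single t (lookup p t)) \<in> poly_ext (polys_in X) (indet x)"
      by (intro E.sum_in) auto
    then show "p \<in> poly_ext (polys_in X) (indet x)" by (simp add: sum_of_monomials)
  qed
  show "poly_ext (polys_in X) (indet x :: ('x, 'k) mpoly) \<subseteq> polys_in (insert x X)"
  proof
    fix p :: "('x, 'k) mpoly" assume "p \<in> poly_ext (polys_in X) (indet x)"
    then obtain q where q: "q \<in> polys_over (polys_in X)" "p = poly q (indet x)"
      by (auto simp: poly_ext_def)
    have "coeff q i \<in> polys_in (insert x X)" for i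
      using q(1) polys_in_mono[of X "insert x X"] by (auto simp: polys_over_def)
    then show "p \<in> polys_in (insert x X)"
      unfolding q(2) poly_altdef using indet_in_polys_in[of x "insert x X"]
      by (intro I.sum_in I.mult_in I.power_in) auto
  qed
qed

lemma noetherian_constants: "noetherian (polys_in {} :: ('x, 'k::field) mpoly set)"
  unfolding noetherian_def
proof (intro allI impI)
  interpret subring_set "polys_in {} :: ('x, 'k) mpoly set" by (rule polys_in_subring)
  fix I :: "('x, 'k) mpoly set" assume I: "ideal_in (polys_in {}) I"
  show "\<exists>A. finite A \<and> A \<subseteq> I \<and> gen (polys_in {}) A = I"
  proof (cases "I = {0}")
    case True
    then show ?thesis using gen_of_ideal[OF I] by (intro exI[of _ I]) auto
  next
    case False
    then obtain p where p: "p \<in> I" "p \<noteq> 0" using ideal_inD(2)[OF I] by auto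
    define c where "c = lookup p 0"
    have "keys p \<subseteq> {0}"
      using ideal_inD(1)[OF I p(1)] by (auto simp: polys_in_def)
    then have pc: "p = single 0 c"
      by (intro poly_mapping_eqI) (auto simp: c_def lookup_single when_def in_keys_iff)
    then have "c \<noteq> 0" using p(2) by auto
    then have "single 0 (inverse c) * p = 1" by (simp add: pc mult_single)
    moreover have "single 0 (inverse c) \<in> polys_in {}" by (rule single_in_polys_in) simp
    ultimately have "1 \<in> I" using ideal_inD(4)[OF I _ p(1)] by metis
    then have "I = polys_in {}" using ideal_eq_ring[OF I] by simp
    moreover have "gen (polys_in {}) {1} = (polys_in {} :: ('x, 'k) mpoly set)"
      by (intro ideal_eq_ring gen_ideal gen_incl) (auto simp: one_in)
    ultimately show ?thesis using \<open>1 \<in> I\<close> by (intro exI[of _ "{1}"]) auto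
  qed
qed

lemma noetherian_polys_in: "finite X \<Longrightarrow> noetherian (polys_in X :: ('x, 'k::field) mpoly set)"
proof (induction X rule: finite_induct)
  case (insert x X)
  then show ?case
    unfolding polys_in_insert using subring_set.hilbert_basis[OF polys_in_subring] by blast
qed (rule noetherian_constants)

section \<open>Coprime squarefree leading monomials\<close>

definition mono_dvd :: "('x \<Rightarrow>\<^sub>0 nat) \<Rightarrow> ('x \<Rightarrow>\<^sub>0 nat) \<Rightarrow> bool" where
  "mono_dvd s t \<longleftrightarrow> (\<forall>x. lookup s x \<le> lookup t x)"

lemma mono_dvd_add: "mono_dvd s (t + s)"
  by (simp add: mono_dvd_def lookup_add)

lemma mono_dvdE:
  assumes "mono_dvd s t" obtains u where "t = u + s"
proof
  show "t = (t - s) + s"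
    using assms by (intro poly_mapping_eqI) (auto simp: mono_dvd_def lookup_add lookup_minus)
qed

text \<open>The leading monomials \<open>m i\<close> are singled out by an additive weight \<open>\<omega>\<close> only, which need not
  separate all monomials. For squarefree pairwise coprime leading monomials the \<open>f i\<close> automatically
  form a Groebner basis, and the initial ideal is a radical complete intersection; the ideal of
  the \<open>f i\<close> inherits both properties.\<close>

locale coprime_leads =
  fixes X :: "'x::linorder set" and \<omega> :: "('x \<Rightarrow>\<^sub>0 nat) \<Rightarrow> nat"
    and I :: "'i set" and f :: "'i \<Rightarrow> ('x, 'k::field) mpoly" and m :: "'i \<Rightarrow> 'x \<Rightarrow>\<^sub>0 nat"
  assumes finI: "finite I"
    and \<omega>_add: "\<omega> (s + t) = \<omega> s + \<omega> t"
    and f_in: "i \<in> I \<Longrightarrow> f i \<in> polys_in X"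
    and lead_coeff: "i \<in> I \<Longrightarrow> lookup (f i) (m i) = 1"
    and lower: "i \<in> I \<Longrightarrow> t \<in> keys (f i) \<Longrightarrow> t \<noteq> m i \<Longrightarrow> \<omega> t < \<omega> (m i)"
    and squarefree: "i \<in> I \<Longrightarrow> lookup (m i) x \<le> 1"
    and coprime: "i \<in> I \<Longrightarrow> j \<in> I \<Longrightarrow> i \<noteq> j \<Longrightarrow> keys (m i) \<inter> keys (m j) = {}"
begin

abbreviation T :: "('x, 'k) mpoly set" where "T \<equiv> polys_in X"

sublocale subring_set T by (rule polys_in_subring)

definition standard :: "'i set \<Rightarrow> ('x \<Rightarrow>\<^sub>0 nat) \<Rightarrow> bool" where
  "standard G t \<longleftrightarrow> (\<forall>i\<in>G. \<not> mono_dvd (m i) t)"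

definition reduced :: "'i set \<Rightarrow> ('x, 'k) mpoly \<Rightarrow> bool" where
  "reduced G p \<longleftrightarrow> (\<forall>t\<in>keys p. standard G t)"

text \<open>Ties between monomials of the same weight are broken by the linear order of monomials, so
  that leading monomials of arbitrary polynomials exist and are multiplicative.\<close>

definition is_lead :: "('x, 'k) mpoly \<Rightarrow> ('x \<Rightarrow>\<^sub>0 nat) \<Rightarrow> bool" where
  "is_lead p t \<longleftrightarrow> t \<in> keys p \<and>
     (\<forall>u\<in>keys p. u \<noteq> t \<longrightarrow> \<omega> u < \<omega> t \<or> \<omega> u = \<omega> t \<and> u < t)"

lemma f_img: "G \<subseteq> I \<Longrightarrow> f ` G \<subseteq> T" using f_in by auto

lemma reduced_diff: "reduced G p \<Longrightarrow> reduced G q \<Longrightarrow> reduced G (p - q)"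
  unfolding reduced_def using keys_diff_subset[of p q] by blast

lemma weight_bound: obtains D where "\<And>t. t \<in> keys (p :: ('x, 'k) mpoly) \<Longrightarrow> \<omega> t \<le> D"
proof
  fix t assume "t \<in> keys p"
  then show "\<omega> t \<le> Max (\<omega> ` keys p)" by (intro Max_ge) auto
qed

text \<open>Division with remainder: each nonstandard monomial \<open>u + m i\<close> is replaced by \<open>u\<close> times the lower
  part of \<open>f i\<close>, of smaller weight. Coefficients of standard monomials of the top weight \<open>D\<close> are not
  affected, which is what allows leading terms to be followed through a reduction.\<close>

lemma reduce:
  assumes "G \<subseteq> I" "q \<in> T" "\<And>t. t \<in> keys q \<Longrightarrow> \<omega> t \<le> D"
  shows "\<exists>p\<in>T. q - p \<in> gen T (f ` G) \<and> reduced G p \<and>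
    (\<forall>t. D \<le> \<omega> t \<longrightarrow> standard G t \<longrightarrow> lookup p t = lookup q t)"
  using assms(2,3)
proof (induction D arbitrary: q rule: less_induct)
  case (less D)
  note Gi = gen_ideal[OF f_img[OF assms(1)]]
  let ?c = "lookup q"
  define K where "K = {t \<in> keys q. \<not> standard G t}"
  have finK: "finite K" by (simp add: K_def)
  have "\<exists>i u. i \<in> G \<and> t = u + m i" if "t \<in> K" for t
    using that unfolding K_def standard_def by (auto elim!: mono_dvdE)
  then obtain i u where iu: "\<And>t. t \<in> K \<Longrightarrow> i t \<in> G \<and> t = u t + m (i t)" by metis
  define r where "r t = single (u t) (?c t) * f (i t)" for t
  define q1 where "q1 = (\<Sum>t\<in>keys q - K. single t (?c t))"
  define q3 where "q3 = (\<Sum>t\<in>K. single t (?c t) - r t)"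
  have KT: "keys t \<subseteq> X" if "t \<in> keys q" for t
    using that less.prems(1) by (auto simp: polys_in_def)
  have uT: "single (u t) c \<in> T" if "t \<in> K" for t c
  proof (rule single_in_polys_in)
    have "t = u t + m (i t)" using iu that by blast
    then have "keys (u t) \<subseteq> keys t"
      by (metis add_is_0 in_keys_iff lookup_add subsetI)
    then show "keys (u t) \<subseteq> X" using KT that by (auto simp: K_def)
  qed
  have rG: "r t \<in> gen T (f ` G)" if "t \<in> K" for t
    unfolding r_def using iu that by (intro ideal_inD(4)[OF Gi] uT gen_incl) auto
  have q: "q = q1 + (\<Sum>t\<in>K. single t (?c t))"
  proof -
    have "q = (\<Sum>t\<in>keys q. single t (?c t))" by (simp add: sum_of_monomials)
    also have "\<dots> = q1 + (\<Sum>t\<in>K. single t (?c t))"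
      unfolding q1_def by (rule sum.subset_diff) (auto simp: K_def)
    finally show ?thesis .
  qed
  have q': "q - q1 - q3 \<in> gen T (f ` G)"
  proof -
    have "q - q1 - q3 = (\<Sum>t\<in>K. r t)" unfolding q3_def using q by (simp add: sum_subtractf algebra_simps)
    then show ?thesis using ideal_sum[OF Gi rG, of K "\<lambda>t. t"] by simp
  qed
  have q1T: "q1 \<in> T"
    unfolding q1_def by (intro sum_in single_in_polys_in KT) auto
  have q3T: "q3 \<in> T"
  proof -
    have "q3 = q - q1 - (q - q1 - q3)" by simp
    also have "\<dots> \<in> T" by (rule diff_in[OF diff_in[OF less.prems(1) q1T] ideal_inD(1)[OF Gi q']])
    finally show ?thesis .
  qed
  have low: "\<omega> v < D" if v: "v \<in> keys q3" for v
  proof -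
    have "\<exists>t\<in>K. v \<in> keys (single t (?c t) - r t)"
    proof (rule ccontr)
      assume "\<not> ?thesis"
      then have "lookup q3 v = 0" by (auto simp: q3_def lookup_sum in_keys_iff)
      then show False using v by (simp add: in_keys_iff)
    qed
    then obtain t where t: "t \<in> K" "v \<in> keys (single t (?c t) - r t)" by blast
    have it: "i t \<in> I" "t = u t + m (i t)" using iu[OF t(1)] assms(1) by auto
    have tD: "\<omega> t \<le> D" using t less.prems(2) by (auto simp: K_def)
    have "lookup (r t) (u t + m (i t)) = ?c t * 1"
      unfolding r_def using lead_coeff[OF it(1)]
      by (subst lookup_mult_unique) (auto split: if_splits)
    then have "v \<noteq> t" using t(2) it(2) by (auto simp: in_keys_iff lookup_minus)
    then have "v \<in> keys (r t)"
      using t(2) by (auto simp: in_keys_iff lookup_minus lookup_single when_def)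
    then obtain b where b: "b \<in> keys (f (i t))" "v = u t + b"
      unfolding r_def using keys_mult[of "single (u t) (?c t)" "f (i t)"]
      by (auto split: if_splits)
    then have "b \<noteq> m (i t)" using \<open>v \<noteq> t\<close> it by auto
    then have "\<omega> v < \<omega> t" using lower[OF it(1) b(1)] b(2) it(2) by (metis \<omega>_add nat_add_left_cancel_less)
    then show ?thesis using tD by simp
  qed
  obtain p3 where p3: "p3 \<in> T" "q3 - p3 \<in> gen T (f ` G)" "reduced G p3"
    "\<And>t. D \<le> \<omega> t \<Longrightarrow> standard G t \<Longrightarrow> lookup p3 t = lookup q3 t"
  proof (cases "D = 0")
    case True
    then have "q3 = 0" using low by (metis keys_eq_empty all_not_in_conv not_less_zero)
    then show ?thesis using that[of 0] zero_in ideal_inD(2)[OF Gi] by (auto simp: reduced_def)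
  next
    case False
    have "\<And>t. t \<in> keys q3 \<Longrightarrow> \<omega> t \<le> D - 1" using low by fastforce
    from less.IH[of "D - 1", OF _ q3T this] False show ?thesis
      using that by (meson diff_less diff_le_self le_trans less_one not_gr_zero)
  qed
  have q1: "lookup q1 t = (if t \<in> keys q \<and> standard G t then ?c t else 0)" for t
    unfolding q1_def by (subst lookup_sum_single) (auto simp: K_def)
  show ?case
  proof (intro bexI[of _ "q1 + p3"] conjI allI impI)
    show "q1 + p3 \<in> T" using q1T p3 by (auto intro: add_in)
    have "q - (q1 + p3) = (q - q1 - q3) + (q3 - p3)" by simp
    then show "q - (q1 + p3) \<in> gen T (f ` G)" using q' p3 ideal_inD(3)[OF Gi] by metis
    have "reduced G q1" using q1 by (auto simp: reduced_def in_keys_iff split: if_splits)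
    then show "reduced G (q1 + p3)" using p3(3) keys_add[of q1 p3] unfolding reduced_def by blast
    fix t assume t: "D \<le> \<omega> t" "standard G t"
    have "lookup q3 t = 0" using low t(1) by (meson in_keys_iff not_less)
    then show "lookup (q1 + p3) t = ?c t"
      using p3(4)[OF t] t(2) q1[of t] by (auto simp: lookup_add in_keys_iff)
  qed
qed

lemma normal_form:
  assumes "G \<subseteq> I" "q \<in> T"
  obtains p where "p \<in> T" "q - p \<in> gen T (f ` G)" "reduced G p"
  using reduce[OF assms] weight_bound[of q] by metis

lemma lead_exists:
  assumes "p \<noteq> 0" obtains t where "is_lead p t"
proof
  let ?D = "Max (\<omega> ` keys p)" and ?S = "\<lambda>D. {u \<in> keys p. \<omega> u = D}"
  have ne: "keys p \<noteq> {}" using assms by simp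
  have "?D \<in> \<omega> ` keys p" using ne by (intro Max_in) auto
  then have S: "?S ?D \<noteq> {}" by auto
  define t where "t = Max (?S ?D)"
  have t: "t \<in> ?S ?D" unfolding t_def using S by (intro Max_in) auto
  show "is_lead p t"
    unfolding is_lead_def
  proof (intro conjI ballI impI)
    show "t \<in> keys p" using t by simp
    fix u assume u: "u \<in> keys p" "u \<noteq> t"
    have "\<omega> u \<le> ?D" using u by (intro Max_ge) auto
    moreover have "u \<le> t" if "\<omega> u = ?D" unfolding t_def using that u by (intro Max_ge) auto
    ultimately show "\<omega> u < \<omega> t \<or> \<omega> u = \<omega> t \<and> u < t"
      using t u by (cases "\<omega> u = ?D") (auto simp: order.strict_iff_order)
  qed
qed

lemma lead_f: "i \<in> I \<Longrightarrow> is_lead (f i) (m i)"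
  unfolding is_lead_def using lower lead_coeff by (auto simp: in_keys_iff)

lemma lead_mult:
  assumes "is_lead p s" "is_lead q t"
  shows "lookup (p * q) (s + t) \<noteq> 0"
    and "\<And>u. u \<in> keys (p * q) \<Longrightarrow> \<omega> u \<le> \<omega> (s + t)"
proof -
  have p: "\<omega> a < \<omega> s \<or> \<omega> a = \<omega> s \<and> a < s \<or> a = s" if "a \<in> keys p" for a
    using assms(1) that unfolding is_lead_def by blast
  have q: "\<omega> a < \<omega> t \<or> \<omega> a = \<omega> t \<and> a < t \<or> a = t" if "a \<in> keys q" for a
    using assms(2) that unfolding is_lead_def by blast
  have "a = s \<and> b = t" if ab: "a \<in> keys p" "b \<in> keys q" "a + b = s + t" for a b
  proof -
    have w: "\<omega> a + \<omega> b = \<omega> s + \<omega> t" using ab(3) by (metis \<omega>_add)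
    then have "a \<le> s" "b \<le> t" using p[OF ab(1)] q[OF ab(2)] by auto
    then show ?thesis using ab(3) add_less_le_mono[of a s b t] add_le_less_mono[of a s b t]
      by (auto simp: order.order_iff_strict)
  qed
  then have "lookup (p * q) (s + t) = lookup p s * lookup q t"
    by (rule lookup_mult_unique)
  then show "lookup (p * q) (s + t) \<noteq> 0"
    using assms by (auto simp: is_lead_def in_keys_iff)
  fix u assume "u \<in> keys (p * q)"
  then obtain a b where "u = a + b" "a \<in> keys p" "b \<in> keys q"
    using keys_mult[of p q] by blast
  then show "\<omega> u \<le> \<omega> (s + t)" using p[of a] q[of b] by (auto simp: \<omega>_add)
qed

lemma standard_add_lead:
  assumes "G \<subseteq> I" "i \<in> I - G" "standard G t" shows "standard G (t + m i)"
  unfolding standard_def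
proof (intro ballI notI)
  fix j assume j: "j \<in> G" "mono_dvd (m j) (t + m i)"
  have "lookup (m j) x \<le> lookup t x" for x
  proof (cases "x \<in> keys (m j)")
    case True
    then have "x \<notin> keys (m i)" using coprime[of i j] j assms by blast
    then show ?thesis using j(2) by (auto simp: mono_dvd_def lookup_add in_keys_iff dest: spec[of _ x])
  qed (simp add: in_keys_iff)
  then show False using assms(3) j(1) by (auto simp: standard_def mono_dvd_def)
qed

text \<open>Multiplying a reduced polynomial by a further \<open>f i\<close> shifts its leading monomial by \<open>m i\<close>. By
  coprimality the result is still standard for \<open>G\<close>, so it is not lost in the reduction.\<close>

lemma lead_survives:
  assumes "G \<subseteq> I" "i \<in> I - G" "h \<in> T" "reduced G h" "h \<noteq> 0"
  obtains p t where "p \<in> T" "h * f i - p \<in> gen T (f ` G)" "reduced G p"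
    "t + m i \<in> keys p"
proof -
  obtain t where t: "is_lead h t" using lead_exists[OF assms(5)] .
  have fi: "is_lead (f i) (m i)" "f i \<in> T" using assms lead_f f_in by auto
  have "standard G (t + m i)"
    using standard_add_lead[OF assms(1,2)] assms(4) t by (auto simp: reduced_def is_lead_def)
  then show ?thesis
    using reduce[OF assms(1) mult_in[OF assms(3) fi(2)], of "\<omega> (t + m i)"] lead_mult[OF t fi(1)] that
    by (metis in_keys_iff order_refl)
qed

text \<open>Normal forms are unique. Write \<open>p = a + h * f i\<close> with \<open>h\<close> reduced by the previous generators; if \<open>h\<close>
  were not zero, the leading monomial of \<open>h * f i\<close> would appear in \<open>p\<close> and be divisible by \<open>m i\<close>.\<close>

lemma reduced_in_gen:
  assumes "G \<subseteq> I" "p \<in> gen T (f ` G)" "reduced G p" shows "p = 0"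
proof -
  have "finite G" using assms(1) finI finite_subset by blast
  then show ?thesis using assms
  proof (induction G arbitrary: p rule: finite_induct)
    case empty
    have "gen T {} \<subseteq> {0}" by (rule gen_least) (auto simp: ideal_in_def zero_in)
    then show ?case using empty by auto
  next
    case (insert i G)
    have iG: "G \<subseteq> I" "i \<in> I - G" using insert by auto
    have fi: "f i \<in> T" "f ` G \<subseteq> T" using f_in iG f_img by auto
    note Gi = gen_ideal[OF fi(2)]
    have "p \<in> adjoin T (gen T (f ` G)) (f i)"
      using insert.prems(2) gen_insert[OF fi(2,1)] by simp
    then obtain a h where ah: "p = a + h * f i" "a \<in> gen T (f ` G)" "h \<in> T"
      unfolding adjoin_def by blast
    obtain h' where h': "h' \<in> T" "h - h' \<in> gen T (f ` G)" "reduced G h'"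
      using normal_form[OF iG(1) ah(3)] .
    have a': "p - h' * f i \<in> gen T (f ` G)"
    proof -
      have "p - h' * f i = a + f i * (h - h')" using ah by (simp add: algebra_simps)
      then show ?thesis using ah(2) h'(2) fi(1) ideal_inD(3,4)[OF Gi] by metis
    qed
    have red: "reduced G p" using insert.prems(3) by (auto simp: reduced_def standard_def)
    show ?case
    proof (cases "h' = 0")
      case True
      then show ?thesis using insert.IH[OF iG(1) _ red] a' by simp
    next
      case False
      obtain p' t where p': "p' \<in> T" "h' * f i - p' \<in> gen T (f ` G)" "reduced G p'"
        "t + m i \<in> keys p'"
        using lead_survives[OF iG h'(1,3) False] .
      have "p - p' = (p - h' * f i) + (h' * f i - p')" by simp
      also have "\<dots> \<in> gen T (f ` G)" using a' p' ideal_inD(3)[OF Gi] by blast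
      finally have "p = p'" using insert.IH[OF iG(1) _ reduced_diff[OF red p'(3)]] by simp
      then show ?thesis
        using p'(4) insert.prems(3) mono_dvd_add[of "m i" t] by (auto simp: reduced_def standard_def)
    qed
  qed
qed

lemma regular: "regular_family T f I"
  unfolding regular_family_def
proof (intro allI impI)
  fix G i h assume G: "G \<subseteq> I" "i \<in> I - G" and h: "h \<in> T" "h * f i \<in> gen T (f ` G)"
  have fi: "f i \<in> T" "f ` G \<subseteq> T" using f_in G f_img by auto
  note Gi = gen_ideal[OF fi(2)]
  obtain h' where h': "h' \<in> T" "h - h' \<in> gen T (f ` G)" "reduced G h'"
    using normal_form[OF G(1) h(1)] .
  have "h' = 0"
  proof (rule ccontr)
    assume "h' \<noteq> 0"
    then obtain p t where p: "p \<in> T" "h' * f i - p \<in> gen T (f ` G)" "reduced G p"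
        "t + m i \<in> keys p"
      using lead_survives[OF G h'(1,3)] by metis
    have "p = h * f i - f i * (h - h') - (h' * f i - p)" by (simp add: algebra_simps)
    also have "\<dots> \<in> gen T (f ` G)"
      by (rule ideal_diff[OF Gi ideal_diff[OF Gi h(2) ideal_inD(4)[OF Gi fi(1) h'(2)]] p(2)])
    finally have "p = 0" using reduced_in_gen[OF G(1)] p by blast
    then show False using p by simp
  qed
  then show "h \<in> gen T (f ` G)" using h' by simp
qed

text \<open>A squarefree \<open>m i\<close> divides \<open>t + t\<close> only if it divides \<open>t\<close>, so squares of standard monomials are
  standard. Hence the leading term of the square of a nonzero normal form survives reduction.\<close>

lemma radical_square:
  assumes "h \<in> T" "h * h \<in> gen T (f ` I)" shows "h \<in> gen T (f ` I)"
proof -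
  note Gi = gen_ideal[OF f_img[OF order_refl]]
  obtain h' where h': "h' \<in> T" "h - h' \<in> gen T (f ` I)" "reduced I h'"
    using normal_form[OF order_refl assms(1)] .
  have "h' = 0"
  proof (rule ccontr)
    assume "h' \<noteq> 0"
    then obtain t where t: "is_lead h' t" using lead_exists by metis
    have "standard I t" using h'(3) t by (auto simp: reduced_def is_lead_def)
    have "standard I (t + t)"
      unfolding standard_def
    proof (intro ballI notI)
      fix i assume i: "i \<in> I" "mono_dvd (m i) (t + t)"
      have "lookup (m i) x \<le> lookup t x" for x
      proof -
        have "lookup (m i) x \<le> lookup t x + lookup t x"
          using i(2) by (simp add: mono_dvd_def lookup_add)
        then show ?thesis using squarefree[OF i(1), of x] by linarith
      qed
      then show False using \<open>standard I t\<close> i(1) by (auto simp: standard_def mono_dvd_def)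
    qed
    then obtain p where p: "p \<in> T" "h' * h' - p \<in> gen T (f ` I)" "reduced I p"
        "t + t \<in> keys p"
      using reduce[OF order_refl mult_in[OF h'(1,1)], of "\<omega> (t + t)"] lead_mult[OF t t]
      by (metis in_keys_iff order_refl)
    have "p = h * h - (h + h') * (h - h') - (h' * h' - p)" by (simp add: algebra_simps)
    also have "\<dots> \<in> gen T (f ` I)"
      by (rule ideal_diff[OF Gi ideal_diff[OF Gi assms(2)
            ideal_inD(4)[OF Gi add_in[OF assms(1) h'(1)] h'(2)]] p(2)])
    finally have "p = 0" using reduced_in_gen[OF order_refl] p by blast
    then show False using p by simp
  qed
  then show ?thesis using h' by simp
qed

lemma radical:
  assumes "h \<in> T" "h ^ k \<in> gen T (f ` I)" "k > 0" shows "h \<in> gen T (f ` I)"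
proof -
  note Gi = gen_ideal[OF f_img[OF order_refl]]
  have "h ^ Suc k \<in> gen T (f ` I) \<Longrightarrow> h \<in> gen T (f ` I)" for k
  proof (induction k)
    case (Suc k)
    have "h ^ Suc k * h ^ Suc k = h ^ k * h ^ Suc (Suc k)" by (simp add: algebra_simps)
    also have "\<dots> \<in> gen T (f ` I)"
      using Suc.prems assms(1) by (intro ideal_inD(4)[OF Gi] power_in)
    finally show ?case using Suc.IH radical_square[OF power_in[OF assms(1)]] by blast
  qed simp
  then show ?thesis using assms by (metis gr0_implies_Suc)
qed

end

section \<open>Krull's theorem in represented rings\<close>

definition ring_of :: "'a::comm_ring_1 set \<Rightarrow> 'a ring" where
  "ring_of T = \<lparr>carrier = T, monoid.mult = (*), one = 1, zero = 0, add = (+)\<rparr>"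

lemma ring_of_simps [simp]:
  "carrier (ring_of T) = T" "monoid.mult (ring_of T) = (*)" "one (ring_of T) = 1"
  "zero (ring_of T) = 0" "add (ring_of T) = (+)"
  by (simp_all add: ring_of_def)

lemma represents_ring_of: "represents (\<lambda>x. x) T (ring_of T)"
  by (auto simp: represents_def)

lemma poly_ring_eq: "poly_ring X = ring_of (polys_in X)"
  by (simp add: poly_ring_def ring_of_def polys_in_def)

context represented_ring
begin

text \<open>Krull's theorem as a bound on the height of an ideal. Taking \<open>I\<close> merely contained in the ideal
  of \<open>A\<close> permits \<open>A\<close> to generate something larger, as when variables are set to zero.\<close>

lemma rep_height_le_card:
  assumes N: "noetherian T" and A: "finite A" "A \<subseteq> P" and P: "prime_in T P" and I: "I \<subseteq> gen T A"
    and r: "card A \<le> r"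
  shows "ideal_height L (\<phi> ` I) \<le> enat r"
proof -
  have AT: "A \<subseteq> T" using A(2) ideal_inD(1)[OF prime_inD(1)[OF P]] by blast
  obtain Q where Q: "minimal_over T A Q" using minimal_prime_below[OF N P A(2)] by blast
  then have Qp: "prime_in T Q" "A \<subseteq> Q" by (auto simp: minimal_over_def)
  show ?thesis
  proof (rule rep_height_le[OF Qp(1)])
    show "I \<subseteq> Q" using I gen_least[OF prime_inD(1)[OF Qp(1)] Qp(2)] by blast
    show "m \<le> r" if "prime_chain T Q m c" for m c
      using krull_height[OF N A(1) AT Q that] r by simp
  qed
qed

lemma rep_height_le_min_gens:
  assumes N: "noetherian T" and P: "prime_in T P" "I \<subseteq> P"
  shows "ideal_height L (\<phi> ` I) \<le> min_gens L (\<phi> ` I)"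
proof (rule rep_min_gens_ge)
  show "I \<subseteq> T" using P ideal_inD(1)[OF prime_inD(1)[OF P(1)]] by blast
  fix A assume A: "finite A" "A \<subseteq> T" "gen T A = I"
  have "A \<subseteq> P" using A(3) gen_incl P(2) by blast
  then show "ideal_height L (\<phi> ` I) \<le> enat (card A)"
    using rep_height_le_card[OF N A(1) _ P(1), of I "card A"] A(3) by simp
qed

end

section \<open>Localization at a prime ideal\<close>

locale prime_localization = subring_set T for T :: "'a::idom set" +
  fixes P :: "'a set"
  assumes prime: "prime_in T P"
begin

text \<open>The local ring as a subring of the field of fractions of the ambient domain.\<close>

definition fracs :: "'a fract set" where
  "fracs = {Fract a s | a s. a \<in> T \<and> s \<in> T - P}"

definition extended :: "'a set \<Rightarrow> 'a fract set" where
  "extended I = {Fract a s | a s. a \<in> I \<and> s \<in> T - P}"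

text \<open>The set of all representatives of a fraction, which is the way in which the localization
  encodes its elements.\<close>

definition pairs :: "'a fract \<Rightarrow> ('a \<times> 'a) set" where
  "pairs q = {(b, t). b \<in> T \<and> t \<in> T - P \<and> Fract b t = q}"

lemma denom_nonzero: "s \<in> T - P \<Longrightarrow> s \<noteq> 0"
  using ideal_inD(2)[OF prime_inD(1)[OF prime]] by auto

lemma one_compl: "1 \<in> T - P"
  using prime_inD(2)[OF prime] one_in by auto

lemma fracs_subring: "subring_set fracs"
proof
  show "1 \<in> fracs" unfolding fracs_def One_fract_def using one_compl one_in by blast
  fix x y assume "x \<in> fracs" "y \<in> fracs"
  then obtain a s b t where xy: "x = Fract a s" "y = Fract b t" "a \<in> T" "b \<in> T" "s \<in> T - P" "t \<in> T - P"
    unfolding fracs_def by blast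
  have "x - y = Fract (a * t - b * s) (s * t)" "x * y = Fract (a * b) (s * t)"
    using xy denom_nonzero by auto
  then show "x - y \<in> fracs" "x * y \<in> fracs"
    unfolding fracs_def using prime_compl_mult[OF prime xy(5,6)] xy diff_in mult_in by blast+
qed

sublocale loc: subring_set fracs by (rule fracs_subring)

lemma loc_frac_eq:
  assumes "a \<in> T" "s \<in> T - P"
  shows "loc_frac (ring_of T) P a s = pairs (Fract a s)"
proof -
  have "(\<exists>u\<in>T - P. u * (a * t) = u * (b * s)) \<longleftrightarrow> Fract b t = Fract a s"
    if "t \<in> T - P" for b t
  proof -
    have "(\<exists>u\<in>T - P. u * (a * t) = u * (b * s)) \<longleftrightarrow> a * t = b * s"
      using denom_nonzero one_compl by auto
    also have "\<dots> \<longleftrightarrow> Fract b t = Fract a s" using denom_nonzero[OF that] denom_nonzero[OF assms(2)] by (auto simp: eq_fract)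
    finally show ?thesis .
  qed
  then show ?thesis unfolding loc_frac_def pairs_def by auto
qed

lemma pairs_mem: "a \<in> T \<Longrightarrow> s \<in> T - P \<Longrightarrow> (a, s) \<in> pairs (Fract a s)"
  by (auto simp: pairs_def)

lemma fracsE:
  assumes "q \<in> fracs" obtains a s where "q = Fract a s" "a \<in> T" "s \<in> T - P"
  using assms unfolding fracs_def by blast

lemma represents_localization: "represents pairs fracs (localization (ring_of T) P)"
  unfolding represents_def
proof (intro conjI ballI)
  show "inj_on pairs fracs"
  proof (rule inj_onI)
    fix q q' assume q: "q \<in> fracs" "q' \<in> fracs" "pairs q = pairs q'"
    obtain a s where "q = Fract a s" "a \<in> T" "s \<in> T - P" using fracsE[OF q(1)] .
    then show "q = q'" using pairs_mem[of a s] q(3) by (auto simp: pairs_def)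
  qed
  show "carrier (localization (ring_of T) P) = pairs ` fracs"
    unfolding localization_def fracs_def using loc_frac_eq by (auto simp: image_iff) (metis Diff_iff)+
  show "\<one>\<^bsub>localization (ring_of T) P\<^esub> = pairs 1" "\<zero>\<^bsub>localization (ring_of T) P\<^esub> = pairs 0"
    unfolding localization_def One_fract_def Zero_fract_def
    using loc_frac_eq[OF one_in one_compl] loc_frac_eq[OF zero_in one_compl] by auto
  fix q q' assume q: "q \<in> fracs" "q' \<in> fracs"
  obtain a0 s0 where as: "q = Fract a0 s0" "a0 \<in> T" "s0 \<in> T - P" using fracsE[OF q(1)] .
  obtain b0 t0 where bt: "q' = Fract b0 t0" "b0 \<in> T" "t0 \<in> T - P" using fracsE[OF q(2)] .
  have mem: "(a0, s0) \<in> pairs q" "(b0, t0) \<in> pairs q'" using pairs_mem as bt by auto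
  have m: "loc_frac (ring_of T) P (a * b) (s * t) = pairs (q * q')"
    and p: "loc_frac (ring_of T) P (a * t + b * s) (s * t) = pairs (q + q')"
    if "(a, s) \<in> pairs q" "(b, t) \<in> pairs q'" for a s b t
  proof -
    from that have *: "a \<in> T" "s \<in> T - P" "Fract a s = q" "b \<in> T" "t \<in> T - P" "Fract b t = q'"
      by (auto simp: pairs_def)
    have "q * q' = Fract (a * b) (s * t)" "q + q' = Fract (a * t + b * s) (s * t)"
      using * denom_nonzero by auto
    then show "loc_frac (ring_of T) P (a * b) (s * t) = pairs (q * q')"
      "loc_frac (ring_of T) P (a * t + b * s) (s * t) = pairs (q + q')"
      using loc_frac_eq[OF _ prime_compl_mult[OF prime *(2,5)]] * by (auto simp: ring_in)
  qed
  have "{loc_frac (ring_of T) P (a * b) (s * t) | a s b t. (a, s) \<in> pairs q \<and> (b, t) \<in> pairs q'} = {pairs (q * q')}"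
    using m mem by blast
  then show "pairs q \<otimes>\<^bsub>localization (ring_of T) P\<^esub> pairs q' = pairs (q * q')"
    by (simp add: localization_def)
  have "{loc_frac (ring_of T) P (a * t + b * s) (s * t) | a s b t. (a, s) \<in> pairs q \<and> (b, t) \<in> pairs q'} = {pairs (q + q')}"
    using p mem by blast
  then show "pairs q \<oplus>\<^bsub>localization (ring_of T) P\<^esub> pairs q' = pairs (q + q')"
    by (simp add: localization_def)
qed

sublocale rep: represented_ring fracs pairs "localization (ring_of T) P"
  by unfold_locales (rule represents_localization)

lemma localized_ideal_eq:
  assumes "I \<subseteq> T" shows "localized_ideal (ring_of T) P I = pairs ` extended I"
  unfolding localized_ideal_def extended_def using loc_frac_eq assms
  by (auto simp: image_iff subset_iff) (metis Diff_iff)+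

lemma extended_mem:
  assumes Q: "prime_in T Q" "Q \<subseteq> P" and "a \<in> T" "s \<in> T - P"
  shows "Fract a s \<in> extended Q \<longleftrightarrow> a \<in> Q"
proof
  assume "Fract a s \<in> extended Q"
  then obtain b t where b: "Fract a s = Fract b t" "b \<in> Q" "t \<in> T - P" unfolding extended_def by blast
  then have "a * t = b * s" using denom_nonzero assms(4) by (auto simp: eq_fract)
  also have "\<dots> \<in> Q" using b assms(4) ideal_inD(5)[OF prime_inD(1)[OF Q(1)]] by blast
  finally show "a \<in> Q" using prime_inD(3)[OF Q(1) assms(3), of t] b Q(2) by blast
qed (use assms in \<open>auto simp: extended_def\<close>)

lemma extended_ideal:
  assumes I: "ideal_in T I" shows "ideal_in fracs (extended I)"
  unfolding ideal_in_def
proof (intro conjI ballI)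
  show "extended I \<subseteq> fracs" using ideal_inD(1)[OF I] unfolding extended_def fracs_def by blast
  show "0 \<in> extended I" unfolding extended_def Zero_fract_def using ideal_inD(2)[OF I] one_compl by blast
  fix x assume "x \<in> extended I"
  then obtain a s where x: "x = Fract a s" "a \<in> I" "s \<in> T - P" unfolding extended_def by blast
  { fix y assume "y \<in> extended I"
    then obtain b t where y: "y = Fract b t" "b \<in> I" "t \<in> T - P" unfolding extended_def by blast
    have "x + y = Fract (a * t + b * s) (s * t)" using x y denom_nonzero by auto
    moreover have "a * t + b * s \<in> I" using x y ideal_inD(3,5)[OF I] by blast
    ultimately show "x + y \<in> extended I"
      unfolding extended_def using prime_compl_mult[OF prime x(3) y(3)] by blast }
  { fix r assume "r \<in> fracs"
    then obtain b t where r: "r = Fract b t" "b \<in> T" "t \<in> T - P" by (rule fracsE)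
    have "r * x = Fract (b * a) (t * s)" using x r by auto
    then show "r * x \<in> extended I"
      unfolding extended_def using prime_compl_mult[OF prime r(3) x(3)] ideal_inD(4)[OF I r(2) x(2)] by blast }
qed

lemma extended_prime:
  assumes Q: "prime_in T Q" "Q \<subseteq> P" shows "prime_in fracs (extended Q)"
  unfolding prime_in_def
proof (intro conjI ballI impI)
  show "ideal_in fracs (extended Q)" by (rule extended_ideal[OF prime_inD(1)[OF Q(1)]])
  show "1 \<notin> extended Q"
    unfolding One_fract_def using extended_mem[OF Q one_in one_compl] prime_inD(2)[OF Q(1)] by simp
  fix x y assume xy: "x \<in> fracs" "y \<in> fracs" "x * y \<in> extended Q"
  obtain a s where x: "x = Fract a s" "a \<in> T" "s \<in> T - P" using fracsE[OF xy(1)] .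
  obtain b t where y: "y = Fract b t" "b \<in> T" "t \<in> T - P" using fracsE[OF xy(2)] .
  have "a * b \<in> Q"
    using xy(3) x y extended_mem[OF Q mult_in[OF x(2) y(2)] prime_compl_mult[OF prime x(3) y(3)]] by simp
  then have "a \<in> Q \<or> b \<in> Q" using prime_inD(3)[OF Q(1)] x y by blast
  then show "x \<in> extended Q \<or> y \<in> extended Q" using x y by (auto simp: extended_def)
qed

definition contracted :: "'a fract set \<Rightarrow> 'a set" where
  "contracted J = {a \<in> T. Fract a 1 \<in> J}"

lemma frac_in_fracs: "a \<in> T \<Longrightarrow> s \<in> T - P \<Longrightarrow> Fract a s \<in> fracs"
  by (auto simp: fracs_def)

lemma contracted_ideal:
  assumes J: "ideal_in fracs J" shows "ideal_in T (contracted J)"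
  unfolding ideal_in_def
proof (intro conjI ballI)
  show "0 \<in> contracted J" using ideal_inD(2)[OF J] zero_in by (auto simp: contracted_def Zero_fract_def)
  fix x assume x: "x \<in> contracted J"
  { fix y assume y: "y \<in> contracted J"
    have "Fract (x + y) 1 = Fract x 1 + Fract y 1" by simp
    then show "x + y \<in> contracted J"
      using x y add_in ideal_inD(3)[OF J, of "Fract x 1" "Fract y 1"] by (auto simp: contracted_def) }
  { fix r assume r: "r \<in> T"
    have "Fract (r * x) 1 = Fract r 1 * Fract x 1" by simp
    then show "r * x \<in> contracted J"
      using x r mult_in ideal_inD(4)[OF J frac_in_fracs[OF r one_compl], of "Fract x 1"]
      by (auto simp: contracted_def) }
qed (auto simp: contracted_def)

lemma ideal_frac_mem:
  assumes J: "ideal_in fracs J" and as: "a \<in> T" "s \<in> T - P"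
  shows "Fract a s \<in> J \<longleftrightarrow> a \<in> contracted J"
proof
  assume "Fract a s \<in> J"
  then have "Fract s 1 * Fract a s \<in> J"
    using as one_compl by (intro ideal_inD(4)[OF J] frac_in_fracs) auto
  moreover have "Fract s 1 * Fract a s = Fract a 1" using denom_nonzero[OF as(2)] by (simp add: eq_fract)
  ultimately show "a \<in> contracted J" using as by (simp add: contracted_def)
next
  assume "a \<in> contracted J"
  then have "Fract 1 s * Fract a 1 \<in> J"
    using as one_in by (intro ideal_inD(4)[OF J] frac_in_fracs) (auto simp: contracted_def)
  then show "Fract a s \<in> J" by simp
qed

lemma gen_frac:
  assumes "x \<in> gen T A" shows "Fract x 1 \<in> gen fracs ((\<lambda>a. Fract a 1) ` A)"
  using assms
proof induction
  case (gen_step x r a)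
  have "Fract r 1 * Fract a 1 + Fract x 1 \<in> gen fracs ((\<lambda>a. Fract a 1) ` A)"
    using gen_step one_compl by (intro gen.gen_step frac_in_fracs) auto
  then show ?case by simp
qed (simp add: gen_zero flip: Zero_fract_def)

lemma gen_frac_img: "A \<subseteq> T \<Longrightarrow> (\<lambda>a. Fract a 1) ` A \<subseteq> fracs"
  using one_compl by (auto simp: fracs_def)

lemma noetherian_fracs:
  assumes "noetherian T" shows "noetherian fracs"
  unfolding noetherian_def
proof (intro allI impI)
  fix J assume J: "ideal_in fracs J"
  obtain A where A: "finite A" "A \<subseteq> contracted J" "gen T A = contracted J"
    using noetherianE[OF assms contracted_ideal[OF J]] .
  let ?A = "(\<lambda>a. Fract a 1) ` A"
  have AT: "A \<subseteq> T" using A(2) by (auto simp: contracted_def)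
  have sub: "?A \<subseteq> J" using A(2) by (auto simp: contracted_def)
  note gi = loc.gen_ideal[OF gen_frac_img[OF AT]]
  have "J \<subseteq> gen fracs ?A"
  proof
    fix q assume q: "q \<in> J"
    obtain a s where as: "q = Fract a s" "a \<in> T" "s \<in> T - P" using fracsE ideal_inD(1)[OF J q] by metis
    have "a \<in> gen T A" using A(3) ideal_frac_mem[OF J as(2,3)] q as by simp
    then have "a \<in> contracted (gen fracs ?A)" using gen_frac as(2) by (auto simp: contracted_def)
    then show "q \<in> gen fracs ?A" using ideal_frac_mem[OF gi as(2,3)] as by simp
  qed
  then show "\<exists>A. finite A \<and> A \<subseteq> J \<and> gen fracs A = J"
    using A(1) sub gen_least[OF J sub] by (intro exI[of _ ?A]) auto
qed

lemma extended_gen: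
  assumes I: "ideal_in T I" and B: "B \<subseteq> I" "\<And>x. x \<in> I \<Longrightarrow> \<exists>s\<in>T - P. s * x \<in> gen T B"
  shows "gen fracs ((\<lambda>a. Fract a 1) ` B) = extended I"
proof
  let ?B = "(\<lambda>a. Fract a 1) ` B"
  have BT: "B \<subseteq> T" using B(1) ideal_inD(1)[OF I] by blast
  note gi = loc.gen_ideal[OF gen_frac_img[OF BT]]
  show "gen fracs ?B \<subseteq> extended I"
    by (rule gen_least[OF extended_ideal[OF I]]) (use B(1) one_compl in \<open>auto simp: extended_def\<close>)
  show "extended I \<subseteq> gen fracs ?B"
  proof
    fix q assume "q \<in> extended I"
    then obtain a s where as: "q = Fract a s" "a \<in> I" "s \<in> T - P" unfolding extended_def by blast
    obtain t where t: "t \<in> T - P" "t * a \<in> gen T B" using B(2)[OF as(2)] by blast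
    have aT: "a \<in> T" using as ideal_inD(1)[OF I] by blast
    have "t * a \<in> contracted (gen fracs ?B)" using gen_frac[OF t(2)] t aT by (auto simp: contracted_def mult_in)
    then have "Fract (t * a) (t * s) \<in> gen fracs ?B"
      using ideal_frac_mem[OF gi mult_in prime_compl_mult[OF prime t(1) as(3)]] t aT by blast
    moreover have "Fract (t * a) (t * s) = q" using denom_nonzero[OF t(1)] denom_nonzero[OF as(3)] as(1) by (simp add: eq_fract)
    ultimately show "q \<in> gen fracs ?B" by simp
  qed
qed

text \<open>The localized ideal has only one prime above it, because the contraction of such a prime lies
  between \<open>I\<close> and \<open>P\<close>.\<close>

lemma primes_over_extended:
  assumes P: "minimal_over T I P" and q: "prime_in fracs q" "extended I \<subseteq> q"
  shows "q = extended P"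
proof -
  note qi = prime_inD(1)[OF q(1)]
  have pP: "prime_in T (contracted q)"
    unfolding prime_in_def
  proof (intro conjI ballI impI)
    show "1 \<notin> contracted q" using prime_inD(2)[OF q(1)] by (simp add: contracted_def One_fract_def)
    fix x y assume xy: "x \<in> T" "y \<in> T" "x * y \<in> contracted q"
    have "Fract x 1 * Fract y 1 \<in> q" using xy by (simp add: contracted_def)
    then show "x \<in> contracted q \<or> y \<in> contracted q"
      using prime_inD(3)[OF q(1)] frac_in_fracs one_compl xy by (auto simp: contracted_def)
  qed (rule contracted_ideal[OF qi])
  have IP: "I \<subseteq> P" using P by (auto simp: minimal_over_def)
  have "I \<subseteq> contracted q"
    using q(2) one_compl IP ideal_inD(1)[OF prime_inD(1)[OF prime]] unfolding contracted_def extended_def by blast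
  moreover have "contracted q \<subseteq> P"
  proof
    fix s assume s: "s \<in> contracted q"
    show "s \<in> P"
    proof (rule ccontr)
      assume "s \<notin> P"
      then have sT: "s \<in> T - P" using s by (auto simp: contracted_def)
      then have "Fract s s \<in> q" using ideal_frac_mem[OF qi, of s s] s by auto
      moreover have "Fract s s = 1" using denom_nonzero[OF sT] by (simp add: One_fract_def eq_fract)
      ultimately show False using prime_inD(2)[OF q(1)] by simp
    qed
  qed
  ultimately have cP: "contracted q = P" using P pP unfolding minimal_over_def by blast
  show ?thesis
  proof
    show "q \<subseteq> extended P"
    proof
      fix z assume z: "z \<in> q"
      obtain a s where as: "z = Fract a s" "a \<in> T" "s \<in> T - P" using fracsE ideal_inD(1)[OF qi z] by metis
      then show "z \<in> extended P" using ideal_frac_mem[OF qi as(2,3)] z cP by (auto simp: extended_def)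
    qed
    show "extended P \<subseteq> q"
      using ideal_frac_mem[OF qi] cP ideal_inD(1)[OF prime_inD(1)[OF prime]] by (auto simp: extended_def)
  qed
qed

lemma extended_chain:
  assumes c: "prime_chain T P r c" shows "prime_chain fracs (extended P) r (\<lambda>i. extended (c i))"
proof -
  have cP: "c i \<subseteq> P" if "i \<le> r" for i
    using that
  proof (induction rule: inc_induct)
    case base
    then show ?case using c by (simp add: prime_chain_def)
  next
    case (step n)
    then have "c n \<subset> c (Suc n)" using c by (simp add: prime_chain_def)
    then show ?case using step by auto
  qed
  show ?thesis
    unfolding prime_chain_def
  proof (intro conjI allI impI)
    fix i assume i: "i < r"
    have p: "prime_in T (c i)" "prime_in T (c (Suc i))" "c i \<subset> c (Suc i)"
      using c i by (auto simp: prime_chain_def)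
    then obtain a where a: "a \<in> c (Suc i)" "a \<notin> c i" by blast
    have aT: "a \<in> T" using a ideal_inD(1)[OF prime_inD(1)[OF p(2)]] by blast
    have "Fract a 1 \<in> extended (c (Suc i))" "Fract a 1 \<notin> extended (c i)"
      using a extended_mem[OF p(1) cP aT one_compl] extended_mem[OF p(2) cP aT one_compl] i by auto
    moreover have "extended (c i) \<subseteq> extended (c (Suc i))" using p(3) by (auto simp: extended_def)
    ultimately show "extended (c i) \<subset> extended (c (Suc i))" by blast
  qed (use c extended_prime cP in \<open>auto simp: prime_chain_def\<close>)
qed

text \<open>A chain of length \<open>r\<close> below \<open>P\<close> bounds the height of the localized ideal from below, \<open>r\<close> local
  generators bound the number of generators from above, and Krull's theorem closes the circle.\<close>

lemma complete_intersection_localization: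
  assumes N: "noetherian T" and I: "ideal_in T I" and P: "minimal_over T I P"
    and B: "finite B" "B \<subseteq> I" "card B \<le> r" "\<And>x. x \<in> I \<Longrightarrow> \<exists>s\<in>T - P. s * x \<in> gen T B"
    and c: "prime_chain T P r c"
  shows "complete_intersection (localization (ring_of T) P) (localized_ideal (ring_of T) P I)"
proof -
  let ?L = "localization (ring_of T) P"
  have IT: "I \<subseteq> T" using ideal_inD(1)[OF I] by blast
  have IP: "I \<subseteq> P" using P by (auto simp: minimal_over_def)
  have le: "localized_ideal (ring_of T) P I = pairs ` extended I" by (rule localized_ideal_eq[OF IT])
  have eT: "extended I \<subseteq> fracs" using ideal_inD(1)[OF extended_ideal[OF I]] by blast
  have "ideal (pairs ` extended I) ?L" using rep.rep_ideal[OF eT] extended_ideal[OF I] by simp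
  moreover have "min_gens ?L (pairs ` extended I) = ideal_height ?L (pairs ` extended I)"
  proof (rule antisym)
    have "min_gens ?L (pairs ` extended I) \<le> enat r"
      using rep.rep_min_gens_le[of "(\<lambda>a. Fract a 1) ` B" r] extended_gen[OF I B(2,4)]
        gen_frac_img[of B] B IT card_image_le[of B "\<lambda>a. Fract a 1"] by auto
    also have "enat r \<le> ideal_height ?L (pairs ` extended I)"
    proof (rule rep.rep_height_ge[OF eT])
      fix q assume "prime_in fracs q" "extended I \<subseteq> q"
      then have "q = extended P" by (rule primes_over_extended[OF P])
      then show "\<exists>c. prime_chain fracs q r c" using extended_chain[OF c] by blast
    qed
    finally show "min_gens ?L (pairs ` extended I) \<le> ideal_height ?L (pairs ` extended I)" .
    show "ideal_height ?L (pairs ` extended I) \<le> min_gens ?L (pairs ` extended I)"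
      by (rule rep.rep_height_le_min_gens[OF noetherian_fracs[OF N] extended_prime[OF prime order_refl]])
         (use IP in \<open>auto simp: extended_def\<close>)
  qed
  ultimately show ?thesis unfolding complete_intersection_def le by simp
qed

end

section \<open>Numbers of generators\<close>

lemma (in subring_set) gen_image_sum:
  assumes "finite E" "x \<in> gen T (f ` E)"
  obtains c where "\<And>e. c e \<in> T" "x = (\<Sum>e\<in>E. c e * f e)"
proof -
  have "\<exists>c. (\<forall>e. c e \<in> T) \<and> x = (\<Sum>e\<in>E. c e * f e)"
    using assms(2)
  proof induction
    case gen_zero
    then show ?case using zero_in by (intro exI[of _ "\<lambda>_. 0"]) simp
  next
    case (gen_step x r a)
    then obtain c e0 where c: "\<forall>e. c e \<in> T" "x = (\<Sum>e\<in>E. c e * f e)" "e0 \<in> E" "a = f e0" by auto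
    have "r * a + x = (\<Sum>e\<in>E. (c e + (if e = e0 then r else 0)) * f e)"
      using c assms(1) by (simp add: distrib_right sum.distrib if_distrib[of "\<lambda>z. z * _"] sum.delta cong: if_cong)
    then show ?case
      using c gen_step(2) by (intro exI[of _ "\<lambda>e. c e + (if e = e0 then r else 0)"]) (auto simp: add_in)
  qed
  then show ?thesis using that by blast
qed

text \<open>Gaussian elimination of one column at a time: a matrix with fewer columns than rows has
  linearly dependent rows.\<close>

lemma dependent_rows:
  fixes M :: "'e \<Rightarrow> 'g \<Rightarrow> 'k::field"
  assumes "finite G" "finite E" "card G < card E"
  shows "\<exists>c. (\<exists>e\<in>E. c e \<noteq> 0) \<and> (\<forall>g\<in>G. (\<Sum>e\<in>E. c e * M e g) = 0)"
  using assms
proof (induction G arbitrary: E M rule: finite_induct)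
  case empty
  then show ?case by (intro exI[of _ "\<lambda>_. 1"]) (auto simp: card_gt_0_iff)
next
  case (insert g G)
  show ?case
  proof (cases "\<forall>e\<in>E. M e g = 0")
    case True
    from insert.IH[of E M] insert.prems insert.hyps obtain c
      where "\<exists>e\<in>E. c e \<noteq> 0" "\<forall>h\<in>G. (\<Sum>e\<in>E. c e * M e h) = 0" by auto
    then show ?thesis using True by (intro exI[of _ c]) auto
  next
    case False
    then obtain p where p: "p \<in> E" "M p g \<noteq> 0" by blast
    define M' where "M' e h = M e h - M e g / M p g * M p h" for e h
    have "card G < card (E - {p})" using insert.prems insert.hyps p by simp
    from insert.IH[OF _ this, of M'] insert.prems obtain c
      where c: "\<exists>e\<in>E - {p}. c e \<noteq> 0" "\<And>h. h \<in> G \<Longrightarrow> (\<Sum>e\<in>E - {p}. c e * M' e h) = 0" by auto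
    define b where "b = (\<Sum>e\<in>E - {p}. c e * M e g) / M p g"
    define c' where "c' e = (if e = p then - b else c e)" for e
    have split: "(\<Sum>e\<in>E. c' e * M e h) = - b * M p h + (\<Sum>e\<in>E - {p}. c e * M e h)" for h
      using p insert.prems by (subst sum.remove[of _ p]) (auto simp: c'_def intro!: sum.cong)
    have "(\<Sum>e\<in>E. c' e * M e h) = 0" if "h \<in> insert g G" for h
    proof (cases "h = g")
      case True
      then show ?thesis using p unfolding split b_def by simp
    next
      case False
      then have "0 = (\<Sum>e\<in>E - {p}. c e * M' e h)" using c(2) that by auto
      also have "\<dots> = (\<Sum>e\<in>E - {p}. c e * M e h) - (\<Sum>e\<in>E - {p}. c e * M e g * (M p h / M p g))"
        unfolding M'_def sum_subtractf[symmetric] by (intro sum.cong) (auto simp: algebra_simps)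
      also have "(\<Sum>e\<in>E - {p}. c e * M e g * (M p h / M p g)) = b * M p h"
        unfolding b_def sum_distrib_right[symmetric] by simp
      finally show ?thesis unfolding split by simp
    qed
    moreover have "\<exists>e\<in>E. c' e \<noteq> 0" using c(1) by (auto simp: c'_def)
    ultimately show ?thesis by blast
  qed
qed

lemma lookup_mult_zero:
  "lookup (p * q :: ('x, 'k::comm_ring_1) mpoly) 0 = lookup p 0 * lookup q 0"
proof -
  have "lookup (p * q) (0 + 0) = lookup p 0 * lookup q 0"
  proof (rule lookup_mult_unique)
    fix a b :: "'x \<Rightarrow>\<^sub>0 nat" assume "a + b = 0 + 0"
    then have "lookup a x + lookup b x = 0" for x
      by (metis add_0 lookup_add lookup_zero)
    then show "a = 0 \<and> b = 0" by (auto intro!: poly_mapping_eqI)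
  qed
  then show ?thesis by simp
qed

text \<open>Expressing the \<open>f e\<close> by the elements of \<open>A\<close> and these again by the \<open>f e\<close> gives two matrices. By
  independence the constant terms of their product form the identity matrix, so its size is at
  most the inner dimension, the size of \<open>A\<close>.\<close>

lemma card_le_generators:
  fixes f :: "'e \<Rightarrow> ('x, 'k::field) mpoly"
  assumes E: "finite E" "f ` E \<subseteq> polys_in X"
    and ind: "\<And>c. (\<Sum>e\<in>E. c e * f e) = 0 \<Longrightarrow> \<forall>e\<in>E. lookup (c e) 0 = 0"
    and A: "finite A" "A \<subseteq> polys_in X" "gen (polys_in X) A = gen (polys_in X) (f ` E)"
  shows "card E \<le> card A"
proof (rule ccontr)
  interpret subring_set "polys_in X :: ('x, 'k) mpoly set" by (rule polys_in_subring)
  assume neg: "\<not> card E \<le> card A"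
  have "\<exists>c. f e = (\<Sum>g\<in>A. c g * g)" if "e \<in> E" for e
  proof -
    have "f e \<in> gen (polys_in X) ((\<lambda>g. g) ` A)" using that A(3) gen_incl[of "f e" "f ` E"] by auto
    from gen_image_sum[OF A(1) this] show ?thesis by metis
  qed
  then obtain \<alpha> where \<alpha>: "\<And>e. e \<in> E \<Longrightarrow> f e = (\<Sum>g\<in>A. \<alpha> e g * g)" by metis
  have "\<exists>c. g = (\<Sum>e\<in>E. c e * f e)" if "g \<in> A" for g
  proof -
    have "g \<in> gen (polys_in X) (f ` E)" using that A(3) gen_incl[of g A] by auto
    from gen_image_sum[OF E(1) this] show ?thesis by metis
  qed
  then obtain \<beta> where \<beta>: "\<And>g. g \<in> A \<Longrightarrow> g = (\<Sum>e\<in>E. \<beta> g e * f e)" by metis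
  let ?\<alpha> = "\<lambda>e g. lookup (\<alpha> e g) 0" and ?\<beta> = "\<lambda>g e. lookup (\<beta> g e) 0"
  have id: "(\<Sum>g\<in>A. ?\<alpha> e g * ?\<beta> g e') = (if e' = e then 1 else 0)" if e: "e \<in> E" "e' \<in> E" for e e'
  proof -
    have "f e = (\<Sum>g\<in>A. \<alpha> e g * (\<Sum>e'\<in>E. \<beta> g e' * f e'))"
      using \<alpha>[OF e(1)] \<beta> by simp
    also have "\<dots> = (\<Sum>g\<in>A. \<Sum>e'\<in>E. \<alpha> e g * \<beta> g e' * f e')"
      by (simp add: sum_distrib_left mult.assoc)
    also have "\<dots> = (\<Sum>e'\<in>E. (\<Sum>g\<in>A. \<alpha> e g * \<beta> g e') * f e')"
      by (subst sum.swap) (simp add: sum_distrib_right)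
    finally have "(\<Sum>e'\<in>E. ((\<Sum>g\<in>A. \<alpha> e g * \<beta> g e') - (if e' = e then 1 else 0)) * f e') = 0"
      using e(1) E(1) by (simp add: left_diff_distrib sum_subtractf if_distrib[of "\<lambda>z. z * _"] sum.delta cong: if_cong)
    from ind[OF this] e(2) have "lookup ((\<Sum>g\<in>A. \<alpha> e g * \<beta> g e') - (if e' = e then 1 else 0)) 0 = 0"
      by blast
    then show ?thesis by (auto simp: lookup_minus lookup_sum lookup_mult_zero split: if_splits)
  qed
  obtain c where c: "\<exists>e\<in>E. c e \<noteq> 0" "\<And>g. g \<in> A \<Longrightarrow> (\<Sum>e\<in>E. c e * ?\<alpha> e g) = 0"
    using dependent_rows[OF A(1) E(1), of ?\<alpha>] neg by auto
  then obtain e' where e': "e' \<in> E" "c e' \<noteq> 0" by blast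
  have "c e' = (\<Sum>e\<in>E. c e * (if e' = e then 1 else 0))"
    using e' E(1) by (simp add: if_distrib sum.delta cong: if_cong)
  also have "\<dots> = (\<Sum>e\<in>E. \<Sum>g\<in>A. c e * ?\<alpha> e g * ?\<beta> g e')"
    unfolding mult.assoc sum_distrib_left[symmetric] using id e' by (intro sum.cong) auto
  also have "\<dots> = (\<Sum>g\<in>A. (\<Sum>e\<in>E. c e * ?\<alpha> e g) * ?\<beta> g e')"
    by (subst sum.swap) (simp add: sum_distrib_right)
  also have "\<dots> = 0" using c(2) by simp
  finally show False using e' by simp
qed

section \<open>One more generator than a radical complete intersection\<close>

context coprime_leads
begin

interpretation R: represented_ring T "\<lambda>x. x" "ring_of T"
  by unfold_locales (rule represents_ring_of)

text \<open>At a minimal prime of \<open>J\<close> that is also minimal over the first generators, a power of \<open>f0\<close> is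
  locally in their ideal, and so is \<open>f0\<close> itself by radicality. At the other minimal primes the
  height is larger by one, and all generators are needed.\<close>

lemma almost_complete_intersection_extend:
  assumes finX: "finite X" and f0: "f0 \<in> T" and J: "J = gen T (insert f0 (f ` I))"
    and gens: "min_gens (ring_of T) J = enat (Suc (card I))"
    and height: "ideal_height (ring_of T) J \<le> enat (card I)"
  shows "almost_complete_intersection (ring_of T) J"
proof -
  note N = noetherian_polys_in[OF finX, where 'k = 'k]
  note fT = f_img[OF order_refl]
  have insT: "insert f0 (f ` I) \<subseteq> T" using fT f0 by auto
  note Ji = gen_ideal[OF insT, folded J]
  have JT: "J \<subseteq> T" using ideal_inD(1)[OF Ji] by blast
  have fJ: "f ` I \<subseteq> J" "f0 \<in> J" unfolding J by (auto intro: gen_incl)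
  have ch: "\<exists>c. prime_chain T P (card I) c" if "prime_in T P" "f ` I \<subseteq> P" for P
    by (rule regular_family_chain[OF N finI fT regular that])
  have "enat (card I) \<le> ideal_height (ring_of T) J"
    using R.rep_height_ge[OF JT] ch fJ by fastforce
  then have h: "ideal_height (ring_of T) J = enat (card I)" using height by (rule antisym[rotated])
  have ci: "complete_intersection (localization (ring_of T) P) (localized_ideal (ring_of T) P J)"
    if P: "minimal_over T J P" for P
  proof -
    have Pp: "prime_in T P" "J \<subseteq> P" using P by (auto simp: minimal_over_def)
    interpret prime_localization T P by unfold_locales (rule Pp)
    have fP: "f ` I \<subseteq> P" using fJ Pp by blast
    show ?thesis
    proof (cases "minimal_over T (f ` I) P")
      case True
      obtain s k where s: "s \<in> T" "s \<notin> P" "s * f0 ^ k \<in> gen T (f ` I)"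
        using minimal_over_power[OF N fT True] fJ(2) Pp(2) by blast
      note gi = gen_ideal[OF fT]
      \<comment> \<open>The exponent is raised by one because \<open>k\<close> may be zero.\<close>
      have "(s * f0) ^ Suc k = (s ^ k * f0) * (s * f0 ^ k)" by (simp add: power_mult_distrib algebra_simps)
      also have "\<dots> \<in> gen T (f ` I)" by (rule ideal_inD(4)[OF gi mult_in[OF power_in[OF s(1)] f0] s(3)])
      finally have sf0: "s * f0 \<in> gen T (f ` I)" using radical[OF mult_in[OF s(1) f0]] by blast
      obtain c where c: "prime_chain T P (card I) c" using ch[OF Pp(1) fP] by blast
      show ?thesis
      proof (rule complete_intersection_localization[OF N Ji P _ fJ(1) _ _ c])
        show "finite (f ` I)" "card (f ` I) \<le> card I" using finI card_image_le by auto
        fix x assume "x \<in> J"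
        then obtain a r where x: "x = a + r * f0" "a \<in> gen T (f ` I)" "r \<in> T"
          unfolding J gen_insert[OF fT f0] adjoin_def by blast
        have "s * x = s * a + r * (s * f0)" using x(1) by (simp add: algebra_simps)
        also have "\<dots> \<in> gen T (f ` I)" using ideal_lin[OF gi s(1) x(3) x(2) sf0] .
        finally show "\<exists>s\<in>T - P. s * x \<in> gen T (f ` I)" using s by blast
      qed
    next
      case False
      then obtain Q where Q: "prime_in T Q" "f ` I \<subseteq> Q" "Q \<subset> P"
        using Pp(1) fP unfolding minimal_over_def by blast
      obtain c where "prime_chain T Q (card I) c" using ch[OF Q(1,2)] by blast
      note c = prime_chain_extend[OF this Pp(1) Q(3)]
      show ?thesis
      proof (rule complete_intersection_localization[OF N Ji P _ _ _ _ c])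
        show "finite (insert f0 (f ` I))" using finI by simp
        show "insert f0 (f ` I) \<subseteq> J" using fJ by simp
        show "card (insert f0 (f ` I)) \<le> Suc (card I)"
          using card_insert_le_m1[of "Suc (card I)" "f ` I" f0] card_image_le[OF finI, of f] by simp
        fix x assume "x \<in> J"
        then show "\<exists>s\<in>T - P. s * x \<in> gen T (insert f0 (f ` I))"
          using one_compl J by (intro bexI[of _ 1]) auto
      qed
    qed
  qed
  have "ideal J (ring_of T)" using R.rep_ideal[OF JT] Ji by simp
  moreover have "min_gens (ring_of T) J = ideal_height (ring_of T) J + 1"
    unfolding gens h by (simp add: one_enat_def)
  moreover have "\<forall>P\<in>minimal_primes (ring_of T) J.
      complete_intersection (localization (ring_of T) P) (localized_ideal (ring_of T) P J)"
    using R.rep_minimal_primes[OF JT] ci by auto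
  ultimately show ?thesis unfolding almost_complete_intersection_def by blast
qed

end

section \<open>The ideals of graphs\<close>

definition edge_mono :: "nat \<Rightarrow> nat \<Rightarrow> nat \<Rightarrow> (nat \<times> nat) \<Rightarrow>\<^sub>0 nat" where
  "edge_mono i j l = single (i, l) 1 + single (j, l) 1"

text \<open>One generator for each edge, where ordered pairs of vertices would list each of them twice.\<close>

definition edge_poly :: "nat \<Rightarrow> nat set \<Rightarrow> (nat \<times> nat, 'k::field) mpoly" where
  "edge_poly d e = lss_poly d (Min e) (Max e)"

definition lss_vars :: "nat \<Rightarrow> nat \<Rightarrow> (nat \<times> nat) set" where
  "lss_vars n d = {1..n} \<times> {1..d}"

text \<open>The two endpoints of an edge together prefer the colour of that edge. Integral weights, also
  negative ones, are convenient here; adding a constant makes them natural numbers. With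
  colours as coordinates, the quadric of each edge then has the monomial of its colour as
  leading monomial, and properness of the colouring makes these monomials coprime.\<close>

definition weighted_colouring ::
    "nat \<Rightarrow> nat set set \<Rightarrow> (nat set \<Rightarrow> nat) \<Rightarrow> (nat \<Rightarrow> nat \<Rightarrow> int) \<Rightarrow> bool" where
  "weighted_colouring d F col w \<longleftrightarrow>
     (\<forall>e\<in>F. col e \<in> {1..d}) \<and>
     (\<forall>e\<in>F. \<forall>e'\<in>F. e \<noteq> e' \<longrightarrow> e \<inter> e' \<noteq> {} \<longrightarrow> col e \<noteq> col e') \<and>
     (\<forall>i j l. {i, j} \<in> F \<longrightarrow> i \<noteq> j \<longrightarrow> l \<in> {1..d} \<longrightarrow> l \<noteq> col {i, j} \<longrightarrow>
        w i l + w j l < w i (col {i, j}) + w j (col {i, j}))"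

definition weight_degree :: "('x \<Rightarrow> nat) \<Rightarrow> ('x \<Rightarrow>\<^sub>0 nat) \<Rightarrow> nat" where
  "weight_degree w t = (\<Sum>x\<in>keys t. lookup t x * w x)"

lemma weight_degree_superset:
  assumes "finite A" "keys t \<subseteq> A"
  shows "weight_degree w t = (\<Sum>x\<in>A. lookup t x * w x)"
  unfolding weight_degree_def
  by (rule sum.mono_neutral_left) (use assms in \<open>auto simp: in_keys_iff\<close>)

lemma weight_degree_add: "weight_degree w (s + t) = weight_degree w s + weight_degree w t"
proof -
  let ?A = "keys s \<union> keys t"
  have "weight_degree w (s + t) = (\<Sum>x\<in>?A. lookup (s + t) x * w x)"
    by (rule weight_degree_superset) (use keys_add[of s t] in auto)
  also have "\<dots> = (\<Sum>x\<in>?A. lookup s x * w x) + (\<Sum>x\<in>?A. lookup t x * w x)"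
    by (simp add: lookup_add distrib_right sum.distrib)
  also have "\<dots> = weight_degree w s + weight_degree w t"
    by (simp add: weight_degree_superset[of ?A])
  finally show ?thesis .
qed

lemma weight_degree_edge: "weight_degree w (edge_mono i j l) = w (i, l) + w (j, l)"
  unfolding edge_mono_def weight_degree_add by (simp add: weight_degree_def)

lemma edge_mono_commute: "edge_mono i j l = edge_mono j i l"
  by (simp add: edge_mono_def add.commute)

lemma lookup_edge_mono:
  "i \<noteq> j \<Longrightarrow> lookup (edge_mono i j l) x = (if x = (i, l) \<or> x = (j, l) then 1 else 0)"
  by (auto simp: edge_mono_def lookup_add lookup_single when_def)

lemma keys_edge_mono: "i \<noteq> j \<Longrightarrow> keys (edge_mono i j l) = {(i, l), (j, l)}"
  by (auto simp: in_keys_iff lookup_edge_mono split: if_splits)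

lemma edge_mono_eq:
  assumes "i \<noteq> j" "i' \<noteq> j'"
  shows "edge_mono i j l = edge_mono i' j' l' \<longleftrightarrow> {i, j} = {i', j'} \<and> l = l'"
proof
  assume "edge_mono i j l = edge_mono i' j' l'"
  then have "{(i, l), (j, l)} = {(i', l'), (j', l')}" using keys_edge_mono assms by metis
  then show "{i, j} = {i', j'} \<and> l = l'" by auto
next
  assume "{i, j} = {i', j'} \<and> l = l'"
  then show "edge_mono i j l = edge_mono i' j' l'" using edge_mono_commute by (auto simp: doubleton_eq_iff)
qed

lemma lss_poly_sum:
  "lss_poly d i j = (\<Sum>l\<in>{1..d}. single (edge_mono i j l) (1::'k::field))"
  by (simp add: lss_poly_def indet_def edge_mono_def mult_single)

lemma lss_poly_commute: "lss_poly d i j = lss_poly d j i"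
  unfolding lss_poly_sum by (simp add: edge_mono_commute)

lemma lookup_lss_poly:
  assumes "i \<noteq> j"
  shows "lookup (lss_poly d i j :: (nat \<times> nat, 'k::field) mpoly) t =
    (if t \<in> edge_mono i j ` {1..d} then 1 else 0)"
proof -
  have "inj_on (edge_mono i j) {1..d}" using assms by (auto simp: inj_on_def edge_mono_eq)
  then have "lss_poly d i j = (\<Sum>t\<in>edge_mono i j ` {1..d}. single t (1::'k))"
    unfolding lss_poly_sum by (simp add: sum.reindex)
  then show ?thesis by (simp add: lookup_sum_single)
qed

lemma edge_poly_eq: "edge_poly d {i, j} = lss_poly d i j"
  unfolding edge_poly_def by (cases "i \<le> j") (auto simp: lss_poly_commute min_def max_def)

lemma simple_graph_edge:
  assumes "simple_graph V E" "e \<in> E"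
  obtains i j where "e = {i, j}" "i \<noteq> j" "i \<in> V" "j \<in> V"
  using assms unfolding simple_graph_def by (auto simp: card_2_iff)

lemma simple_graph_finite: "simple_graph V E \<Longrightarrow> finite E"
  unfolding simple_graph_def by (meson PowI finite_Pow_iff finite_subset subsetI)

lemma simple_graph_subset: "simple_graph V E \<Longrightarrow> F \<subseteq> E \<Longrightarrow> simple_graph V F"
  unfolding simple_graph_def by blast

lemma keys_edge_poly:
  assumes "i \<noteq> j"
  shows "keys (edge_poly d {i, j} :: (nat \<times> nat, 'k::field) mpoly) = edge_mono i j ` {1..d}"
  unfolding edge_poly_eq by (auto simp: in_keys_iff lookup_lss_poly[OF assms] split: if_splits)

lemma edge_poly_in:
  assumes "simple_graph {1..n} E" "e \<in> E"
  shows "(edge_poly d e :: (nat \<times> nat, 'k::field) mpoly) \<in> polys_in (lss_vars n d)"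
proof -
  obtain i j where e: "e = {i, j}" "i \<noteq> j" "i \<in> {1..n}" "j \<in> {1..n}"
    by (rule simple_graph_edge[OF assms])
  then show ?thesis by (auto simp: polys_in_def keys_edge_poly keys_edge_mono lss_vars_def)
qed

lemma polys_in_represented:
  "represented_ring (polys_in X) (\<lambda>x. x) (ring_of (polys_in X :: ('x, 'k::field) mpoly set))"
  by (intro represented_ring.intro polys_in_subring represented_ring_axioms.intro represents_ring_of)

lemma lss_ring_eq: "lss_ring n d = ring_of (polys_in (lss_vars n d))"
  by (simp add: lss_ring_def poly_ring_eq lss_vars_def)

context
  fixes n d :: nat and E :: "nat set set"
  assumes E: "simple_graph {1..n} E"
begin

abbreviation (input) R :: "(nat \<times> nat, 'k::field) mpoly set" where
  "R \<equiv> polys_in (lss_vars n d)"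

lemma lss_ideal_eq: "(lss_ideal n d E :: (nat \<times> nat, 'k::field) mpoly set) = gen R (edge_poly d ` E)"
proof -
  interpret represented_ring R "\<lambda>x. x" "ring_of (R :: (nat \<times> nat, 'k) mpoly set)"
    by (rule polys_in_represented)
  have "{lss_poly d i j | i j. {i, j} \<in> E} = (edge_poly d ` E :: (nat \<times> nat, 'k) mpoly set)"
  proof safe
    fix e assume "e \<in> E"
    then obtain i j where "e = {i, j}" by (rule simple_graph_edge[OF E])
    then show "\<exists>i j. edge_poly d e = (lss_poly d i j :: (nat \<times> nat, 'k) mpoly) \<and> {i, j} \<in> E"
      using \<open>e \<in> E\<close> edge_poly_eq by blast
  qed (auto simp flip: edge_poly_eq)
  moreover have "(edge_poly d ` E :: (nat \<times> nat, 'k) mpoly set) \<subseteq> R" using edge_poly_in[OF E] by blast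
  ultimately show ?thesis
    unfolding lss_ideal_def lss_ring_eq using rep_genideal[of "edge_poly d ` E"] by simp
qed

text \<open>The monomial of colour 1 of an edge occurs in no other generator, and since all generators
  are homogeneous of degree 2, it can only arise with the constant term of the coefficient of
  that edge.\<close>

lemma edge_polys_independent:
  assumes "d \<ge> 1" and c: "(\<Sum>e\<in>E. c e * (edge_poly d e :: (nat \<times> nat, 'k::field) mpoly)) = 0" and "e \<in> E"
  shows "lookup (c e) 0 = 0"
proof -
  obtain i j where e: "e = {i, j}" "i \<noteq> j" by (rule simple_graph_edge[OF E \<open>e \<in> E\<close>])
  let ?t = "edge_mono i j 1"
  have "lookup (c e' * edge_poly d e') (0 + ?t) = (if e' = e then lookup (c e) 0 else 0)"
    if "e' \<in> E" for e'
  proof -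
    obtain i' j' where e': "e' = {i', j'}" "i' \<noteq> j'" by (rule simple_graph_edge[OF E \<open>e' \<in> E\<close>])
    have "lookup (c e' * edge_poly d e') (0 + ?t) =
        lookup (c e') 0 * lookup (edge_poly d e' :: (nat \<times> nat, 'k) mpoly) ?t"
    proof (rule lookup_mult_unique)
      fix a b assume "b \<in> keys (edge_poly d e' :: (nat \<times> nat, 'k) mpoly)" and ab: "a + b = 0 + ?t"
      then obtain l where b: "b = edge_mono i' j' l" using keys_edge_poly[OF e'(2)] e'(1) by auto
      have "lookup b x \<le> lookup ?t x" for x
        using ab by (metis add_0 le_add2 lookup_add)
      then have "keys b \<subseteq> keys ?t" by (metis in_keys_iff le_zero_eq subsetI)
      then have "{(i', l), (j', l)} \<subseteq> {(i, 1), (j, 1)}" using b e e' by (simp add: keys_edge_mono)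
      then have "b = ?t" using b e(2) e'(2) by (auto simp: edge_mono_eq)
      then show "a = 0 \<and> b = ?t" using ab by simp
    qed
    moreover have "?t \<in> edge_mono i' j' ` {1..d} \<longleftrightarrow> e' = e"
      using e e' assms(1) by (auto simp: edge_mono_eq image_iff)
    ultimately show ?thesis using e' by (simp add: edge_poly_eq lookup_lss_poly)
  qed
  then have "lookup (\<Sum>e\<in>E. c e * (edge_poly d e :: (nat \<times> nat, 'k) mpoly)) (0 + ?t) = lookup (c e) 0"
    using \<open>e \<in> E\<close> simple_graph_finite[OF E] by (simp add: lookup_sum del: add_0)
  then show ?thesis using c by simp
qed

lemma lss_min_gens:
  assumes "d \<ge> 1"
  shows "min_gens (lss_ring n d) (lss_ideal n d E :: (nat \<times> nat, 'k::field) mpoly set) = enat (card E)"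
proof -
  interpret represented_ring R "\<lambda>x. x" "ring_of (R :: (nat \<times> nat, 'k) mpoly set)"
    by (rule polys_in_represented)
  have sub: "(edge_poly d ` E :: (nat \<times> nat, 'k) mpoly set) \<subseteq> R" using edge_poly_in[OF E] by blast
  have fin: "finite E" by (rule simple_graph_finite[OF E])
  let ?I = "gen R (edge_poly d ` E :: (nat \<times> nat, 'k) mpoly set)"
  have IR: "?I \<subseteq> R" using ideal_inD(1)[OF gen_ideal[OF sub]] by blast
  have "min_gens (ring_of R) ?I \<le> enat (card E)"
    using rep_min_gens_le[OF _ sub card_image_le[OF fin]] fin by simp
  moreover have "enat (card E) \<le> min_gens (ring_of R) ?I"
  proof -
    have "enat (card E) \<le> enat (card A)" if "finite A" "A \<subseteq> R" "gen R A = ?I" for A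
      using card_le_generators[OF fin sub _ that] edge_polys_independent[OF assms] by auto
    then show ?thesis using rep_min_gens_ge[OF IR] by simp
  qed
  ultimately show ?thesis unfolding lss_ideal_eq lss_ring_eq by (rule antisym)
qed

text \<open>The variables of \<open>B\<close> together with the quadrics of the edges missing \<open>B\<close> generate an ideal
  that contains all quadrics and lies in the maximal ideal of the origin.\<close>

lemma lss_height_le:
  assumes B: "B \<subseteq> {1..n}" and r: "card B * d + card {e \<in> E. e \<inter> B = {}} \<le> r"
  shows "ideal_height (lss_ring n d) (lss_ideal n d E :: (nat \<times> nat, 'k::field) mpoly set) \<le> enat r"
proof -
  interpret represented_ring R "\<lambda>x. x" "ring_of (R :: (nat \<times> nat, 'k) mpoly set)"
    by (rule polys_in_represented)
  define P :: "(nat \<times> nat, 'k) mpoly set" where "P = {p \<in> R. lookup p 0 = 0}"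
  have P: "prime_in R P"
    unfolding prime_in_def ideal_in_def P_def
    by (auto simp: lookup_add lookup_mult_zero add_in mult_in zero_in)
  let ?E = "{e \<in> E. e \<inter> B = {}}"
  define A :: "(nat \<times> nat, 'k) mpoly set" where "A = indet ` (B \<times> {1..d}) \<union> edge_poly d ` ?E"
  have finB: "finite B" using B finite_subset by blast
  have finE: "finite ?E" using simple_graph_finite[OF E] by simp
  have fA: "finite A" unfolding A_def using finB finE by simp
  have ind: "indet x \<in> P" if "x \<in> lss_vars n d" for x :: "nat \<times> nat"
  proof -
    have "lookup (indet x :: (nat \<times> nat, 'k) mpoly) 0 = 0"
      unfolding indet_def by (subst lookup_single_not_eq) (auto simp: poly_mapping_eq_iff fun_eq_iff lookup_single when_def)
    then show ?thesis using that indet_in_polys_in by (simp add: P_def)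
  qed
  have Pi: "ideal_in R P" by (rule prime_inD(1)[OF P])
  have edge: "edge_poly d e \<in> P" if e: "e \<in> E" for e
  proof -
    obtain i j where ij: "e = {i, j}" "i \<noteq> j" "i \<in> {1..n}" "j \<in> {1..n}" by (rule simple_graph_edge[OF E e])
    have "(\<Sum>l = 1..d. indet (i, l) * indet (j, l)) \<in> P"
      using ij ideal_inD(1)[OF Pi ind] by (intro ideal_sum[OF Pi] ideal_inD(4)[OF Pi] ind) (auto simp: lss_vars_def)
    then show ?thesis unfolding ij edge_poly_eq lss_poly_def .
  qed
  have AP: "A \<subseteq> P" unfolding A_def using ind edge B by (auto simp: lss_vars_def)
  have AR: "A \<subseteq> R" using AP by (auto simp: P_def)
  note gi = gen_ideal[OF AR]
  have "edge_poly d e \<in> gen R A" if e: "e \<in> E" for e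
  proof (cases "e \<inter> B = {}")
    case True
    then show ?thesis using e by (intro gen_incl) (auto simp: A_def)
  next
    case False
    then obtain i where "i \<in> e" "i \<in> B" by blast
    moreover obtain i' j' where "e = {i', j'}" "i' \<noteq> j'" "i' \<in> {1..n}" "j' \<in> {1..n}" by (rule simple_graph_edge[OF E e])
    ultimately obtain j where ij: "e = {j, i}" "j \<in> {1..n}" by fastforce
    have "(\<Sum>l = 1..d. indet (j, l) * indet (i, l)) \<in> gen R A"
      using ij \<open>i \<in> B\<close> by (intro ideal_sum[OF gi] ideal_inD(4)[OF gi] gen_incl)
        (auto simp: lss_vars_def A_def intro!: indet_in_polys_in)
    then show ?thesis unfolding ij edge_poly_eq lss_poly_def .
  qed
  then have sub: "gen R (edge_poly d ` E) \<subseteq> gen R A" by (intro gen_least[OF gi]) auto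
  have "card A \<le> card (B \<times> {1..d}) + card ?E"
    unfolding A_def using finB finE card_Un_le card_image_le
    by (meson add_mono finite_SigmaI finite_atLeastAtMost le_trans)
  then have "card A \<le> r" using r by (simp add: card_cartesian_product)
  then show ?thesis
    unfolding lss_ideal_eq lss_ring_eq
    using rep_height_le_card[OF noetherian_polys_in fA AP P sub] by (simp add: lss_vars_def)
qed

lemma coprime_leads_edges:
  assumes col: "weighted_colouring d E col w"
  shows "\<exists>\<omega>. coprime_leads (lss_vars n d) \<omega> E (edge_poly d :: _ \<Rightarrow> (nat \<times> nat, 'k::field) mpoly)
    (\<lambda>e. edge_mono (Min e) (Max e) (col e))"
proof -
  define K where "K = (\<Sum>(i, l)\<in>lss_vars n d. \<bar>w i l\<bar>)"
  define w' where "w' x = nat (w (fst x) (snd x) + K)" for x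
  have K: "0 \<le> w i l + K" if "(i, l) \<in> lss_vars n d" for i l
  proof -
    have "(case (i, l) of (i, l) \<Rightarrow> \<bar>w i l\<bar>) \<le> K"
      unfolding K_def by (rule member_le_sum[OF that]) (auto simp: lss_vars_def)
    then show ?thesis by simp
  qed
  have MM: "\<exists>i j. e = {i, j} \<and> i \<noteq> j \<and> i \<in> {1..n} \<and> j \<in> {1..n} \<and> Min e = i \<and> Max e = j" if e: "e \<in> E" for e
  proof -
    obtain i j where ij: "e = {i, j}" "i \<noteq> j" "i \<in> {1..n}" "j \<in> {1..n}" by (rule simple_graph_edge[OF E e])
    then show ?thesis by (cases "i < j") (auto simp: min_def max_def doubleton_eq_iff)
  qed
  have "coprime_leads (lss_vars n d) (weight_degree w') E (edge_poly d :: _ \<Rightarrow> (nat \<times> nat, 'k) mpoly)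
    (\<lambda>e. edge_mono (Min e) (Max e) (col e))"
  proof
    show "finite E" by (rule simple_graph_finite[OF E])
    show "weight_degree w' (s + t) = weight_degree w' s + weight_degree w' t" for s t
      by (rule weight_degree_add)
    fix e assume e: "e \<in> E"
    then obtain i j where ij: "e = {i, j}" "i \<noteq> j" "i \<in> {1..n}" "j \<in> {1..n}" "Min e = i" "Max e = j"
      using MM by blast
    have ce: "col e \<in> {1..d}" using col e by (auto simp: weighted_colouring_def)
    show "(edge_poly d e :: (nat \<times> nat, 'k) mpoly) \<in> polys_in (lss_vars n d)" by (rule edge_poly_in[OF E e])
    show "lookup (edge_poly d e :: (nat \<times> nat, 'k) mpoly) (edge_mono (Min e) (Max e) (col e)) = 1"
      unfolding edge_poly_def using ij ce by (simp add: lookup_lss_poly)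
    show "lookup (edge_mono (Min e) (Max e) (col e)) x \<le> 1" for x
      using ij by (simp add: lookup_edge_mono)
    show "weight_degree w' t < weight_degree w' (edge_mono (Min e) (Max e) (col e))"
      if t: "t \<in> keys (edge_poly d e :: (nat \<times> nat, 'k) mpoly)" "t \<noteq> edge_mono (Min e) (Max e) (col e)" for t
    proof -
      obtain l where l: "t = edge_mono i j l" "l \<in> {1..d}" using t(1) ij(1) by (auto simp: keys_edge_poly[OF ij(2)])
      then have "l \<noteq> col e" using t(2) ij by auto
      then have "w i l + w j l < w i (col e) + w j (col e)"
        using col e l ij unfolding weighted_colouring_def by blast
      moreover have "0 \<le> w i l + K" "0 \<le> w j l + K" "0 \<le> w i (col e) + K" "0 \<le> w j (col e) + K"
        using K ij l ce by (auto simp: lss_vars_def)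
      ultimately show ?thesis using ij l by (simp add: weight_degree_edge w'_def)
    qed
    fix e' assume e': "e' \<in> E" "e \<noteq> e'"
    then obtain i' j' where ij': "e' = {i', j'}" "i' \<noteq> j'" "Min e' = i'" "Max e' = j'" using MM by blast
    show "keys (edge_mono (Min e) (Max e) (col e)) \<inter>
        keys (edge_mono (Min e') (Max e') (col e')) = {}"
    proof (rule ccontr)
      assume "\<not> ?thesis"
      then have "col e = col e'" "e \<inter> e' \<noteq> {}"
        using ij ij' by (auto simp: keys_edge_mono)
      then show False using col e e' unfolding weighted_colouring_def by blast
    qed
  qed
  then show ?thesis by blast
qed

end

lemma lss_almost_complete_intersection:
  assumes E: "simple_graph {1..n} E" and e: "e \<in> E" and d: "d \<ge> 1"
    and col: "weighted_colouring d (E - {e}) col w"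
    and height: "ideal_height (lss_ring n d) (lss_ideal n d E :: (nat \<times> nat, 'k::field) mpoly set) \<le> enat (card E - 1)"
  shows "almost_complete_intersection (lss_ring n d) (lss_ideal n d E :: (nat \<times> nat, 'k) mpoly set)"
proof -
  have F: "simple_graph {1..n} (E - {e})" by (rule simple_graph_subset[OF E]) auto
  obtain \<omega> where "coprime_leads (lss_vars n d) \<omega> (E - {e}) (edge_poly d :: _ \<Rightarrow> (nat \<times> nat, 'k) mpoly)
      (\<lambda>e. edge_mono (Min e) (Max e) (col e))"
    using coprime_leads_edges[OF F col] by blast
  then interpret coprime_leads "lss_vars n d" \<omega> "E - {e}" "edge_poly d :: _ \<Rightarrow> (nat \<times> nat, 'k) mpoly"
      "\<lambda>e. edge_mono (Min e) (Max e) (col e)" .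
  have fin: "finite E" by (rule simple_graph_finite[OF E])
  have ins: "edge_poly d ` E = insert (edge_poly d e) (edge_poly d ` (E - {e}))" using e by blast
  have card: "card (E - {e}) = card E - 1" "Suc (card E - 1) = card E"
    using e fin card_Suc_Diff1[OF fin e] by auto
  show ?thesis
    unfolding lss_ring_eq
  proof (rule almost_complete_intersection_extend)
    show "finite (lss_vars n d)" by (simp add: lss_vars_def)
    show "(edge_poly d e :: (nat \<times> nat, 'k) mpoly) \<in> T" by (rule edge_poly_in[OF E e])
    show "lss_ideal n d E = gen T (insert (edge_poly d e) (edge_poly d ` (E - {e})) :: (nat \<times> nat, 'k) mpoly set)"
      unfolding lss_ideal_eq[OF E] ins ..
    show "min_gens (ring_of T) (lss_ideal n d E :: (nat \<times> nat, 'k) mpoly set) = enat (Suc (card (E - {e})))"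
      using lss_min_gens[OF E d] card unfolding lss_ring_eq by simp
    show "ideal_height (ring_of T) (lss_ideal n d E :: (nat \<times> nat, 'k) mpoly set) \<le> enat (card (E - {e}))"
      using height card unfolding lss_ring_eq by simp
  qed
qed

section \<open>Cycles, bridges and leaves\<close>

definition adj :: "'v set set \<Rightarrow> ('v \<times> 'v) set" where
  "adj E = {(x, y). {x, y} \<in> E}"

definition edge_path :: "'v set set \<Rightarrow> 'v list \<Rightarrow> bool" where
  "edge_path E vs \<longleftrightarrow> vs \<noteq> [] \<and> distinct vs \<and> (\<forall>i. Suc i < length vs \<longrightarrow> {vs ! i, vs ! Suc i} \<in> E)"

lemma adj_mono: "E \<subseteq> F \<Longrightarrow> (adj E)\<^sup>* \<subseteq> (adj F)\<^sup>*"
  by (rule rtrancl_mono) (auto simp: adj_def)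

lemma adj_sym: "(x, y) \<in> (adj E)\<^sup>* \<Longrightarrow> (y, x) \<in> (adj E)\<^sup>*"
  by (rule symD[OF sym_rtrancl]) (auto simp: sym_def adj_def insert_commute)

lemma cycles_mono: "E \<subseteq> F \<Longrightarrow> cycles E \<subseteq> cycles F"
  unfolding cycles_def by blast

lemma cycles_subset: "C \<in> cycles E \<Longrightarrow> C \<subseteq> F \<Longrightarrow> C \<in> cycles F"
  unfolding cycles_def by blast

lemma cycle_subset_edges: "C \<in> cycles E \<Longrightarrow> C \<subseteq> E"
  unfolding cycles_def by blast

lemma cycle_nonempty: "C \<in> cycles E \<Longrightarrow> C \<noteq> {}"
  unfolding cycles_def cycle_edges_def by force

lemma path_cycle:
  assumes p: "edge_path E vs" and len: "3 \<le> length vs" and e: "{last vs, hd vs} \<in> E"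
  shows "cycle_edges vs \<in> cycles E" "{last vs, hd vs} \<in> cycle_edges vs"
proof -
  have ne: "vs \<noteq> []" using len by auto
  have last: "{vs ! (length vs - 1), vs ! (Suc (length vs - 1) mod length vs)} = {last vs, hd vs}"
    using ne by (simp add: last_conv_nth hd_conv_nth)
  have "{vs ! i, vs ! (Suc i mod length vs)} \<in> E" if "i < length vs" for i
  proof (cases "Suc i = length vs")
    case True
    then have "i = length vs - 1" by simp
    then show ?thesis using last e by simp
  next
    case False
    then show ?thesis using that p by (auto simp: edge_path_def)
  qed
  then show "cycle_edges vs \<in> cycles E"
    using p len unfolding cycles_def edge_path_def cycle_edges_def by blast
  show "{last vs, hd vs} \<in> cycle_edges vs"
    unfolding cycle_edges_def using last ne by (intro CollectI exI[of _ "length vs - 1"]) auto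
qed

text \<open>A walk becomes a path if the path built so far is cut off at a repeated vertex.\<close>

lemma connected_path:
  assumes "(u, v) \<in> (adj E)\<^sup>*"
  obtains vs where "edge_path E vs" "hd vs = u" "last vs = v"
proof -
  have "\<exists>vs. edge_path E vs \<and> hd vs = u \<and> last vs = v"
    using assms
  proof (induction rule: converse_rtrancl_induct)
    case base
    then show ?case by (intro exI[of _ "[v]"]) (auto simp: edge_path_def)
  next
    case (step x y)
    then obtain vs where vs: "edge_path E vs" "hd vs = y" "last vs = v" by blast
    have xy: "{x, y} \<in> E" using step by (simp add: adj_def)
    show ?case
    proof (cases "x \<in> set vs")
      case True
      then obtain as bs where s: "vs = as @ x # bs" by (auto simp: in_set_conv_decomp)
      have "{(x # bs) ! i, (x # bs) ! Suc i} \<in> E" if "Suc i < length (x # bs)" for i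
      proof -
        have "{vs ! (length as + i), vs ! Suc (length as + i)} \<in> E"
        proof -
          have "Suc (length as + i) < length vs" using that s by simp
          then show ?thesis using vs(1) by (simp add: edge_path_def)
        qed
        moreover have "vs ! (length as + j) = (x # bs) ! j" for j
          unfolding s by (rule nth_append_length_plus)
        ultimately show ?thesis by (metis add_Suc_right)
      qed
      then show ?thesis
        using vs s by (intro exI[of _ "x # bs"]) (auto simp: edge_path_def)
    next
      case False
      have "{(x # vs) ! i, (x # vs) ! Suc i} \<in> E" if "Suc i < length (x # vs)" for i
        using vs that xy by (cases i) (auto simp: edge_path_def hd_conv_nth)
      then show ?thesis
        using vs False by (intro exI[of _ "x # vs"]) (auto simp: edge_path_def)
    qed
  qed
  then show ?thesis using that by blast
qed

text \<open>An edge whose endpoints stay connected after its removal lies on a cycle. So an edge outside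
  all cycles is a bridge.\<close>

lemma cycle_through_edge:
  assumes "u \<noteq> v" "{u, v} \<in> E" "(u, v) \<in> (adj (E - {{u, v}}))\<^sup>*"
  obtains C where "C \<in> cycles E" "{u, v} \<in> C"
proof -
  obtain vs where vs: "edge_path (E - {{u, v}}) vs" "hd vs = u" "last vs = v"
    using connected_path[OF assms(3)] .
  have ne: "vs \<noteq> []" using vs by (auto simp: edge_path_def)
  have "length vs \<noteq> 1" using vs assms(1) by (auto simp: length_Suc_conv)
  moreover have "length vs \<noteq> 2"
  proof
    assume l: "length vs = 2"
    then have "vs ! 0 = u" "vs ! 1 = v" using vs ne by (auto simp: hd_conv_nth last_conv_nth)
    then show False using vs(1) l by (auto simp: edge_path_def)
  qed
  ultimately have "3 \<le> length vs" using ne by (cases "length vs") (auto simp: Suc_le_eq)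
  moreover have "edge_path E vs" using vs by (auto simp: edge_path_def)
  moreover have "{last vs, hd vs} = {u, v}" using vs by auto
  ultimately show ?thesis using path_cycle[of E vs] assms(2) that by metis
qed

text \<open>This fails for lists of length two, where both indices give the same edge.\<close>

lemma cycle_edge_index:
  assumes "distinct vs" "3 \<le> length vs" "i < length vs" "k < length vs"
    and "{vs ! i, vs ! (Suc i mod length vs)} = {vs ! k, vs ! (Suc k mod length vs)}"
  shows "i = k"
proof (rule ccontr)
  assume "i \<noteq> k"
  let ?n = "length vs"
  have n: "?n > 0" using assms(2) by linarith
  have eq: "vs ! a = vs ! b \<longleftrightarrow> a = b" if "a < ?n" "b < ?n" for a b
    using that assms(1) by (simp add: nth_eq_iff_index_eq)
  have "vs ! i \<noteq> vs ! k" using eq \<open>i \<noteq> k\<close> assms by simp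
  then have "vs ! i = vs ! (Suc k mod ?n)" "vs ! (Suc i mod ?n) = vs ! k"
    using assms(5) by (auto simp: doubleton_eq_iff)
  then have "i = Suc k mod ?n" "Suc i mod ?n = k" using eq assms n by auto
  then show False using assms(2-4) by (auto simp: mod_Suc split: if_splits)
qed

lemma cycle_connected:
  assumes "C \<in> cycles E" "x \<in> \<Union>C" "y \<in> \<Union>C"
  shows "(x, y) \<in> (adj C)\<^sup>*"
proof -
  obtain vs where vs: "C = cycle_edges vs" "distinct vs" "3 \<le> length vs"
    using assms(1) unfolding cycles_def by blast
  have len: "length vs > 0" using vs by auto
  have step: "(vs ! 0, vs ! i) \<in> (adj C)\<^sup>*" if "i < length vs" for i
    using that
  proof (induction i)
    case (Suc i)
    then have "{vs ! i, vs ! Suc i} \<in> C"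
      unfolding vs(1) cycle_edges_def by (intro CollectI exI[of _ i]) auto
    then have "(vs ! i, vs ! Suc i) \<in> adj C" by (simp add: adj_def)
    then show ?case using Suc by (meson Suc_lessD rtrancl.rtrancl_into_rtrancl)
  qed simp
  have "\<exists>i<length vs. z = vs ! i" if "z \<in> \<Union>C" for z
    using that len unfolding vs(1) cycle_edges_def by (auto intro: mod_less_divisor)
  then show ?thesis using assms(2,3) step adj_sym by (metis rtrancl_trans)
qed

text \<open>Going once around the cycle, starting behind the removed edge.\<close>

lemma cycle_remove_edge:
  assumes "C \<in> cycles E" "{a, b} \<in> C"
  shows "(a, b) \<in> (adj (C - {{a, b}}))\<^sup>*"
proof -
  obtain vs where vs: "C = cycle_edges vs" "distinct vs" "3 \<le> length vs"
    using assms(1) unfolding cycles_def by blast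
  let ?n = "length vs"
  have n: "?n > 0" using vs by auto
  obtain k where k: "k < ?n" "{a, b} = {vs ! k, vs ! (Suc k mod ?n)}"
    using assms(2) unfolding vs(1) cycle_edges_def by blast
  define p where "p j = vs ! ((Suc k + j) mod ?n)" for j
  have step: "(p 0, p j) \<in> (adj (C - {{a, b}}))\<^sup>*" if "j < ?n" for j
    using that
  proof (induction j)
    case (Suc j)
    let ?i = "(Suc k + j) mod ?n"
    have i: "?i < ?n" "Suc ?i mod ?n = (Suc k + Suc j) mod ?n" using n by (auto simp: mod_Suc_eq)
    have "?i \<noteq> k"
    proof
      assume "?i = k"
      then have "(Suc j + k) mod ?n = (0 + k) mod ?n" using k(1) by (simp add: add.commute)
      then have "?n dvd Suc j" using mod_eq_dvd_iff_nat[of "0 + k" "Suc j + k" ?n] by simp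
      then show False using Suc.prems by (auto dest: dvd_imp_le)
    qed
    then have "{vs ! ?i, vs ! (Suc ?i mod ?n)} \<noteq> {a, b}"
      using cycle_edge_index[OF vs(2,3) i(1) k(1)] k(2) by metis
    moreover have "{vs ! ?i, vs ! (Suc ?i mod ?n)} \<in> C"
      unfolding vs(1) cycle_edges_def using i(1) by blast
    ultimately have "(p j, p (Suc j)) \<in> adj (C - {{a, b}})"
      unfolding p_def i(2)[symmetric] adj_def by simp
    then show ?case using Suc by (meson Suc_lessD rtrancl.rtrancl_into_rtrancl)
  qed simp
  have "Suc k + (?n - 1) = k + ?n" using n by simp
  then have "p (?n - 1) = vs ! k" using k(1) unfolding p_def by simp
  moreover have "p 0 = vs ! (Suc k mod ?n)" by (simp add: p_def)
  ultimately have "(vs ! (Suc k mod ?n), vs ! k) \<in> (adj (C - {{a, b}}))\<^sup>*"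
    using step[of "?n - 1"] n by simp
  moreover have "(a = vs ! k \<and> b = vs ! (Suc k mod ?n)) \<or> (b = vs ! k \<and> a = vs ! (Suc k mod ?n))"
    using k(2) by (auto simp: doubleton_eq_iff)
  ultimately show ?thesis by (metis adj_sym)
qed

text \<open>Start with the edge \<open>e\<close> in one direction and take a longest path. Without leaves its last vertex
  has a second neighbour, which lies on the path, so a cycle is reached from this end of \<open>e\<close>.
  The same happens in the other direction. As there is only one cycle, both ends of \<open>e\<close> are
  connected in the complement of \<open>e\<close>, and \<open>e\<close> lies on a cycle after all.\<close>

lemma leaf_exists:
  assumes E: "simple_graph V E" and uni: "\<And>C D. C \<in> cycles E \<Longrightarrow> D \<in> cycles E \<Longrightarrow> C = D"
    and e: "e \<in> E" "\<And>C. C \<in> cycles E \<Longrightarrow> e \<notin> C"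
  shows "\<exists>v. \<exists>f\<in>E. v \<in> f \<and> (\<forall>g\<in>E. v \<in> g \<longrightarrow> g = f)"
proof (rule ccontr)
  assume no: "\<not> ?thesis"
  have finV: "finite V" using E by (simp add: simple_graph_def)
  have key: "\<exists>D\<in>cycles E. \<exists>z\<in>\<Union>D. (b, z) \<in> (adj (E - {e}))\<^sup>*" if ab: "e = {a, b}" "a \<noteq> b" for a b
  proof -
    define S where "S = {vs. edge_path E vs \<and> (\<exists>rest. vs = a # b # rest) \<and> set vs \<subseteq> V}"
    have abV: "a \<in> V" "b \<in> V" using E e ab unfolding simple_graph_def by auto
    have "[a, b] \<in> S" using ab e abV by (auto simp: S_def edge_path_def)
    have "length vs < Suc (card V)" if "vs \<in> S" for vs
    proof -
      have "length vs = card (set vs)" using that by (auto simp: S_def edge_path_def distinct_card)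
      also have "\<dots> \<le> card V" using that finV by (intro card_mono) (auto simp: S_def)
      finally show ?thesis by simp
    qed
    then have "\<exists>vs. vs \<in> S \<and> (\<forall>us. us \<in> S \<longrightarrow> length us \<le> length vs)"
      using ex_has_greatest_nat[of "\<lambda>vs. vs \<in> S" "[a, b]" length "Suc (card V)"] \<open>[a, b] \<in> S\<close> by auto
    then obtain vs where vs: "vs \<in> S" and max: "\<And>us. us \<in> S \<Longrightarrow> length us \<le> length vs" by blast
    then obtain rest where rest: "vs = a # b # rest" by (auto simp: S_def)
    have path: "edge_path E vs" and vsV: "set vs \<subseteq> V" using vs by (auto simp: S_def)
    define k where "k = length vs - 1"
    have k: "k \<ge> 1" "length vs = Suc k" using rest by (auto simp: k_def)
    define z where "z = vs ! k"
    have lastz: "last vs = z" using rest by (simp add: z_def k_def last_conv_nth)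
    have ez: "{vs ! (k - 1), z} \<in> E" using path k unfolding edge_path_def z_def by (metis Suc_diff_1 less_Suc_eq less_eq_Suc_le One_nat_def)
    obtain g where g: "g \<in> E" "z \<in> g" "g \<noteq> {vs ! (k - 1), z}" using no ez by blast
    obtain i j where "g = {i, j}" "i \<noteq> j" "i \<in> V" "j \<in> V" by (rule simple_graph_edge[OF E g(1)])
    then obtain q where q: "g = {z, q}" "q \<noteq> z" "q \<in> V" using g(2) by auto
    have qp: "q \<noteq> vs ! (k - 1)" using g q by (auto simp: insert_commute)
    have "q \<in> set vs"
    proof (rule ccontr)
      assume "q \<notin> set vs"
      have "{(vs @ [q]) ! i, (vs @ [q]) ! Suc i} \<in> E" if "Suc i < length (vs @ [q])" for i
      proof (cases "Suc i < length vs")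
        case True
        then show ?thesis using path by (auto simp: edge_path_def nth_append)
      next
        case False
        then have "i = k" using that k by simp
        then show ?thesis using g q k by (simp add: nth_append z_def)
      qed
      then have "vs @ [q] \<in> S"
        using path \<open>q \<notin> set vs\<close> q vsV rest by (auto simp: S_def edge_path_def)
      then show False using max by fastforce
    qed
    then obtain j where j: "j < length vs" "vs ! j = q" by (auto simp: in_set_conv_nth)
    have "j \<noteq> k" using j q by (auto simp: z_def)
    moreover have "j \<noteq> k - 1" using j qp by auto
    ultimately have jk: "j + 2 \<le> k" using j k by auto
    have dp: "edge_path E (drop j vs)"
      using path j by (auto simp: edge_path_def)
    have "hd (drop j vs) = q" using j by (simp add: hd_drop_conv_nth)
    moreover have "last (drop j vs) = z" using lastz j by simp
    ultimately have "cycle_edges (drop j vs) \<in> cycles E" "{z, q} \<in> cycle_edges (drop j vs)"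
      using path_cycle[OF dp] g q jk k by auto
    moreover have "(b, vs ! i) \<in> (adj (E - {e}))\<^sup>*" if "1 \<le> i" "i \<le> k" for i
      using that
    proof (induction i rule: dec_induct)
      case base
      then show ?case using rest by simp
    next
      case (step i)
      have "{vs ! i, vs ! Suc i} \<in> E" using path step k by (auto simp: edge_path_def)
      moreover have "a \<noteq> vs ! i" "a \<noteq> vs ! Suc i"
        using path step k rest nth_eq_iff_index_eq[of vs 0 i] nth_eq_iff_index_eq[of vs 0 "Suc i"]
        by (auto simp: edge_path_def)
      ultimately have "(vs ! i, vs ! Suc i) \<in> adj (E - {e})" using ab by (auto simp: adj_def)
      then show ?case using step by (meson Suc_leD rtrancl.rtrancl_into_rtrancl)
    qed
    ultimately show ?thesis using k unfolding z_def by blast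
  qed
  obtain a b where ab: "e = {a, b}" "a \<noteq> b"
    using E e unfolding simple_graph_def by (metis card_2_iff)
  have ba: "e = {b, a}" "b \<noteq> a" using ab by auto
  obtain D z where D: "D \<in> cycles E" "z \<in> \<Union>D" "(b, z) \<in> (adj (E - {e}))\<^sup>*" using key[OF ab] by blast
  obtain D' z' where D': "D' \<in> cycles E" "z' \<in> \<Union>D'" "(a, z') \<in> (adj (E - {e}))\<^sup>*" using key[OF ba] by blast
  have "D' = D" using uni D D' by blast
  then have "(z', z) \<in> (adj D)\<^sup>*" using cycle_connected[OF D(1)] D(2) D'(2) by blast
  moreover have "D \<subseteq> E - {e}" using D(1) e(2) cycle_subset_edges by blast
  ultimately have "(z', z) \<in> (adj (E - {e}))\<^sup>*" using adj_mono by blast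
  then have "(a, b) \<in> (adj (E - {e}))\<^sup>*" using D(3) D'(3) adj_sym by (metis rtrancl_trans)
  then obtain C where "C \<in> cycles E" "e \<in> C" using cycle_through_edge[of a b E] ab e(1) by metis
  then show False using e(2) by blast
qed

section \<open>Weighted colourings\<close>

lemma vdegree_mono: "finite F \<Longrightarrow> E \<subseteq> F \<Longrightarrow> vdegree E v \<le> vdegree F v"
  unfolding vdegree_def by (rule card_mono) auto

text \<open>The path obtained from the cycle by omitting the closing edge is coloured alternately with 1
  and 2; the closing edge gets colour 3. Along the path the differences \<open>-1, 2, -3, 4, \<dots>\<close> of the
  weights for colours 1 and 2 have sums of alternating sign at consecutive vertices. Colour 3 has a
  large weight at the two ends of the path, outweighed at all inner vertices by a very negative
  one.\<close>

lemma weighted_colouring_cycle: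
  assumes vs: "distinct vs" "3 \<le> length vs" and d: "3 \<le> d"
  shows "\<exists>col w. weighted_colouring d (cycle_edges vs) col w"
proof -
  let ?n = "length vs"
  define g where "g i = {vs ! i, vs ! (Suc i mod ?n)}" for i
  define \<kappa> :: "nat \<Rightarrow> nat" where "\<kappa> i = (if Suc i = ?n then 3 else if even i then 1 else 2)" for i
  define D :: "nat \<Rightarrow> int" where "D i = (if even i then - (int i + 1) else int i + 1)" for i
  define W :: "nat \<Rightarrow> nat \<Rightarrow> int" where
    "W i l = (if l = 1 then D i else if l = 2 then 0
      else if l = 3 then (if i = 0 \<or> Suc i = ?n then int ?n else - 2 * int ?n) else - 3 * int ?n)" for i l
  define col where "col e = \<kappa> (inv_into {..<?n} g e)" for e
  define w where "w v = W (inv_into {..<?n} ((!) vs) v)" for v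
  have ginj: "inj_on g {..<?n}"
    using cycle_edge_index[OF vs] by (auto simp: inj_on_def g_def)
  have vinj: "inj_on ((!) vs) {..<?n}" using vs(1) by (auto simp: inj_on_def nth_eq_iff_index_eq)
  have colg: "col (g i) = \<kappa> i" if "i < ?n" for i using ginj that by (simp add: col_def)
  have wv: "w (vs ! i) = W i" if "i < ?n" for i using vinj that by (simp add: w_def)
  have C: "e \<in> cycle_edges vs \<longleftrightarrow> (\<exists>i<?n. e = g i)" for e by (auto simp: cycle_edges_def g_def)
  have n: "?n > 0" using vs by auto
  have sucn: "Suc i mod ?n < ?n" for i using n by simp
  have eq: "vs ! a = vs ! b \<longleftrightarrow> a = b" if "a < ?n" "b < ?n" for a b
    using that vs(1) by (simp add: nth_eq_iff_index_eq)
  have main: "W i l + W (Suc i mod ?n) l < W i (\<kappa> i) + W (Suc i mod ?n) (\<kappa> i)"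
    if "i < ?n" "l \<in> {1..d}" "l \<noteq> \<kappa> i" for i l
  proof (cases "Suc i = ?n")
    case True
    then have "Suc i mod ?n = 0" "\<kappa> i = 3" by (auto simp: \<kappa>_def)
    then show ?thesis using True that vs(2) by (auto simp: W_def D_def)
  next
    case False
    then have "Suc i mod ?n = Suc i" using that by simp
    then show ?thesis using False that vs(2) by (auto simp: W_def D_def \<kappa>_def split: if_splits)
  qed
  have "weighted_colouring d (cycle_edges vs) col w"
    unfolding weighted_colouring_def
  proof (intro conjI ballI impI allI)
    fix e assume "e \<in> cycle_edges vs"
    then obtain i where i: "i < ?n" "e = g i" using C by blast
    show "col e \<in> {1..d}" using colg[OF i(1)] i(2) d by (auto simp: \<kappa>_def)
    fix e' assume "e' \<in> cycle_edges vs" and ne: "e \<noteq> e'" "e \<inter> e' \<noteq> {}"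
    then obtain k where k: "k < ?n" "e' = g k" using C by blast
    have ik: "i \<noteq> k" using ne i k by auto
    have "vs ! i = vs ! k \<or> vs ! i = vs ! (Suc k mod ?n) \<or> vs ! (Suc i mod ?n) = vs ! k \<or>
        vs ! (Suc i mod ?n) = vs ! (Suc k mod ?n)"
      using ne(2) i k by (auto simp: g_def)
    then have "i = Suc k mod ?n \<or> Suc i mod ?n = k \<or> Suc i mod ?n = Suc k mod ?n"
      using eq i k sucn ik by auto
    then have "\<kappa> i \<noteq> \<kappa> k" using ik i(1) k(1) by (auto simp: \<kappa>_def mod_Suc split: if_splits)
    then show "col e \<noteq> col e'" using colg i k by simp
  next
    fix a b l assume ab: "{a, b} \<in> cycle_edges vs" "a \<noteq> b" "l \<in> {1..d}" "l \<noteq> col {a, b}"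
    then obtain i where i: "i < ?n" "{a, b} = g i" using C by blast
    have "W i l + W (Suc i mod ?n) l < W i (col {a, b}) + W (Suc i mod ?n) (col {a, b})"
      using main[OF i(1) ab(3)] ab(4) i(2) colg[OF i(1)] by simp
    moreover have "(a = vs ! i \<and> b = vs ! (Suc i mod ?n)) \<or> (b = vs ! i \<and> a = vs ! (Suc i mod ?n))"
      using i(2) by (auto simp: g_def doubleton_eq_iff)
    ultimately show "w a l + w b l < w a (col {a, b}) + w b (col {a, b})"
      using wv[OF i(1)] wv[OF sucn[of i]] by auto
  qed
  then show ?thesis by blast
qed

text \<open>The leaf \<open>v\<close> occurs in no other edge, so its weight for a colour that is free at \<open>u\<close> can be chosen
  as large as necessary.\<close>

lemma weighted_colouring_leaf:
  assumes F: "weighted_colouring d (E - {f}) col w" and E: "finite E" "f \<in> E" "f = {u, v}" "u \<noteq> v"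
    and leaf: "\<And>g. g \<in> E \<Longrightarrow> v \<in> g \<Longrightarrow> g = f" and deg: "vdegree E u \<le> d"
  shows "\<exists>col w. weighted_colouring d E col w"
proof -
  let ?U = "{g \<in> E - {f}. u \<in> g}"
  have "{g \<in> E. u \<in> g} = insert f ?U" using E by auto
  then have "card ?U < d" using deg E(1) by (simp add: vdegree_def)
  then have "card (col ` ?U) < card {1..d}" using card_image_le[of ?U col] E(1) by simp
  then have "\<not> {1..d} \<subseteq> col ` ?U" using card_mono[of "col ` ?U" "{1..d}"] E(1) by auto
  then obtain c where c: "c \<in> {1..d}" "c \<notin> col ` ?U" by blast
  define M where "M = 1 + \<bar>w u c\<bar> + (\<Sum>l\<in>{1..d}. \<bar>w u l\<bar>)"
  have M: "w u l < w u c + M" if "l \<in> {1..d}" for l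
    using member_le_sum[OF that, of "\<lambda>l. \<bar>w u l\<bar>"] by (simp add: M_def)
  define col' where "col' = col(f := c)"
  define w' where "w' = w(v := (\<lambda>l. if l = c then M else 0))"
  have other: "g \<in> E - {f}" "v \<notin> g" if "g \<in> E" "g \<noteq> f" for g using that leaf by auto
  have "weighted_colouring d E col' w'"
    unfolding weighted_colouring_def
  proof (intro conjI ballI impI allI)
    fix g assume g: "g \<in> E"
    show "col' g \<in> {1..d}" using F c g by (auto simp: col'_def weighted_colouring_def)
    fix h assume h: "h \<in> E" and ne: "g \<noteq> h" "g \<inter> h \<noteq> {}"
    have f: "col g' \<noteq> c" if "g' \<in> E" "g' \<noteq> f" "g' \<inter> f \<noteq> {}" for g'
      using c(2) other[OF that(1,2)] that(3) E(3) by auto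
    show "col' g \<noteq> col' h"
    proof (cases "g = f \<or> h = f")
      case True
      then show ?thesis using f[of g] f[of h] g h ne by (auto simp: col'_def)
    next
      case False
      then show ?thesis using F g h ne unfolding weighted_colouring_def col'_def by auto
    qed
  next
    fix i j l assume ij: "{i, j} \<in> E" "i \<noteq> j" "l \<in> {1..d}" "l \<noteq> col' {i, j}"
    show "w' i l + w' j l < w' i (col' {i, j}) + w' j (col' {i, j})"
    proof (cases "{i, j} = f")
      case True
      then have "(i = u \<and> j = v) \<or> (i = v \<and> j = u)" using E(3) by (auto simp: doubleton_eq_iff)
      then show ?thesis using True ij M[OF ij(3)] E(4) by (auto simp: col'_def w'_def)
    next
      case False
      then have "i \<noteq> v" "j \<noteq> v" using other[OF ij(1)] by auto
      then show ?thesis using F False ij unfolding weighted_colouring_def by (simp add: col'_def w'_def)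
    qed
  qed
  then show ?thesis by blast
qed

text \<open>Leaves are removed first. What remains without leaves consists of edges on cycles, hence is
  empty or equal to the only cycle.\<close>

lemma weighted_colouring_exists:
  assumes "simple_graph V E" "\<And>C D. C \<in> cycles E \<Longrightarrow> D \<in> cycles E \<Longrightarrow> C = D"
    and "\<And>v. v \<in> V \<Longrightarrow> vdegree E v \<le> d" and d: "3 \<le> d"
  shows "\<exists>col w. weighted_colouring d E col w"
  using assms(1-3)
proof (induction "card E" arbitrary: E rule: less_induct)
  case less
  note E = less.prems(1)
  have finE: "finite E" by (rule simple_graph_finite[OF E])
  show ?case
  proof (cases "\<exists>v. \<exists>f\<in>E. v \<in> f \<and> (\<forall>g\<in>E. v \<in> g \<longrightarrow> g = f)")
    case True
    then obtain v f where f: "f \<in> E" "v \<in> f" "\<And>g. g \<in> E \<Longrightarrow> v \<in> g \<Longrightarrow> g = f" by blast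
    obtain i j where ij: "f = {i, j}" "i \<noteq> j" "i \<in> V" "j \<in> V" by (rule simple_graph_edge[OF E f(1)])
    then obtain u where u: "f = {u, v}" "u \<noteq> v" "u \<in> V" using f(2) by auto
    have sub: "E - {f} \<subseteq> E" by auto
    have "\<exists>col w. weighted_colouring d (E - {f}) col w"
    proof (rule less.hyps)
      show "card (E - {f}) < card E" using finE f(1) by (rule card_Diff1_less)
      show "simple_graph V (E - {f})" by (rule simple_graph_subset[OF E sub])
      show "C = D" if "C \<in> cycles (E - {f})" "D \<in> cycles (E - {f})" for C D
        using that cycles_mono[OF sub] less.prems(2) by blast
      show "vdegree (E - {f}) x \<le> d" if "x \<in> V" for x
        using vdegree_mono[OF finE sub, of x] less.prems(3)[OF that] by simp
    qed
    then show ?thesis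
      using weighted_colouring_leaf[OF _ finE f(1) u(1,2) f(3)] less.prems(3)[OF u(3)] by blast
  next
    case False
    show ?thesis
    proof (cases "E = {}")
      case True
      have "weighted_colouring d {} col w" for col w by (simp add: weighted_colouring_def)
      then show ?thesis using True by blast
    next
      case False
      have cyc: "\<exists>C\<in>cycles E. e \<in> C" if "e \<in> E" for e
        using leaf_exists[OF E less.prems(2) that] \<open>\<not> (\<exists>v. \<exists>f\<in>E. v \<in> f \<and> (\<forall>g\<in>E. v \<in> g \<longrightarrow> g = f))\<close> by blast
      then obtain C where C: "C \<in> cycles E" using False by blast
      then have "E = C" using cyc less.prems(2) cycle_subset_edges by blast
      moreover obtain vs where "C = cycle_edges vs" "distinct vs" "3 \<le> length vs"
        using C unfolding cycles_def by blast
      ultimately show ?thesis using weighted_colouring_cycle d by blast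
    qed
  qed
qed

section \<open>The two forms and removal of one edge\<close>

lemma max_degree_le_iff:
  assumes "finite V" "V \<noteq> {}"
  shows "max_degree V E \<le> d \<longleftrightarrow> (\<forall>v\<in>V. vdegree E v \<le> d)"
  unfolding max_degree_def using assms by simp

text \<open>Removing the bridge leaves two components. The one of \<open>v\<close> inherits the cycle through \<open>z\<close>, and the
  one of \<open>u\<close> has none.\<close>

lemma bridge_split:
  assumes E: "connected_graph V E" and C: "C \<in> cycles E" "\<And>D. D \<in> cycles E \<Longrightarrow> D = C"
    and e: "{u, v} \<in> E" "u \<noteq> v" "{u, v} \<notin> C"
    and deg: "\<And>x. x \<in> V \<Longrightarrow> vdegree (E - {{u, v}}) x \<le> d"
    and z: "z \<in> \<Union>C" "(v, z) \<in> (adj (E - {{u, v}}))\<^sup>*"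
  shows "\<exists>V\<^sub>H E\<^sub>H V\<^sub>U E\<^sub>U.
       V\<^sub>H \<inter> V\<^sub>U = {} \<and> V\<^sub>H \<union> V\<^sub>U = V \<and>
       tree V\<^sub>H E\<^sub>H \<and> max_degree V\<^sub>H E\<^sub>H \<le> d \<and>
       unicyclic V\<^sub>U E\<^sub>U \<and> max_degree V\<^sub>U E\<^sub>U \<le> d \<and>
       u \<in> V\<^sub>H \<and> v \<in> V\<^sub>U \<and> E = insert {u, v} (E\<^sub>H \<union> E\<^sub>U)"
proof -
  define F where "F = E - {{u, v}}"
  have sg: "simple_graph V E" using E by (simp add: connected_graph_def)
  have finE: "finite E" by (rule simple_graph_finite[OF sg])
  have finV: "finite V" using sg by (simp add: simple_graph_def)
  have uvV: "u \<in> V" "v \<in> V" using sg e(1) by (auto simp: simple_graph_def)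
  have EV: "x \<in> V" "y \<in> V" if "{x, y} \<in> E" for x y using that sg by (auto simp: simple_graph_def)
  have nuv: "(u, v) \<notin> (adj F)\<^sup>*"
    using cycle_through_edge[OF e(2,1)] e(3) C(2) unfolding F_def by blast
  define A where "A = {x \<in> V. (u, x) \<in> (adj F)\<^sup>*}"
  define B where "B = {x \<in> V. (v, x) \<in> (adj F)\<^sup>*}"
  define EA where "EA = {f \<in> F. f \<subseteq> A}"
  define EB where "EB = {f \<in> F. f \<subseteq> B}"
  have uv: "u \<in> A" "v \<in> B" using uvV by (auto simp: A_def B_def)
  have AB: "A \<inter> B = {}"
  proof (rule ccontr)
    assume "A \<inter> B \<noteq> {}"
    then obtain x where "(u, x) \<in> (adj F)\<^sup>*" "(v, x) \<in> (adj F)\<^sup>*" by (auto simp: A_def B_def)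
    then show False using nuv rtrancl_trans[OF _ adj_sym] by metis
  qed
  have "x \<in> A \<union> B" if "(u, x) \<in> (adj E)\<^sup>*" for x
    using that
  proof induction
    case base
    then show ?case using uv by simp
  next
    case (step x y)
    then have xy: "{x, y} \<in> E" by (simp add: adj_def)
    show ?case
    proof (cases "{x, y} = {u, v}")
      case True
      then show ?thesis using uv by (auto simp: doubleton_eq_iff)
    next
      case False
      then have "(x, y) \<in> adj F" using xy by (simp add: adj_def F_def)
      then show ?thesis using step.IH EV[OF xy] unfolding A_def B_def
        by (auto intro: rtrancl.rtrancl_into_rtrancl)
    qed
  qed
  moreover have "(u, x) \<in> (adj E)\<^sup>*" if "x \<in> V" for x
    using E that uvV unfolding connected_graph_def adj_def by blast
  ultimately have ABV: "A \<union> B = V" unfolding A_def B_def by blast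
  have FE: "F \<subseteq> E" by (auto simp: F_def)
  have closedA: "y \<in> A" if "x \<in> A" "{x, y} \<in> F" for x y
    using that EV[of x y] FE unfolding A_def by (auto simp: adj_def intro: rtrancl.rtrancl_into_rtrancl)
  have closedB: "y \<in> B" if "x \<in> B" "{x, y} \<in> F" for x y
    using that EV[of x y] FE unfolding B_def by (auto simp: adj_def intro: rtrancl.rtrancl_into_rtrancl)
  have split: "f \<subseteq> A \<or> f \<subseteq> B" if f: "f \<in> F" for f
  proof -
    obtain x y where xy: "f = {x, y}" "x \<in> V" using simple_graph_edge[OF sg, of f] f FE by blast
    then have "x \<in> A \<or> x \<in> B" using ABV by blast
    then show ?thesis using closedA closedB f xy by blast
  qed
  then have FAB: "F = EA \<union> EB" unfolding EA_def EB_def by blast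
  have reach: "(u, x) \<in> (adj EA)\<^sup>*" if "(u, x) \<in> (adj F)\<^sup>*" for x
    using that
  proof induction
    case (step x y)
    then have "x \<in> V" "y \<in> V" using EV[of x y] FE by (auto simp: adj_def)
    then have "x \<in> A" "y \<in> A" using step unfolding A_def by (auto intro: rtrancl.rtrancl_into_rtrancl)
    then have "(x, y) \<in> adj EA" using step by (auto simp: adj_def EA_def)
    then show ?case using step.IH by (rule rtrancl.rtrancl_into_rtrancl[rotated])
  qed simp
  have CF: "C \<subseteq> F" using cycle_subset_edges[OF C(1)] e(3) by (auto simp: F_def)
  have CB: "C \<subseteq> EB"
  proof
    fix f assume f: "f \<in> C"
    have "x \<in> B" if "x \<in> f" for x
    proof -
      have "(z, x) \<in> (adj C)\<^sup>*" using cycle_connected[OF C(1) z(1)] f that by blast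
      then have "(v, x) \<in> (adj F)\<^sup>*" using z(2) adj_mono[OF CF] unfolding F_def[symmetric] by (meson rtrancl_trans subsetD)
      moreover have "x \<in> V" using sg f CF FE that unfolding simple_graph_def by blast
      ultimately show ?thesis by (simp add: B_def)
    qed
    then show "f \<in> EB" using f CF by (auto simp: EB_def)
  qed
  have EAE: "EA \<subseteq> E" "EB \<subseteq> E" using FE by (auto simp: EA_def EB_def)
  have sgA: "simple_graph A EA" "simple_graph B EB"
    using sg FE finV by (auto simp: simple_graph_def EA_def EB_def A_def B_def)
  have noC: "cycles EA = {}"
  proof (rule ccontr)
    assume "cycles EA \<noteq> {}"
    then obtain D where D: "D \<in> cycles EA" by blast
    then have "D = C" using C(2) cycles_mono[OF EAE(1)] by blast
    then obtain f where f: "f \<in> EA" "f \<in> EB" using CB D cycle_subset_edges[OF D] cycle_nonempty[OF D] by blast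
    then have "f \<subseteq> {}" using AB by (auto simp: EA_def EB_def)
    moreover have "card f = 2" using f(1) sgA(1) by (simp add: simple_graph_def)
    ultimately show False by simp
  qed
  have "tree A EA"
    unfolding tree_def connected_graph_def adj_def[symmetric]
  proof (intro conjI ballI)
    fix x y assume "x \<in> A" "y \<in> A"
    then have "(u, x) \<in> (adj EA)\<^sup>*" "(u, y) \<in> (adj EA)\<^sup>*" using reach by (auto simp: A_def)
    then show "(x, y) \<in> (adj EA)\<^sup>*" using adj_sym by (metis rtrancl_trans)
  qed (use sgA noC uv in auto)
  moreover have "unicyclic B EB"
    unfolding unicyclic_def
    using sgA(2) cycles_subset[OF C(1) CB] C(2) cycles_mono[OF EAE(2)] by blast
  moreover have "vdegree EA x \<le> d" "vdegree EB x \<le> d" if "x \<in> V" for x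
  proof -
    have "finite F" "EA \<subseteq> F" "EB \<subseteq> F" using finE by (auto simp: F_def EA_def EB_def)
    then show "vdegree EA x \<le> d" "vdegree EB x \<le> d"
      using vdegree_mono[of F EA x] vdegree_mono[of F EB x] deg[OF that] by (auto simp: F_def)
  qed
  then have "max_degree A EA \<le> d" "max_degree B EB \<le> d"
    using max_degree_le_iff[of A EA d] max_degree_le_iff[of B EB d] finV uv
    by (auto simp: A_def B_def)
  moreover have "E = insert {u, v} (EA \<union> EB)" using FAB e(1) by (auto simp: F_def)
  ultimately show ?thesis using AB ABV uv by (intro exI[of _ A] exI[of _ EA] exI[of _ B] exI[of _ EB]) simp
qed

text \<open>Removing a cycle edge gives the first form and removing a bridge the second. In the second
  case the cycle may lie on either side of the bridge, and the roles of its endpoints are chosen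
  accordingly.\<close>

lemma forms_iff_edge_removal:
  assumes con: "connected_graph V E" and uni: "unicyclic V E"
  shows "(\<exists>F u v. tree V F \<and> max_degree V F \<le> d \<and>
       u \<in> V \<and> v \<in> V \<and> u \<noteq> v \<and> {u, v} \<notin> F \<and> E = insert {u, v} F) \<or>
    (\<exists>V\<^sub>H E\<^sub>H V\<^sub>U E\<^sub>U u v.
       V\<^sub>H \<inter> V\<^sub>U = {} \<and> V\<^sub>H \<union> V\<^sub>U = V \<and>
       tree V\<^sub>H E\<^sub>H \<and> max_degree V\<^sub>H E\<^sub>H \<le> d \<and>
       unicyclic V\<^sub>U E\<^sub>U \<and> max_degree V\<^sub>U E\<^sub>U \<le> d \<and>
       u \<in> V\<^sub>H \<and> v \<in> V\<^sub>U \<and> E = insert {u, v} (E\<^sub>H \<union> E\<^sub>U))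
    \<longleftrightarrow> (\<exists>e\<in>E. \<forall>x\<in>V. vdegree (E - {e}) x \<le> d)"
    (is "?F1 \<or> ?F2 \<longleftrightarrow> ?R")
proof
  have sg: "simple_graph V E" and V: "finite V" "V \<noteq> {}"
    using con by (auto simp: connected_graph_def simple_graph_def)
  have finE: "finite E" by (rule simple_graph_finite[OF sg])
  show ?R if "?F1 \<or> ?F2"
    using that
  proof
    assume ?F1
    then obtain F u v where F: "max_degree V F \<le> d" "{u, v} \<notin> F" "E = insert {u, v} F" by blast
    then have "E - {{u, v}} = F" by auto
    then show ?R using F max_degree_le_iff[OF V, of F d] by (intro bexI[of _ "{u, v}"]) auto
  next
    assume ?F2
    then obtain H EH U EU u v where *: "H \<inter> U = {}" "H \<union> U = V" "tree H EH" "max_degree H EH \<le> d"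
       "unicyclic U EU" "max_degree U EU \<le> d" "u \<in> H" "v \<in> U" "E = insert {u, v} (EH \<union> EU)" by blast
    have sub: "f \<subseteq> H" if "f \<in> EH" for f using that *(3) by (auto simp: tree_def connected_graph_def simple_graph_def)
    have sub': "f \<subseteq> U" if "f \<in> EU" for f using that *(5) by (auto simp: unicyclic_def simple_graph_def)
    have fin: "finite EH" "finite EU" using finE *(9) by auto
    have finHU: "finite H" "finite U" using V(1) *(2) by auto
    have "vdegree (E - {{u, v}}) x \<le> d" if "x \<in> V" for x
    proof (cases "x \<in> H")
      case True
      have "vdegree (E - {{u, v}}) x \<le> vdegree EH x"
        unfolding vdegree_def by (rule card_mono) (use fin True *(1,9) sub' in auto)
      then show ?thesis using *(4) True max_degree_le_iff[of H EH d] finHU by force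
    next
      case False
      then have xU: "x \<in> U" using that *(2) by blast
      have "vdegree (E - {{u, v}}) x \<le> vdegree EU x"
        unfolding vdegree_def by (rule card_mono) (use fin False *(9) sub in auto)
      then show ?thesis using *(6) xU max_degree_le_iff[of U EU d] finHU by force
    qed
    then show ?R using *(9) by (intro bexI[of _ "{u, v}"]) auto
  qed
  show "?F1 \<or> ?F2" if R: ?R
  proof -
    obtain e where e: "e \<in> E" "\<And>x. x \<in> V \<Longrightarrow> vdegree (E - {e}) x \<le> d" using R by blast
    obtain u v where uv: "e = {u, v}" "u \<noteq> v" "u \<in> V" "v \<in> V" by (rule simple_graph_edge[OF sg e(1)])
    obtain C where C: "C \<in> cycles E" "\<And>D. D \<in> cycles E \<Longrightarrow> D = C" using uni unfolding unicyclic_def by blast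
    show ?thesis
    proof (cases "e \<in> C")
      case True
      let ?F = "E - {e}"
      have sgF: "simple_graph V ?F" by (rule simple_graph_subset[OF sg]) auto
      have uvF: "(u, v) \<in> (adj ?F)\<^sup>*"
        using cycle_remove_edge[OF C(1), of u v] True uv(1) adj_mono[of "C - {e}" ?F] cycle_subset_edges[OF C(1)] by blast
      have "adj E \<subseteq> (adj ?F)\<^sup>*"
      proof safe
        fix x y assume xy: "(x, y) \<in> adj E"
        show "(x, y) \<in> (adj ?F)\<^sup>*"
        proof (cases "{x, y} = e")
          case True
          then have "(x = u \<and> y = v) \<or> (x = v \<and> y = u)" using uv(1) by (auto simp: doubleton_eq_iff)
          then show ?thesis using uvF adj_sym by auto
        next
          case False
          then show ?thesis using xy by (auto simp: adj_def)
        qed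
      qed
      then have "(adj E)\<^sup>* \<subseteq> (adj ?F)\<^sup>*" by (rule rtrancl_subset_rtrancl)
      then have "connected_graph V ?F"
        using con sgF unfolding connected_graph_def adj_def[symmetric] by blast
      moreover have "cycles ?F = {}"
      proof (rule ccontr)
        assume "cycles ?F \<noteq> {}"
        then obtain D where D: "D \<in> cycles ?F" by blast
        then have "D = C" using C(2) cycles_mono[of ?F E] by blast
        then show False using True cycle_subset_edges[OF D] by blast
      qed
      ultimately have "tree V ?F" by (simp add: tree_def)
      moreover have "max_degree V ?F \<le> d" using max_degree_le_iff[OF V] e(2) by blast
      ultimately have ?F1
        using uv e(1) by (intro exI[of _ ?F] exI[of _ u] exI[of _ v]) auto
      then show ?thesis ..
    next
      case False
      obtain f z where z: "f \<in> C" "z \<in> f" "z \<in> V"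
        using cycle_nonempty[OF C(1)] cycle_subset_edges[OF C(1)] simple_graph_edge[OF sg]
        by (metis all_not_in_conv insertI1 subsetD)
      have reach: "(v, x) \<in> (adj (E - {e}))\<^sup>* \<or> (u, x) \<in> (adj (E - {e}))\<^sup>*" if "(u, x) \<in> (adj E)\<^sup>*" for x
        using that
      proof induction
        case (step x y)
        show ?case
        proof (cases "{x, y} = e")
          case True
          then show ?thesis using uv(1) by (auto simp: doubleton_eq_iff)
        next
          case False
          then have "(x, y) \<in> adj (E - {e})" using step by (simp add: adj_def)
          then show ?thesis using step.IH by (meson rtrancl.rtrancl_into_rtrancl)
        qed
      qed simp
      have "(u, z) \<in> (adj E)\<^sup>*" using con uv z unfolding connected_graph_def adj_def by blast
      then have "(v, z) \<in> (adj (E - {e}))\<^sup>* \<or> (u, z) \<in> (adj (E - {e}))\<^sup>*" by (rule reach)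
      then have ?F2
      proof
        assume "(v, z) \<in> (adj (E - {e}))\<^sup>*"
        then show ?F2
          using bridge_split[OF con C, of u v d z] e uv False z by blast
      next
        assume "(u, z) \<in> (adj (E - {e}))\<^sup>*"
        moreover have "e = {v, u}" using uv by auto
        ultimately show ?F2
          using bridge_split[OF con C, of v u d z] e uv(2) False z by blast
      qed
      then show ?thesis ..
    qed
  qed
qed

text \<open>Call a vertex bad if its degree is greater than \<open>d\<close>. If neither a vertex of degree at least
  \<open>d + 2\<close> nor a nonadjacent pair of bad vertices serves as \<open>B\<close>, bad vertices have degree \<open>d + 1\<close> and are
  mutually adjacent. Removing an edge leaves some bad vertex off that edge; removing first an edge
  at \<open>v\<close> and then the edge between the two bad vertices found, one gets three bad vertices, a
  triangle.\<close>

lemma obstruction: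
  assumes sg: "simple_graph V E" and tf: "triangle_free E"
    and v: "v \<in> V" "vdegree E v > d" and bad: "\<And>e. e \<in> E \<Longrightarrow> \<exists>x\<in>V. vdegree (E - {e}) x > d"
  shows "\<exists>B\<subseteq>V. card B * d + card {e \<in> E. e \<inter> B = {}} + 2 \<le> card E"
proof (rule ccontr)
  assume no: "\<not> ?thesis"
  have finE: "finite E" by (rule simple_graph_finite[OF sg])
  have deg: "vdegree E x \<le> d + 1" if "x \<in> V" for x
  proof (rule ccontr)
    assume "\<not> ?thesis"
    moreover have "card E = vdegree E x + card {e \<in> E. e \<inter> {x} = {}}"
      unfolding vdegree_def using finE
      by (subst card_Un_disjoint[symmetric]) (auto intro!: arg_cong[of _ _ card])
    ultimately show False using no that by (auto dest!: spec[of _ "{x}"])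
  qed
  have two: "{x, y} \<in> E" if "x \<in> V" "y \<in> V" "x \<noteq> y" "vdegree E x > d" "vdegree E y > d" for x y
  proof (rule ccontr)
    assume ne: "{x, y} \<notin> E"
    have disj: "{e \<in> E. x \<in> e} \<inter> {e \<in> E. y \<in> e} = {}"
    proof (rule ccontr)
      assume "\<not> ?thesis"
      then obtain e where e: "e \<in> E" "x \<in> e" "y \<in> e" by blast
      obtain i j where "e = {i, j}" by (rule simple_graph_edge[OF sg e(1)])
      then have "e = {x, y}" using e that(3) by auto
      then show False using ne e by simp
    qed
    have "card E = card (({e \<in> E. x \<in> e} \<union> {e \<in> E. y \<in> e}) \<union> {e \<in> E. e \<inter> {x, y} = {}})"
      by (rule arg_cong[of _ _ card]) auto
    also have "\<dots> = card ({e \<in> E. x \<in> e} \<union> {e \<in> E. y \<in> e}) + card {e \<in> E. e \<inter> {x, y} = {}}"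
      using finE by (intro card_Un_disjoint) auto
    also have "card ({e \<in> E. x \<in> e} \<union> {e \<in> E. y \<in> e}) = vdegree E x + vdegree E y"
      unfolding vdegree_def using finE disj by (intro card_Un_disjoint) auto
    finally have "card {x, y} * d + card {e \<in> E. e \<inter> {x, y} = {}} + 2 \<le> card E"
      using that(3-5) by simp
    moreover have "{x, y} \<subseteq> V" using that(1,2) by simp
    ultimately show False using no by metis
  qed
  have remove: "\<exists>y\<in>V. vdegree E y > d \<and> y \<notin> e" if e: "e \<in> E" for e
  proof -
    obtain y where y: "y \<in> V" "vdegree (E - {e}) y > d" using bad[OF e] by blast
    have le: "vdegree (E - {e}) y \<le> vdegree E y" using vdegree_mono[OF finE] by blast
    have "y \<notin> e"
    proof
      assume ye: "y \<in> e"
      have "{f \<in> E. y \<in> f} = insert e {f \<in> E - {e}. y \<in> f}" using e ye by auto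
      then have "vdegree E y = Suc (vdegree (E - {e}) y)" using finE by (simp add: vdegree_def)
      then show False using deg[OF y(1)] y(2) by simp
    qed
    moreover have "vdegree E y > d" using y le by simp
    ultimately show ?thesis using y(1) by blast
  qed
  have "{e \<in> E. v \<in> e} \<noteq> {}"
  proof
    assume "{e \<in> E. v \<in> e} = {}"
    then have "vdegree E v = 0" by (simp only: vdegree_def card.empty)
    then show False using v(2) by simp
  qed
  then obtain e where "e \<in> E" "v \<in> e" by blast
  then obtain u where u: "u \<in> V" "vdegree E u > d" "u \<noteq> v" using remove by blast
  have uv: "{u, v} \<in> E" using two u v by blast
  obtain y where y: "y \<in> V" "vdegree E y > d" "y \<noteq> u" "y \<noteq> v" using remove[OF uv] by auto
  have "{v, y} \<in> E" "{y, u} \<in> E" using two[of v y] two[of y u] u v y by auto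
  then show False using tf uv u y unfolding triangle_free_def by auto
qed

theorem theorem3p3:
  fixes n d :: nat and E :: "nat set set"
  assumes "d \<ge> 3"
    and "connected_graph {1..n} E"
    and "unicyclic {1..n} E"
    and "triangle_free E"
    and "max_degree {1..n} E > d"
  shows "almost_complete_intersection
           (lss_ring n d :: (nat \<times> nat, 'k::field) mpoly ring) (lss_ideal n d E) \<longleftrightarrow>
    (\<exists>F u v. tree {1..n} F \<and> max_degree {1..n} F \<le> d \<and>
       u \<in> {1..n} \<and> v \<in> {1..n} \<and> u \<noteq> v \<and> {u, v} \<notin> F \<and> E = insert {u, v} F) \<or>
    (\<exists>V\<^sub>H E\<^sub>H V\<^sub>U E\<^sub>U u v.
       V\<^sub>H \<inter> V\<^sub>U = {} \<and> V\<^sub>H \<union> V\<^sub>U = {1..n} \<and>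
       tree V\<^sub>H E\<^sub>H \<and> max_degree V\<^sub>H E\<^sub>H \<le> d \<and>
       unicyclic V\<^sub>U E\<^sub>U \<and> max_degree V\<^sub>U E\<^sub>U \<le> d \<and>
       u \<in> V\<^sub>H \<and> v \<in> V\<^sub>U \<and> E = insert {u, v} (E\<^sub>H \<union> E\<^sub>U))"
  unfolding forms_iff_edge_removal[OF assms(2,3)]
proof
  let ?V = "{1..n}" and ?L = "lss_ideal n d E :: (nat \<times> nat, 'k) mpoly set"
  have sg: "simple_graph ?V E" and V: "finite ?V" "?V \<noteq> {}"
    using assms(2) by (auto simp: connected_graph_def)
  have finE: "finite E" by (rule simple_graph_finite[OF sg])
  have d1: "d \<ge> 1" using assms(1) by simp
  have "\<not> max_degree ?V E \<le> d" using assms(5) by simp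
  then obtain v where v: "v \<in> ?V" "vdegree E v > d"
    unfolding max_degree_le_iff[OF V] by (meson not_le)
  have gens: "min_gens (lss_ring n d) ?L = enat (card E)" by (rule lss_min_gens[OF sg d1])
  {
    assume aci: "almost_complete_intersection (lss_ring n d) ?L"
    show "\<exists>e\<in>E. \<forall>x\<in>?V. vdegree (E - {e}) x \<le> d"
    proof (rule ccontr)
      assume "\<not> ?thesis"
      then have "\<And>e. e \<in> E \<Longrightarrow> \<exists>x\<in>?V. vdegree (E - {e}) x > d" by (meson not_le)
      from obstruction[OF sg assms(4) v this] obtain B
        where B: "B \<subseteq> ?V" "card B * d + card {e \<in> E. e \<inter> B = {}} + 2 \<le> card E" by blast
      have "ideal_height (lss_ring n d) ?L \<le> enat (card E - 2)"
        by (rule lss_height_le[OF sg B(1)]) (use B(2) in simp)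
      moreover have "enat (card E) = ideal_height (lss_ring n d) ?L + 1"
        using aci gens unfolding almost_complete_intersection_def by simp
      ultimately have "enat (card E) \<le> enat (card E - 2) + 1" by (metis add_right_mono)
      then show False using B(2) by (simp add: one_enat_def)
    qed
  next
    assume "\<exists>e\<in>E. \<forall>x\<in>?V. vdegree (E - {e}) x \<le> d"
    then obtain e where e: "e \<in> E" "\<And>x. x \<in> ?V \<Longrightarrow> vdegree (E - {e}) x \<le> d" by blast
    have sgF: "simple_graph ?V (E - {e})" by (rule simple_graph_subset[OF sg]) auto
    have "C = D" if "C \<in> cycles (E - {e})" "D \<in> cycles (E - {e})" for C D
      using that cycles_mono[of "E - {e}" E] assms(3) unfolding unicyclic_def by blast
    then obtain col w where col: "weighted_colouring d (E - {e}) col w"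
      using weighted_colouring_exists[OF sgF _ e(2) assms(1)] by blast
    have "card E = vdegree E v + card {e \<in> E. e \<inter> {v} = {}}"
      unfolding vdegree_def using finE
      by (subst card_Un_disjoint[symmetric]) (auto intro!: arg_cong[of _ _ card])
    then have "ideal_height (lss_ring n d) ?L \<le> enat (card E - 1)"
      using v by (intro lss_height_le[OF sg, of "{v}"]) auto
    then show "almost_complete_intersection (lss_ring n d) ?L"
      by (rule lss_almost_complete_intersection[OF sg e(1) d1 col])
  }
qed

end
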